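(* Let $\mathbf{X}$ be a spherical $\mathbf{G}$-variety over $\mathbb{F}$ all of whose $\mathbf G$-orbits are defined over $\mathbb{F}$. If $\mathbf{X}$ is ordered, has the lifting property with respect to all irreducible smooth complex representations of $\mathbf{G}(\mathbb{F})$, and each $\mathbf{G}$-orbit $\mathbf{Y}$ of $\mathbf{X}$ is multiplicity-free, then $\mathbf{X}$ is multiplicity-free.
   Context: $\mathbb{F}$ is a non-archimedean local field and $\mathbf{G}$ is a quasi-split connected reductive group over $\mathbb{F}$ with Borel subgroup $\mathbf{B}$. A spherical $\mathbf{G}$-variety is a normal $\mathbf{G}$-variety over $\mathbb{F}$ admitting an open dense $\mathbf{B}$-orbit; it has finitely many $\mathbf{G}$-orbits, each of which is again spherical. For a variety $\mathbf{Y}$ over $\mathbb{F}$ write $Y=\mathbf{Y}(\mathbb{F})$ with its natural topology, and let $S(Y)$ be the space of locally constant compactly supported functions $Y\to\mathbb{C}$; if $\mathbf{G}$ acts on $\mathbf{Y}$, then $G=\mathbf{G}(\mathbb{F})$ acts on $S(Y)$ by translation. The closure order on $\mathbf{G}$-orbits of $\mathbf{X}$ is $\mathbf{Y}'\le\mathbf{Y}$ iff $Y'\subseteq\overline{Y}$. $\mathbf{X}$ is called ordered if the closure order is a total order. The spectrum of $\mathbf{Y}$ is the set of irreducible smooth complex representations $\pi$ of $G$ with $\mathrm{Hom}_G(S(Y),\pi)\neq 0$. $\mathbf{Y}$ is multiplicity-free if for every irreducible smooth $\pi$ a non-zero morphism $S(Y)\to\pi$, when it exists, is unique up to a scalar.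 $\mathbf{X}$ has the lifting property with respect to an irreducible smooth representation $\pi$ if: whenever $f\colon S(X)\to\pi$ is a non-zero morphism and $\pi$ is in the spectrum of some $\mathbf{G}$-orbit $\mathbf{Y}$ of $\mathbf X$, then $f$ vanishes on all $\phi\in S(X)$ whose support is contained in $\bigcup_{\mathbf{Y}'>\mathbf{Y}}Y'$. *)

theory Defs
  imports
    "HOL-Analysis.Analysis"
    "HOL-Algebra.Algebraic_Closure_Type"
    "HOL-Algebra.Solvable_Groups"
    "HOL-Algebra.Group_Action"
    "HOL-Algebra.Module"
begin

section \<open>Non-archimedean local fields\<close>

definition absval_topology :: "('f::field \<Rightarrow> real) \<Rightarrow> 'f topology" where
  "absval_topology v = Metric_space.mtopology UNIV (\<lambda>x y. v (x - y))"

definition nonarch_local_field :: "('f::field \<Rightarrow> real) \<Rightarrow> bool" where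
  "nonarch_local_field v \<longleftrightarrow>
     (\<forall>x. v x \<ge> 0) \<and> (\<forall>x. v x = 0 \<longleftrightarrow> x = 0) \<and>
     (\<forall>x y. v (x * y) = v x * v y) \<and>
     (\<forall>x y. v (x + y) \<le> max (v x) (v y)) \<and>
     (\<exists>x. x \<noteq> 0 \<and> v x \<noteq> 1) \<and>
     locally_compact_space (absval_topology v)"


section \<open>Varieties over a field\<close>

text \<open>
  Let F be the field \<open>'f\<close> and K its algebraic closure \<open>'f alg_closure\<close>. A variety over F
  is represented by its set of K-points, the F-Zariski topology on it, and the sheaf of regular
  functions defined over F, viewed as K-valued functions on the K-points. Functions in
  \<open>regs \<X> U\<close> are total; only their values on \<open>U\<close> matter.
  (The name \<open>X\<close> is syntax of HOL-Algebra, and its \<open>closure_of\<close> clashes with the topological one,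
  which is therefore written with its qualified name.)
\<close>

abbreviation base_field :: "'f::field alg_closure set" where
  "base_field \<equiv> range to_ac"

record ('x, 'k) fspace =
  ztop :: "'x topology"
  regs :: "'x set \<Rightarrow> ('x \<Rightarrow> 'k) set"

definition pts :: "('x, 'k) fspace \<Rightarrow> 'x set" where
  "pts \<X> = topspace (ztop \<X>)"

text \<open>
  The space of functions generated by pairs \<open>(U, A)\<close>, where \<open>A\<close> is an algebra of functions
  on \<open>U\<close>: non-vanishing loci of elements of \<open>A\<close> are open, and regular functions are
  locally fractions of elements of some \<open>A\<close>.
\<close>

definition fspace_of :: "('x set \<times> ('x \<Rightarrow> 'k::field) set) set \<Rightarrow> ('x, 'k) fspace" where
  "fspace_of \<C> =
     \<lparr> ztop = topology_generated_by {{x \<in> U. h x \<noteq> 0} | U A h. (U, A) \<in> \<C> \<and> h \<in> A},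
       regs = (\<lambda>V. {f. \<forall>x\<in>V. \<exists>U A h k. (U, A) \<in> \<C> \<and> h \<in> A \<and> k \<in> A \<and> x \<in> U \<and> k x \<noteq> 0 \<and>
                        (\<forall>y \<in> V \<inter> U. k y \<noteq> 0 \<longrightarrow> f y = h y / k y)}) \<rparr>"

definition subvar :: "('x, 'k::field) fspace \<Rightarrow> 'x set \<Rightarrow> ('x, 'k) fspace" where
  "subvar \<X> Y = fspace_of {(U \<inter> Y, regs \<X> U) | U. openin (ztop \<X>) U}"

definition tensors ::
    "('x, 'k::field) fspace \<Rightarrow> ('y, 'k) fspace \<Rightarrow> 'x set \<Rightarrow> 'y set \<Rightarrow> ('x \<times> 'y \<Rightarrow> 'k) set" where
  "tensors \<X> Y U W =
     {(\<lambda>(x, y). \<Sum>i<n. a i x * b i y) | (n::nat) a b. \<forall>i<n. a i \<in> regs \<X> U \<and> b i \<in> regs Y W}"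

definition fprod :: "('x, 'k::field) fspace \<Rightarrow> ('y, 'k) fspace \<Rightarrow> ('x \<times> 'y, 'k) fspace" where
  "fprod \<X> Y =
     fspace_of {(U \<times> W, tensors \<X> Y U W) | U W. openin (ztop \<X>) U \<and> openin (ztop Y) W}"

definition kspan :: "('x \<Rightarrow> 'k::field) set \<Rightarrow> ('x \<Rightarrow> 'k) set" where
  "kspan A = {(\<lambda>x. \<Sum>i<n. c i * f i x) | (n::nat) c f. \<forall>i<n. f i \<in> A}"

definition base_change :: "('x, 'k::field) fspace \<Rightarrow> ('x, 'k) fspace" where
  "base_change \<X> = fspace_of {(U, kspan (regs \<X> U)) | U. openin (ztop \<X>) U}"

abbreviation ktop :: "('x, 'k::field) fspace \<Rightarrow> 'x topology" where
  "ktop \<X> \<equiv> ztop (base_change \<X>)"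

definition morphism ::
    "('x, 'k) fspace \<Rightarrow> ('y, 'k) fspace \<Rightarrow> ('x \<Rightarrow> 'y) \<Rightarrow> bool" where
  "morphism \<X> Y f \<longleftrightarrow>
     continuous_map (ztop \<X>) (ztop Y) f \<and>
     (\<forall>V. openin (ztop Y) V \<longrightarrow> (\<forall>h \<in> regs Y V. h \<circ> f \<in> regs \<X> {x \<in> pts \<X>. f x \<in> V}))"

definition isomorphic :: "('x, 'k) fspace \<Rightarrow> ('y, 'k) fspace \<Rightarrow> bool" where
  "isomorphic \<X> Y \<longleftrightarrow>
     (\<exists>f g. morphism \<X> Y f \<and> morphism Y \<X> g \<and>
            (\<forall>x \<in> pts \<X>. g (f x) = x) \<and> (\<forall>y \<in> pts Y. f (g y) = y))"

inductive_set poly_fun :: "'k::field set \<Rightarrow> ((nat \<Rightarrow> 'k) \<Rightarrow> 'k) set" for R :: "'k set" where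
  const: "c \<in> R \<Longrightarrow> (\<lambda>_. c) \<in> poly_fun R"
| coord: "(\<lambda>x. x i) \<in> poly_fun R"
| add: "p \<in> poly_fun R \<Longrightarrow> q \<in> poly_fun R \<Longrightarrow> (\<lambda>x. p x + q x) \<in> poly_fun R"
| mult: "p \<in> poly_fun R \<Longrightarrow> q \<in> poly_fun R \<Longrightarrow> (\<lambda>x. p x * q x) \<in> poly_fun R"

definition affine_pts :: "nat \<Rightarrow> (nat \<Rightarrow> 'k::field) set" where
  "affine_pts n = {x. \<forall>i\<ge>n. x i = 0}"

definition affine_space :: "nat \<Rightarrow> (nat \<Rightarrow> 'f::field alg_closure, 'f alg_closure) fspace" where
  "affine_space n = fspace_of {(affine_pts n, poly_fun base_field)}"

text \<open>
  \<open>Z\<close> is F-closed and its vanishing ideal over K is generated (equivalently, spanned over K)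
  by polynomials over F. Over an imperfect F the second condition is not automatic.
\<close>

definition closed_over_F :: "nat \<Rightarrow> (nat \<Rightarrow> 'f::field alg_closure) set \<Rightarrow> bool" where
  "closed_over_F n Z \<longleftrightarrow>
     closedin (ztop (affine_space n)) Z \<and>
     (\<forall>p \<in> poly_fun UNIV. (\<forall>z\<in>Z. p z = 0) \<longrightarrow>
        (\<exists>q \<in> kspan {q \<in> poly_fun base_field. \<forall>z\<in>Z. q z = 0}. \<forall>x \<in> affine_pts n. p x = q x))"

definition affine_variety :: "('x, 'f::field alg_closure) fspace \<Rightarrow> bool" where
  "affine_variety \<X> \<longleftrightarrow> (\<exists>n Z. closed_over_F n Z \<and> isomorphic \<X> (subvar (affine_space n) Z))"

text \<open>
  The first two conjuncts say that \<open>regs \<X>\<close> is a sheaf, closed under division by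
  non-vanishing functions, and that non-vanishing loci of regular functions are open.
\<close>

definition variety_over_F :: "('x, 'f::field alg_closure) fspace \<Rightarrow> bool" where
  "variety_over_F \<X> \<longleftrightarrow>
     ztop (subvar \<X> (pts \<X>)) = ztop \<X> \<and>
     (\<forall>U. openin (ztop \<X>) U \<longrightarrow> regs (subvar \<X> (pts \<X>)) U = regs \<X> U) \<and>
     (\<exists>\<U>. finite \<U> \<and> \<Union>\<U> = pts \<X> \<and>
          (\<forall>U\<in>\<U>. openin (ztop \<X>) U \<and> affine_variety (subvar \<X> U))) \<and>
     closedin (ztop (fprod \<X> \<X>)) {(x, x) | x. x \<in> pts \<X>}"

definition subvariety_over_F :: "('x, 'f::field alg_closure) fspace \<Rightarrow> 'x set \<Rightarrow> bool" where
  "subvariety_over_F \<X> Y \<longleftrightarrow>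
     (\<exists>C U. closedin (ztop \<X>) C \<and> openin (ztop \<X>) U \<and> Y = C \<inter> U) \<and>
     variety_over_F (subvar \<X> Y)"

text \<open>All local rings are integrally closed domains; germs are written via representatives.\<close>

definition normal_variety :: "('x, 'k::field) fspace \<Rightarrow> bool" where
  "normal_variety \<X> \<longleftrightarrow>
     (\<forall>x \<in> pts \<X>. \<forall>U. openin (ztop \<X>) U \<and> x \<in> U \<longrightarrow>
        (let vanishes = (\<lambda>f. \<exists>V. openin (ztop \<X>) V \<and> x \<in> V \<and> V \<subseteq> U \<and> (\<forall>y\<in>V. f y = 0)) in
         \<forall>a \<in> regs \<X> U. \<forall>b \<in> regs \<X> U.
           ((\<forall>y\<in>U. a y * b y = 0) \<longrightarrow> vanishes a \<or> vanishes b) \<and>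
           (\<not> vanishes b \<and>
            (\<exists>n c. n > 0 \<and> (\<forall>i<n. c i \<in> regs \<X> U) \<and>
                   (\<forall>y\<in>U. a y ^ n + (\<Sum>i<n. c i y * a y ^ i * b y ^ (n - i)) = 0)) \<longrightarrow>
            (\<exists>V. openin (ztop \<X>) V \<and> x \<in> V \<and> V \<subseteq> U \<and>
                 (\<exists>d \<in> regs \<X> V. \<forall>y\<in>V. a y = d y * b y)))))"

definition rat_pts :: "('x, 'f::field alg_closure) fspace \<Rightarrow> 'x set" where
  "rat_pts \<X> =
     {x \<in> pts \<X>. \<forall>U. openin (ztop \<X>) U \<and> x \<in> U \<longrightarrow> (\<forall>f \<in> regs \<X> U. f x \<in> base_field)}"

definition natural_topology ::
    "('f::field \<Rightarrow> real) \<Rightarrow> ('x, 'f alg_closure) fspace \<Rightarrow> 'x topology" where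
  "natural_topology v \<X> =
     topology_generated_by
       {{x \<in> U \<inter> rat_pts \<X>. f x \<in> to_ac ` S} | U f S.
          openin (ztop \<X>) U \<and> f \<in> regs \<X> U \<and> openin (absval_topology v) S}"


section \<open>Reductive groups and spherical varieties\<close>

record ('g, 'k) alg_group = "'g monoid" +
  variety :: "('g, 'k) fspace"

definition linear_algebraic_group :: "('g, 'f::field alg_closure) alg_group \<Rightarrow> bool" where
  "linear_algebraic_group G \<longleftrightarrow>
     group G \<and> carrier G = pts (variety G) \<and>
     variety_over_F (variety G) \<and> affine_variety (variety G) \<and>
     morphism (fprod (variety G) (variety G)) (variety G) (\<lambda>(g, h). g \<otimes>\<^bsub>G\<^esub> h) \<and>
     morphism (variety G) (variety G) (\<lambda>g. inv\<^bsub>G\<^esub> g) \<and>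
     \<one>\<^bsub>G\<^esub> \<in> rat_pts (variety G)"

definition connected_closed_subgroup ::
    "('g, 'f::field alg_closure) alg_group \<Rightarrow> 'g set \<Rightarrow> bool" where
  "connected_closed_subgroup G H \<longleftrightarrow>
     subgroup H G \<and> closedin (ktop (variety G)) H \<and> connectedin (ktop (variety G)) H"

text \<open>\<open>g\<close> is unipotent iff right translation by \<open>g\<close> on \<open>K[G]\<close> is locally unipotent.\<close>

definition unipotent :: "('g, 'f::field alg_closure) alg_group \<Rightarrow> 'g \<Rightarrow> bool" where
  "unipotent G g \<longleftrightarrow>
     (\<forall>f \<in> regs (base_change (variety G)) (carrier G).
        \<exists>n. \<forall>x \<in> carrier G. ((\<lambda>h y. h (y \<otimes>\<^bsub>G\<^esub> g) - h y) ^^ n) f x = 0)"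

text \<open>Reductivity: the unipotent radical (over K) is trivial.\<close>

definition connected_reductive_group :: "('g, 'f::field alg_closure) alg_group \<Rightarrow> bool" where
  "connected_reductive_group G \<longleftrightarrow>
     linear_algebraic_group G \<and> connected_space (ktop (variety G)) \<and>
     (\<forall>H. connected_closed_subgroup G H \<and> H \<lhd> G \<and> (\<forall>h\<in>H. unipotent G h) \<longrightarrow> H = {\<one>\<^bsub>G\<^esub>})"

definition borel_subgroup :: "('g, 'f::field alg_closure) alg_group \<Rightarrow> 'g set \<Rightarrow> bool" where
  "borel_subgroup G B \<longleftrightarrow>
     connected_closed_subgroup G B \<and> solvable (G\<lparr>carrier := B\<rparr>) \<and>
     (\<forall>H. connected_closed_subgroup G H \<and> solvable (G\<lparr>carrier := H\<rparr>) \<and> B \<subseteq> H \<longrightarrow> H = B)"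

definition borel_subgroup_over_F :: "('g, 'f::field alg_closure) alg_group \<Rightarrow> 'g set \<Rightarrow> bool" where
  "borel_subgroup_over_F G B \<longleftrightarrow> borel_subgroup G B \<and> subvariety_over_F (variety G) B"

definition group_variety ::
    "('g, 'f::field alg_closure) alg_group \<Rightarrow> ('g \<Rightarrow> 'x \<Rightarrow> 'x) \<Rightarrow> ('x, 'f alg_closure) fspace \<Rightarrow> bool"
  where
  "group_variety G act \<X> \<longleftrightarrow>
     variety_over_F \<X> \<and> group_action G (pts \<X>) act \<and>
     morphism (fprod (variety G) \<X>) \<X> (\<lambda>(g, x). act g x)"

definition spherical_variety ::
    "('g, 'f::field alg_closure) alg_group \<Rightarrow> 'g set \<Rightarrow> ('g \<Rightarrow> 'x \<Rightarrow> 'x) \<Rightarrow>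
     ('x, 'f alg_closure) fspace \<Rightarrow> bool" where
  "spherical_variety G B act \<X> \<longleftrightarrow>
     group_variety G act \<X> \<and> normal_variety \<X> \<and>
     (\<exists>x \<in> pts \<X>. openin (ktop \<X>) (orbit (G\<lparr>carrier := B\<rparr>) act x) \<and>
                  Abstract_Topology.closure_of (ktop \<X>) (orbit (G\<lparr>carrier := B\<rparr>) act x) = pts \<X>)"

abbreviation var_orbits ::
    "('g, 'f::field alg_closure) alg_group \<Rightarrow> ('g \<Rightarrow> 'x \<Rightarrow> 'x) \<Rightarrow> ('x, 'f alg_closure) fspace \<Rightarrow>
     'x set set" where
  "var_orbits G act \<X> \<equiv> orbits G (pts \<X>) act"

text \<open>The closure is that of the F-points of the orbit in the natural topology.\<close>

definition closure_order ::
    "('f::field \<Rightarrow> real) \<Rightarrow> ('g, 'f alg_closure) alg_group \<Rightarrow> ('g \<Rightarrow> 'x \<Rightarrow> 'x) \<Rightarrow>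
     ('x, 'f alg_closure) fspace \<Rightarrow> ('x set \<times> 'x set) set" where
  "closure_order v G act \<X> =
     {(Y', Y). Y' \<in> var_orbits G act \<X> \<and> Y \<in> var_orbits G act \<X> \<and>
        rat_pts (subvar \<X> Y') \<subseteq>
          Abstract_Topology.closure_of (natural_topology v \<X>) (rat_pts (subvar \<X> Y))}"

definition ordered_variety ::
    "('f::field \<Rightarrow> real) \<Rightarrow> ('g, 'f alg_closure) alg_group \<Rightarrow> ('g \<Rightarrow> 'x \<Rightarrow> 'x) \<Rightarrow>
     ('x, 'f alg_closure) fspace \<Rightarrow> bool" where
  "ordered_variety v G act \<X> \<longleftrightarrow> linear_order_on (var_orbits G act \<X>) (closure_order v G act \<X>)"


section \<open>Smooth representations and Schwartz spaces\<close>

abbreviation rat_group :: "('g, 'f::field alg_closure) alg_group \<Rightarrow> ('g, 'f alg_closure) alg_group"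
  where "rat_group G \<equiv> G\<lparr>carrier := rat_pts (variety G)\<rparr>"

abbreviation complex_ring :: "complex ring" where
  "complex_ring \<equiv> ring_of_type_algebra"

definition smooth_rep ::
    "('f::field \<Rightarrow> real) \<Rightarrow> ('g, 'f alg_closure) alg_group \<Rightarrow> (complex, 'v) module \<Rightarrow>
     ('g \<Rightarrow> 'v \<Rightarrow> 'v) \<Rightarrow> bool" where
  "smooth_rep v G M \<rho> \<longleftrightarrow>
     module complex_ring M \<and> group_action (rat_group G) (carrier M) \<rho> \<and>
     (\<forall>g \<in> carrier (rat_group G). \<forall>x \<in> carrier M. \<forall>y \<in> carrier M. \<forall>c.
        \<rho> g (c \<odot>\<^bsub>M\<^esub> x \<oplus>\<^bsub>M\<^esub> y) = c \<odot>\<^bsub>M\<^esub> \<rho> g x \<oplus>\<^bsub>M\<^esub> \<rho> g y) \<and>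
     (\<forall>x \<in> carrier M. openin (natural_topology v (variety G)) (stabilizer (rat_group G) \<rho> x))"

definition irreducible_smooth_rep ::
    "('f::field \<Rightarrow> real) \<Rightarrow> ('g, 'f alg_closure) alg_group \<Rightarrow> (complex, 'v) module \<Rightarrow>
     ('g \<Rightarrow> 'v \<Rightarrow> 'v) \<Rightarrow> bool" where
  "irreducible_smooth_rep v G M \<rho> \<longleftrightarrow>
     smooth_rep v G M \<rho> \<and> carrier M \<noteq> {\<zero>\<^bsub>M\<^esub>} \<and>
     (\<forall>W. submodule W complex_ring M \<and> (\<forall>g \<in> carrier (rat_group G). \<forall>w\<in>W. \<rho> g w \<in> W) \<longrightarrow>
          W = {\<zero>\<^bsub>M\<^esub>} \<or> W = carrier M)"

definition supp :: "'x topology \<Rightarrow> ('x \<Rightarrow> complex) \<Rightarrow> 'x set" where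
  "supp T \<phi> = Abstract_Topology.closure_of T {x \<in> topspace T. \<phi> x \<noteq> 0}"

text \<open>Functions on \<open>topspace T\<close> are represented by their extension by zero.\<close>

definition schwartz :: "'x topology \<Rightarrow> ('x \<Rightarrow> complex) set" where
  "schwartz T =
     {\<phi>. (\<forall>x. x \<notin> topspace T \<longrightarrow> \<phi> x = 0) \<and>
         (\<forall>x \<in> topspace T. \<exists>U. openin T U \<and> x \<in> U \<and> (\<forall>y\<in>U. \<phi> y = \<phi> x)) \<and>
         compactin T (supp T \<phi>)}"

abbreviation Schw :: "('f::field \<Rightarrow> real) \<Rightarrow> ('x, 'f alg_closure) fspace \<Rightarrow> ('x \<Rightarrow> complex) set" where
  "Schw v Y \<equiv> schwartz (natural_topology v Y)"

definition translate ::
    "('g, 'f::field alg_closure) alg_group \<Rightarrow> ('g \<Rightarrow> 'x \<Rightarrow> 'x) \<Rightarrow> ('x, 'f alg_closure) fspace \<Rightarrow>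
     'g \<Rightarrow> ('x \<Rightarrow> complex) \<Rightarrow> 'x \<Rightarrow> complex" where
  "translate G act Y g \<phi> = (\<lambda>y. if y \<in> rat_pts Y then \<phi> (act (inv\<^bsub>G\<^esub> g) y) else 0)"

definition rep_morphism ::
    "('f::field \<Rightarrow> real) \<Rightarrow> ('g, 'f alg_closure) alg_group \<Rightarrow> ('g \<Rightarrow> 'x \<Rightarrow> 'x) \<Rightarrow>
     ('x, 'f alg_closure) fspace \<Rightarrow> (complex, 'v) module \<Rightarrow> ('g \<Rightarrow> 'v \<Rightarrow> 'v) \<Rightarrow>
     (('x \<Rightarrow> complex) \<Rightarrow> 'v) \<Rightarrow> bool" where
  "rep_morphism v G act Y M \<rho> f \<longleftrightarrow>
     (\<forall>\<phi> \<in> Schw v Y. f \<phi> \<in> carrier M) \<and>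
     (\<forall>\<phi> \<in> Schw v Y. \<forall>\<psi> \<in> Schw v Y. \<forall>c.
        f (\<lambda>y. c * \<phi> y + \<psi> y) = c \<odot>\<^bsub>M\<^esub> f \<phi> \<oplus>\<^bsub>M\<^esub> f \<psi>) \<and>
     (\<forall>g \<in> carrier (rat_group G). \<forall>\<phi> \<in> Schw v Y. f (translate G act Y g \<phi>) = \<rho> g (f \<phi>))"

definition nonzero_rep_morphism ::
    "('f::field \<Rightarrow> real) \<Rightarrow> ('g, 'f alg_closure) alg_group \<Rightarrow> ('g \<Rightarrow> 'x \<Rightarrow> 'x) \<Rightarrow>
     ('x, 'f alg_closure) fspace \<Rightarrow> (complex, 'v) module \<Rightarrow> ('g \<Rightarrow> 'v \<Rightarrow> 'v) \<Rightarrow>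
     (('x \<Rightarrow> complex) \<Rightarrow> 'v) \<Rightarrow> bool" where
  "nonzero_rep_morphism v G act Y M \<rho> f \<longleftrightarrow>
     rep_morphism v G act Y M \<rho> f \<and> (\<exists>\<phi> \<in> Schw v Y. f \<phi> \<noteq> \<zero>\<^bsub>M\<^esub>)"

definition spectrum ::
    "('f::field \<Rightarrow> real) \<Rightarrow> ('g, 'f alg_closure) alg_group \<Rightarrow> ('g \<Rightarrow> 'x \<Rightarrow> 'x) \<Rightarrow>
     ('x, 'f alg_closure) fspace \<Rightarrow> ((complex, 'v) module \<times> ('g \<Rightarrow> 'v \<Rightarrow> 'v)) set" where
  "spectrum v G act Y =
     {(M, \<rho>). irreducible_smooth_rep v G M \<rho> \<and> (\<exists>f. nonzero_rep_morphism v G act Y M \<rho> f)}"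

text \<open>
  The type argument is the universe in which the underlying sets of representations live.
  Irreducible smooth representations have countable dimension, so up to isomorphism all of them
  occur as soon as \<open>'v\<close> has at least the cardinality of the continuum.
\<close>

definition multiplicity_free ::
    "'v itself \<Rightarrow> ('f::field \<Rightarrow> real) \<Rightarrow> ('g, 'f alg_closure) alg_group \<Rightarrow> ('g \<Rightarrow> 'x \<Rightarrow> 'x) \<Rightarrow>
     ('x, 'f alg_closure) fspace \<Rightarrow> bool" where
  "multiplicity_free TYPE('v) v G act Y \<longleftrightarrow>
     (\<forall>(M :: (complex, 'v) module) \<rho> f f'.
        irreducible_smooth_rep v G M \<rho> \<and>
        nonzero_rep_morphism v G act Y M \<rho> f \<and> nonzero_rep_morphism v G act Y M \<rho> f' \<longrightarrow>
        (\<exists>c. \<forall>\<phi> \<in> Schw v Y. f' \<phi> = c \<odot>\<^bsub>M\<^esub> f \<phi>))"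

definition lifting_property ::
    "('f::field \<Rightarrow> real) \<Rightarrow> ('g, 'f alg_closure) alg_group \<Rightarrow> ('g \<Rightarrow> 'x \<Rightarrow> 'x) \<Rightarrow>
     ('x, 'f alg_closure) fspace \<Rightarrow> (complex, 'v) module \<Rightarrow> ('g \<Rightarrow> 'v \<Rightarrow> 'v) \<Rightarrow> bool" where
  "lifting_property v G act \<X> M \<rho> \<longleftrightarrow>
     (\<forall>f Y. nonzero_rep_morphism v G act \<X> M \<rho> f \<and> Y \<in> var_orbits G act \<X> \<and>
            (M, \<rho>) \<in> spectrum v G act (subvar \<X> Y) \<longrightarrow>
        (\<forall>\<phi> \<in> Schw v \<X>.
           supp (natural_topology v \<X>) \<phi>
             \<subseteq> (\<Union>Y' \<in> {Y'. (Y, Y') \<in> closure_order v G act \<X> \<and> Y' \<noteq> Y}. rat_pts (subvar \<X> Y'))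
           \<longrightarrow> f \<phi> = \<zero>\<^bsub>M\<^esub>))"

end

theory Submission
  imports Defs
begin

text \<open>
  The proof filters \<open>S(X)\<close> by the closure order. For an orbit \<open>Y\<close> let \<open>up Y\<close> and \<open>above Y\<close> be the
  unions of the \<open>Y'(F)\<close> over \<open>Y' \<ge> Y\<close> and over \<open>Y' > Y\<close>. Both are open in \<open>X(F)\<close> (\<open>openin_up\<close>,
  \<open>openin_above\<close>), and \<open>Y(F)\<close> is closed in \<open>up Y\<close> with complement \<open>above Y\<close>. On the totally
  disconnected, locally compact Hausdorff space \<open>X(F)\<close> this gives the exact sequence
  \<open>0 \<rightarrow> S(above Y) \<rightarrow> S(up Y) \<rightarrow> S(Y) \<rightarrow> 0\<close>, so that a morphism \<open>f\<close> on \<open>S(X)\<close> that vanishes on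
  \<open>S(above Y)\<close> induces a morphism on \<open>S(Y)\<close> (\<open>descend\<close>).

  Every non-zero \<open>f\<close> has a leading orbit \<open>Y\<close>: the largest one with \<open>f\<close> non-zero on \<open>S(up Y)\<close>
  (\<open>leading_stratum\<close>). The induced morphism on \<open>S(Y)\<close> is then non-zero, so \<open>\<pi>\<close> lies in the spectrum
  of \<open>Y\<close>, and the lifting property makes every other non-zero \<open>f'\<close> vanish on \<open>S(above Y)\<close>. By symmetry
  all non-zero morphisms to \<open>\<pi>\<close> share one leading orbit \<open>Y\<close>. Given two of them, multiplicity one
  for \<open>Y\<close> provides a scalar \<open>c\<close> with \<open>f' = c f\<close> on \<open>S(up Y)\<close>. The morphism \<open>f' - c f\<close> vanishes there,
  so its leading orbit is not \<open>Y\<close>; hence it is zero.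

  Three facts about \<open>X(F)\<close> support this argument. It is locally compact, Hausdorff and has a base
  of compact open sets (\<open>l_space_variety\<close>), because affine varieties embed as closed subsets of
  \<open>F\<^sup>n\<close> and the diagonal is closed. The closure of \<open>Y(F)\<close> is the union of the \<open>Y'(F)\<close> with \<open>Y' \<le> Y\<close>
  (\<open>closure_stratum\<close>): orbits are locally closed, and translating by points of \<open>G\<close> over the
  algebraic closure is still compatible with the natural topology in the sense of
  \<open>openin_translate\<close>. Finally, leading orbits exist because there is no infinite ascending chain of
  orbits, which follows from the Baire category theorem on the union of the closures of such a
  chain (\<open>no_ascending_chain\<close>).
\<close>

section \<open>Schwartz functions on l-spaces\<close>

text \<open>
  The l-spaces of Bernstein and Zelevinsky; compactness of the basic open sets is what makes
  characteristic functions of small neighbourhoods Schwartz functions.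
\<close>

definition l_space :: "'a topology \<Rightarrow> bool" where
  "l_space T \<longleftrightarrow> Hausdorff_space T \<and>
     (\<forall>U x. openin T U \<and> x \<in> U \<longrightarrow> (\<exists>K. compactin T K \<and> openin T K \<and> x \<in> K \<and> K \<subseteq> U))"

lemma l_space_compact_open:
  assumes "l_space T" "openin T U" "x \<in> U"
  obtains K where "compactin T K" "openin T K" "x \<in> K" "K \<subseteq> U"
  using assms unfolding l_space_def by blast

lemma l_space_compact_closed: "l_space T \<Longrightarrow> compactin T K \<Longrightarrow> closedin T K"
  unfolding l_space_def using compactin_imp_closedin by blast

lemma l_space_locally_compact:
  assumes "l_space T" shows "locally_compact_space T"
  unfolding locally_compact_space_def
proof
  fix x assume "x \<in> topspace T"
  then obtain K where "compactin T K" "openin T K" "x \<in> K"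
    using assms l_space_compact_open openin_topspace by metis
  then show "\<exists>U K. openin T U \<and> compactin T K \<and> x \<in> U \<and> U \<subseteq> K" by blast
qed

lemma schwartz_outside: "\<phi> \<in> schwartz T \<Longrightarrow> x \<notin> topspace T \<Longrightarrow> \<phi> x = 0"
  unfolding schwartz_def by blast

lemma schwartz_locally_constant:
  assumes "\<phi> \<in> schwartz T" "x \<in> topspace T"
  obtains U c where "openin T U" "x \<in> U" "\<And>y. y \<in> U \<Longrightarrow> \<phi> y = c"
  using assms unfolding schwartz_def by blast

lemma schwartz_compact_supp: "\<phi> \<in> schwartz T \<Longrightarrow> compactin T (supp T \<phi>)"
  unfolding schwartz_def by blast

lemma closedin_nonzero_locus:
  assumes "\<And>x. x \<in> topspace T \<Longrightarrow> \<exists>U c. openin T U \<and> x \<in> U \<and> (\<forall>y\<in>U. \<phi> y = c)"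
  shows "closedin T {x \<in> topspace T. \<phi> x \<noteq> (0::complex)}"
proof -
  have "openin T {x \<in> topspace T. \<phi> x = 0}"
  proof (subst openin_subopen, safe)
    fix x assume x: "x \<in> topspace T" "\<phi> x = 0"
    then obtain U c where "openin T U" "x \<in> U" "\<forall>y\<in>U. \<phi> y = c" using assms by blast
    then show "\<exists>U. openin T U \<and> x \<in> U \<and> U \<subseteq> {x \<in> topspace T. \<phi> x = 0}"
      using x(2) openin_subset[of T U] by (intro exI[of _ U]) auto
  qed
  moreover have "topspace T - {x \<in> topspace T. \<phi> x \<noteq> 0} = {x \<in> topspace T. \<phi> x = 0}" by auto
  ultimately show ?thesis unfolding closedin_def by auto
qed

text \<open>
  A locally constant function has a clopen non-vanishing locus, so its support needs no closure.
  From here on supports of Schwartz functions are handled pointwise.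
\<close>

lemma supp_schwartz:
  assumes "\<phi> \<in> schwartz T"
  shows "supp T \<phi> = {x. \<phi> x \<noteq> 0}"
proof -
  have "closedin T {x \<in> topspace T. \<phi> x \<noteq> 0}"
    by (rule closedin_nonzero_locus) (metis assms schwartz_locally_constant)
  then have "supp T \<phi> = {x \<in> topspace T. \<phi> x \<noteq> 0}"
    unfolding supp_def by (rule closure_of_closedin)
  then show ?thesis using schwartz_outside[OF assms] by auto
qed

lemma schwartzI:
  assumes "\<And>x. x \<notin> topspace T \<Longrightarrow> \<phi> x = 0"
    and lc: "\<And>x. x \<in> topspace T \<Longrightarrow> \<exists>U c. openin T U \<and> x \<in> U \<and> (\<forall>y\<in>U. \<phi> y = c)"
    and C: "compactin T C" "\<And>x. \<phi> x \<noteq> 0 \<Longrightarrow> x \<in> C"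
  shows "\<phi> \<in> schwartz T"
proof -
  have cl: "closedin T {x \<in> topspace T. \<phi> x \<noteq> 0}" by (rule closedin_nonzero_locus[OF lc])
  then have "supp T \<phi> = {x \<in> topspace T. \<phi> x \<noteq> 0}"
    unfolding supp_def by (rule closure_of_closedin)
  moreover have "compactin T {x \<in> topspace T. \<phi> x \<noteq> 0}"
    by (rule closed_compactin[OF C(1) _ cl]) (use C(2) in auto)
  moreover have "\<exists>U. openin T U \<and> x \<in> U \<and> (\<forall>y\<in>U. \<phi> y = \<phi> x)" if "x \<in> topspace T" for x
    using lc[OF that] by metis
  ultimately show ?thesis using assms(1) unfolding schwartz_def by auto
qed

lemma schwartz_lincomb:
  assumes "\<phi> \<in> schwartz T" "\<psi> \<in> schwartz T"
  shows "(\<lambda>y. c * \<phi> y + \<psi> y) \<in> schwartz T"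
proof (rule schwartzI)
  show "compactin T (supp T \<phi> \<union> supp T \<psi>)"
    using assms schwartz_compact_supp compactin_Un by blast
  show "x \<in> supp T \<phi> \<union> supp T \<psi>" if "c * \<phi> x + \<psi> x \<noteq> 0" for x
    using that by (auto simp: supp_schwartz[OF assms(1)] supp_schwartz[OF assms(2)])
  show "c * \<phi> x + \<psi> x = 0" if "x \<notin> topspace T" for x
    using that schwartz_outside assms by (metis add_0 mult_zero_right)
  fix x assume x: "x \<in> topspace T"
  obtain U a where U: "openin T U" "x \<in> U" "\<And>y. y \<in> U \<Longrightarrow> \<phi> y = a"
    using schwartz_locally_constant[OF assms(1) x] by blast
  obtain V b where V: "openin T V" "x \<in> V" "\<And>y. y \<in> V \<Longrightarrow> \<psi> y = b"
    using schwartz_locally_constant[OF assms(2) x] by blast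
  show "\<exists>U d. openin T U \<and> x \<in> U \<and> (\<forall>y\<in>U. c * \<phi> y + \<psi> y = d)"
    by (rule exI[of _ "U \<inter> V"], rule exI[of _ "c * a + b"]) (use U V in auto)
qed

lemma schwartz_zero: "(\<lambda>_. 0) \<in> schwartz T"
  by (rule schwartzI[where C = "{}"]) (use openin_topspace in auto)

text \<open>
  The set \<open>C\<close> is closed in \<open>W\<close>, which contains the support of \<open>\<phi>\<close>; so the support of the restriction
  is cut out of a compact set by a closed one.
\<close>

lemma schwartz_restrict:
  assumes \<phi>: "\<phi> \<in> schwartz T" and D: "closedin T D" and W: "supp T \<phi> \<subseteq> W"
    and C: "C = W \<inter> D"
  shows "(\<lambda>x. if x \<in> C then \<phi> x else 0) \<in> schwartz (subtopology T C)"
proof (rule schwartzI)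
  have "compactin T (supp T \<phi> \<inter> D)"
    using compact_Int_closedin[OF schwartz_compact_supp[OF \<phi>] D] .
  then show "compactin (subtopology T C) (supp T \<phi> \<inter> D)"
    using W C by (auto simp: compactin_subtopology)
  show "x \<in> supp T \<phi> \<inter> D" if "(if x \<in> C then \<phi> x else 0) \<noteq> 0" for x
    using that C by (auto simp: supp_schwartz[OF \<phi>] split: if_splits)
  show "(if x \<in> C then \<phi> x else 0) = 0" if "x \<notin> topspace (subtopology T C)" for x
    using that schwartz_outside[OF \<phi>] by auto
  fix x assume x: "x \<in> topspace (subtopology T C)"
  then obtain U a where U: "openin T U" "x \<in> U" "\<And>y. y \<in> U \<Longrightarrow> \<phi> y = a"
    using schwartz_locally_constant[OF \<phi>] by (metis Int_iff topspace_subtopology)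
  show "\<exists>U c. openin (subtopology T C) U \<and> x \<in> U \<and> (\<forall>y\<in>U. (if y \<in> C then \<phi> y else 0) = c)"
  proof (intro exI conjI)
    show "openin (subtopology T C) (U \<inter> C)" using U(1) by (auto simp: openin_subtopology)
  qed (use U x in auto)
qed

text \<open>
  One compact open set is added at a time: overwriting a Schwartz function by a constant on a
  clopen compact set leaves it a Schwartz function.
\<close>

lemma schwartz_glue:
  assumes T: "l_space T" and "finite \<K>"
    and "\<And>K. K \<in> \<K> \<Longrightarrow> compactin T K \<and> openin T K \<and> (\<exists>c. \<forall>y\<in>K \<inter> D. \<psi> y = c)"
  shows "\<exists>\<phi>\<in>schwartz T. (\<forall>x. \<phi> x \<noteq> 0 \<longrightarrow> x \<in> \<Union>\<K>) \<and> (\<forall>y\<in>\<Union>\<K> \<inter> D. \<phi> y = \<psi> y)"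
  using assms(2,3)
proof (induction \<K> rule: finite_induct)
  case empty
  show ?case by (rule bexI[OF _ schwartz_zero]) auto
next
  case (insert K \<K>)
  have "\<exists>\<phi>\<in>schwartz T. (\<forall>x. \<phi> x \<noteq> 0 \<longrightarrow> x \<in> \<Union>\<K>) \<and> (\<forall>y\<in>\<Union>\<K> \<inter> D. \<phi> y = \<psi> y)"
    by (rule insert.IH) (use insert.prems in blast)
  then obtain \<phi> where \<phi>: "\<phi> \<in> schwartz T" "\<forall>x. \<phi> x \<noteq> 0 \<longrightarrow> x \<in> \<Union>\<K>" "\<forall>y\<in>\<Union>\<K> \<inter> D. \<phi> y = \<psi> y"
    by metis
  obtain c where K: "compactin T K" "openin T K" and c: "\<And>y. y \<in> K \<inter> D \<Longrightarrow> \<psi> y = c"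
    using insert.prems[of K] by blast
  define \<phi>' where "\<phi>' = (\<lambda>x. if x \<in> K then c else \<phi> x)"
  have "\<phi>' \<in> schwartz T"
  proof (rule schwartzI)
    show "compactin T (K \<union> supp T \<phi>)" using K(1) schwartz_compact_supp[OF \<phi>(1)] compactin_Un by blast
    show "x \<in> K \<union> supp T \<phi>" if "\<phi>' x \<noteq> 0" for x
      using that by (auto simp: \<phi>'_def supp_schwartz[OF \<phi>(1)] split: if_splits)
    show "\<phi>' x = 0" if "x \<notin> topspace T" for x
      using that K(2) openin_subset schwartz_outside[OF \<phi>(1)] unfolding \<phi>'_def by (metis subsetD)
    fix x assume x: "x \<in> topspace T"
    show "\<exists>U c. openin T U \<and> x \<in> U \<and> (\<forall>y\<in>U. \<phi>' y = c)"
    proof (cases "x \<in> K")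
      case True then show ?thesis using K(2) unfolding \<phi>'_def by auto
    next
      case False
      obtain U a where U: "openin T U" "x \<in> U" "\<And>y. y \<in> U \<Longrightarrow> \<phi> y = a"
        using schwartz_locally_constant[OF \<phi>(1) x] by blast
      have "openin T (U - K)" using U(1) l_space_compact_closed[OF T K(1)] openin_diff by blast
      then show ?thesis using U False unfolding \<phi>'_def by (intro exI[of _ "U - K"]) auto
    qed
  qed
  then show ?case
    by (rule bexI[rotated]) (use \<phi> c in \<open>auto simp: \<phi>'_def\<close>)
qed

text \<open>
  The surjectivity of \<open>S(W) \<rightarrow> S(C)\<close> for \<open>C\<close> closed in an open \<open>W\<close>. Compactly many points of \<open>C\<close>
  matter, and each has a compact open neighbourhood in \<open>W\<close> on whose trace \<open>\<psi>\<close> is constant.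
\<close>

lemma schwartz_extend:
  assumes T: "l_space T" and W: "openin T W"
    and C: "C = W \<inter> D" and \<psi>: "\<psi> \<in> schwartz (subtopology T C)"
  obtains \<phi> where "\<phi> \<in> schwartz T" "supp T \<phi> \<subseteq> W" "\<And>x. x \<in> C \<Longrightarrow> \<phi> x = \<psi> x"
proof -
  let ?S = "supp (subtopology T C) \<psi>"
  have WT: "W \<subseteq> topspace T" using W openin_subset by blast
  have S: "compactin T ?S" "?S \<subseteq> C"
    using schwartz_compact_supp[OF \<psi>] by (auto simp: compactin_subtopology)
  define \<C> where "\<C> = {K. compactin T K \<and> openin T K \<and> K \<subseteq> W \<and> (\<exists>c. \<forall>y\<in>K \<inter> D. \<psi> y = c)}"
  have cover: "?S \<subseteq> \<Union>\<C>"
  proof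
    fix x assume "x \<in> ?S"
    then have x: "x \<in> C" using S by blast
    then have "x \<in> topspace (subtopology T C)" using C WT by auto
    then obtain U a where U: "openin (subtopology T C) U" "x \<in> U" "\<And>y. y \<in> U \<Longrightarrow> \<psi> y = a"
      using schwartz_locally_constant[OF \<psi>] by blast
    then obtain U' where U': "openin T U'" "U = U' \<inter> C" by (auto simp: openin_subtopology)
    have "openin T (U' \<inter> W)" "x \<in> U' \<inter> W" using U' U W C by auto
    then obtain K where K: "compactin T K" "openin T K" "x \<in> K" "K \<subseteq> U' \<inter> W"
      using l_space_compact_open[OF T] by metis
    have "\<forall>y\<in>K \<inter> D. \<psi> y = a" using K(4) U U'(2) C by blast
    then show "x \<in> \<Union>\<C>" using K unfolding \<C>_def by blast
  qed
  have "\<And>U. U \<in> \<C> \<Longrightarrow> openin T U" unfolding \<C>_def by blast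
  with compactinD[OF S(1) _ cover] obtain \<K> where \<K>: "finite \<K>" "\<K> \<subseteq> \<C>" "?S \<subseteq> \<Union>\<K>" by blast
  have "\<exists>\<phi>\<in>schwartz T. (\<forall>x. \<phi> x \<noteq> 0 \<longrightarrow> x \<in> \<Union>\<K>) \<and> (\<forall>y\<in>\<Union>\<K> \<inter> D. \<phi> y = \<psi> y)"
    by (rule schwartz_glue[OF T \<K>(1)]) (use \<K>(2) in \<open>auto simp: \<C>_def\<close>)
  then obtain \<phi> where \<phi>: "\<phi> \<in> schwartz T" "\<forall>x. \<phi> x \<noteq> 0 \<longrightarrow> x \<in> \<Union>\<K>"
    "\<forall>y\<in>\<Union>\<K> \<inter> D. \<phi> y = \<psi> y"
    by metis
  show thesis
  proof
    show "\<phi> \<in> schwartz T" by fact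
    show "supp T \<phi> \<subseteq> W" using \<phi>(2) \<K>(2) by (auto simp: supp_schwartz[OF \<phi>(1)] \<C>_def)
    fix x assume x: "x \<in> C"
    show "\<phi> x = \<psi> x"
    proof (cases "x \<in> \<Union>\<K>")
      case True then show ?thesis using \<phi>(3) x C by blast
    next
      case False
      then have "\<psi> x = 0" using \<K>(3) supp_schwartz[OF \<psi>] by auto
      then show ?thesis using False \<phi>(2) by auto
    qed
  qed
qed

lemma schwartz_push:
  assumes "homeomorphic_maps T T h k" "\<phi> \<in> schwartz T"
  shows "(\<lambda>y. if y \<in> topspace T then \<phi> (k y) else 0) \<in> schwartz T"
proof (rule schwartzI)
  have hk: "continuous_map T T h" "continuous_map T T k"
    "\<And>x. x \<in> topspace T \<Longrightarrow> k (h x) = x" "\<And>x. x \<in> topspace T \<Longrightarrow> h (k x) = x"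
    using assms(1) by (auto simp: homeomorphic_maps_def)
  show "compactin T (h ` supp T \<phi>)"
    using image_compactin[OF schwartz_compact_supp[OF assms(2)] hk(1)] .
  show "y \<in> h ` supp T \<phi>" if "(if y \<in> topspace T then \<phi> (k y) else 0) \<noteq> 0" for y
  proof -
    from that have "y \<in> topspace T" "\<phi> (k y) \<noteq> 0" by (auto split: if_splits)
    then show ?thesis using hk(4)[of y] supp_schwartz[OF assms(2)] by force
  qed
  fix x assume x: "x \<in> topspace T"
  then have kx: "k x \<in> topspace T" using hk(2) by (simp add: continuous_map_def Pi_iff)
  obtain U a where U: "openin T U" "k x \<in> U" "\<And>y. y \<in> U \<Longrightarrow> \<phi> y = a"
    using schwartz_locally_constant[OF assms(2) kx] by blast
  have "openin T {y \<in> topspace T. k y \<in> U}" using hk(2) U(1) by (simp add: continuous_map_def)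
  then show "\<exists>U c. openin T U \<and> x \<in> U \<and> (\<forall>y\<in>U. (if y \<in> topspace T then \<phi> (k y) else 0) = c)"
    using x U(2,3) by (intro exI[of _ "{y \<in> topspace T. k y \<in> U}"]) auto
qed auto

section \<open>Permanence properties of l-spaces\<close>

lemma l_space_subtopology_closed:
  assumes T: "l_space T" and C: "closedin T C"
  shows "l_space (subtopology T C)"
  unfolding l_space_def
proof (intro conjI allI impI)
  show "Hausdorff_space (subtopology T C)"
    using T Hausdorff_space_subtopology unfolding l_space_def by blast
  fix U x assume *: "openin (subtopology T C) U \<and> x \<in> U"
  then obtain V where V: "openin T V" "U = V \<inter> C" by (auto simp: openin_subtopology)
  obtain K where K: "compactin T K" "openin T K" "x \<in> K" "K \<subseteq> V"
    by (rule l_space_compact_open[OF T V(1), of x]) (use * V(2) in auto)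
  have "compactin T (K \<inter> C)" using K(1) C by (simp add: compact_Int_closedin)
  then show "\<exists>K. compactin (subtopology T C) K \<and> openin (subtopology T C) K \<and> x \<in> K \<and> K \<subseteq> U"
    using K * V by (intro exI[of _ "K \<inter> C"]) (auto simp: compactin_subtopology openin_subtopology)
qed

lemma l_space_homeomorphic:
  assumes "homeomorphic_maps S T h k" "l_space S"
  shows "l_space T"
  unfolding l_space_def
proof (intro conjI allI impI)
  have hm: "homeomorphic_map S T h" using assms(1) homeomorphic_map_maps by blast
  have "S homeomorphic_space T" using assms(1) unfolding homeomorphic_space_def by blast
  from homeomorphic_Hausdorff_space[OF this] assms(2) show "Hausdorff_space T"
    unfolding l_space_def by simp
  have hk: "continuous_map S T h" "continuous_map T S k" "\<And>y. y \<in> topspace T \<Longrightarrow> h (k y) = y"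
    using assms(1) by (auto simp: homeomorphic_maps_def)
  fix U y assume *: "openin T U \<and> y \<in> U"
  then have U: "U \<subseteq> topspace T" using openin_subset by blast
  let ?V = "{x \<in> topspace S. h x \<in> U}"
  have "openin S ?V" using hk(1) * by (simp add: continuous_map_def)
  moreover have "k y \<in> ?V" using * U hk by (auto simp: continuous_map_def)
  ultimately obtain K where K: "compactin S K" "openin S K" "k y \<in> K" "K \<subseteq> ?V"
    by (rule l_space_compact_open[OF assms(2)])
  have "compactin T (h ` K)" using image_compactin K(1) hk(1) by blast
  moreover have "openin T (h ` K)"
    using homeomorphic_map_openness_eq[OF hm, of "K"] K(2) openin_subset by blast
  moreover have "y \<in> h ` K" using K(3) hk(3)[of y] * U by force
  ultimately show "\<exists>K. compactin T K \<and> openin T K \<and> y \<in> K \<and> K \<subseteq> U" using K(4) by blast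
qed

lemma l_space_locally:
  assumes "Hausdorff_space T"
    and "\<And>x. x \<in> topspace T \<Longrightarrow> \<exists>W. openin T W \<and> x \<in> W \<and> l_space (subtopology T W)"
  shows "l_space T"
  unfolding l_space_def
proof (intro conjI allI impI)
  fix U x assume *: "openin T U \<and> x \<in> U"
  then have "x \<in> topspace T" using openin_subset by blast
  then obtain W where W: "openin T W" "x \<in> W" "l_space (subtopology T W)" using assms(2) by blast
  have "openin (subtopology T W) (U \<inter> W)" using * by (auto simp: openin_subtopology)
  then obtain K where K: "compactin (subtopology T W) K" "openin (subtopology T W) K" "x \<in> K" "K \<subseteq> U \<inter> W"
    using l_space_compact_open[OF W(3), of "U \<inter> W" x] * W(2) by blast
  have "compactin T K" "openin T K"
    using K W(1) by (auto simp: compactin_subtopology openin_open_subtopology)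
  then show "\<exists>K. compactin T K \<and> openin T K \<and> x \<in> K \<and> K \<subseteq> U" using K by blast
qed (rule assms(1))

text \<open>
  Cofinitely many factors have to be compact: a basic open set of the product restricts only
  finitely many coordinates, and in the other ones the whole factor serves as compact open set.
\<close>

lemma l_space_product:
  assumes T: "\<And>i. i \<in> I \<Longrightarrow> l_space (T i)" and fin: "finite {i \<in> I. \<not> compact_space (T i)}"
  shows "l_space (product_topology T I)"
  unfolding l_space_def
proof (intro conjI allI impI)
  show "Hausdorff_space (product_topology T I)"
    using T by (auto simp: Hausdorff_space_product_topology l_space_def)
  fix U x assume *: "openin (product_topology T I) U \<and> x \<in> U"
  from product_topology_open_contains_basis[OF conjunct1[OF *] conjunct2[OF *]]
  obtain V where V: "x \<in> Pi\<^sub>E I V" "\<forall>i. openin (T i) (V i)"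
      "finite {i. V i \<noteq> topspace (T i)}" "Pi\<^sub>E I V \<subseteq> U"
    by (elim exE conjE) (rule that)
  have "\<exists>K. compactin (T i) K \<and> openin (T i) K \<and> x i \<in> K \<and> K \<subseteq> V i \<and>
      (compact_space (T i) \<and> V i = topspace (T i) \<longrightarrow> K = topspace (T i))" if "i \<in> I" for i
  proof (cases "compact_space (T i) \<and> V i = topspace (T i)")
    case True
    then show ?thesis using V(1) that by (auto simp: compact_space_def)
  next
    case False
    then show ?thesis using l_space_compact_open[OF T[OF that] V(2)[rule_format], of "x i"] V(1) that
      by (metis PiE_mem)
  qed
  then obtain K where K: "\<And>i. i \<in> I \<Longrightarrow> compactin (T i) (K i) \<and> openin (T i) (K i) \<and> x i \<in> K i \<and> K i \<subseteq> V i \<and>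
      (compact_space (T i) \<and> V i = topspace (T i) \<longrightarrow> K i = topspace (T i))"
    by metis
  have "finite {i \<in> I. K i \<noteq> topspace (T i)}"
    by (rule finite_subset[OF _ finite_UnI[OF fin V(3)]]) (use K in blast)
  then have "openin (product_topology T I) (Pi\<^sub>E I K)"
    using K by (auto simp: openin_PiE_gen)
  moreover have "compactin (product_topology T I) (Pi\<^sub>E I K)" using K by (auto simp: compactin_PiE)
  moreover have "x \<in> Pi\<^sub>E I K" using K V(1) by (auto simp: PiE_iff)
  moreover have "Pi\<^sub>E I K \<subseteq> Pi\<^sub>E I V" by (rule PiE_mono) (use K in auto)
  then have "Pi\<^sub>E I K \<subseteq> U" using V(4) by simp
  ultimately show "\<exists>K. compactin (product_topology T I) K \<and> openin (product_topology T I) K \<and> x \<in> K \<and> K \<subseteq> U"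
    by blast
qed

section \<open>Continuity of functions with values in a local field\<close>

locale local_field =
  fixes v :: "'f::field \<Rightarrow> real"
  assumes nonarch: "nonarch_local_field v"
begin

lemma v_nonneg [simp]: "0 \<le> v x" and v_eq_0 [simp]: "v x = 0 \<longleftrightarrow> x = 0"
  and v_mult: "v (x * y) = v x * v y" and v_add: "v (x + y) \<le> max (v x) (v y)"
  using nonarch unfolding nonarch_local_field_def by blast+

lemma v_0 [simp]: "v 0 = 0" by simp

lemma v_1 [simp]: "v 1 = 1"
proof -
  have "v 1 * v 1 = v 1" using v_mult[of 1 1] by simp
  moreover have "v 1 \<noteq> 0" by simp
  ultimately show ?thesis by simp
qed

lemma v_minus_1: "v (- 1) = 1"
proof -
  have "v (-1) * v (-1) = 1" using v_mult[of "-1" "-1"] by simp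
  then have "(v (-1))\<^sup>2 = 1" by (simp add: power2_eq_square)
  then show ?thesis using v_nonneg[of "-1"] by (auto simp: power2_eq_1_iff)
qed

lemma v_minus [simp]: "v (- x) = v x"
  using v_mult[of "-1" x] v_minus_1 by simp

lemma v_diff_commute: "v (x - y) = v (y - x)"
  using v_minus[of "x - y"] by simp

lemma v_pos: "x \<noteq> 0 \<Longrightarrow> 0 < v x"
  using v_nonneg v_eq_0 by (metis less_le)

lemma metric_absval: "Metric_space UNIV (\<lambda>x y. v (x - y))"
proof
  fix x y z
  show "v (x - z) \<le> v (x - y) + v (y - z)"
    using v_add[of "x - y" "y - z"] v_nonneg[of "x - y"] v_nonneg[of "y - z"]
    by (simp only: diff_add_cancel add_diff_eq)
qed (simp_all add: v_diff_commute)

interpretation M: Metric_space UNIV "\<lambda>x y. v (x - y)" by (rule metric_absval)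

abbreviation FT :: "'f topology" where "FT \<equiv> absval_topology v"

lemma topspace_FT [simp]: "topspace FT = UNIV"
  unfolding absval_topology_def by simp

lemma continuous_map_FT_iff:
  "continuous_map T FT f \<longleftrightarrow>
    (\<forall>x\<in>topspace T. \<forall>e>0. \<exists>U. openin T U \<and> x \<in> U \<and> (\<forall>y\<in>U. v (f y - f x) < e))"
  unfolding absval_topology_def M.continuous_map_to_metric
  by (simp add: M.in_mball v_diff_commute)

lemma continuous_map_FT_D:
  assumes "continuous_map T FT f" "x \<in> topspace T" "e > 0"
  obtains U where "openin T U" "x \<in> U" "\<And>y. y \<in> U \<Longrightarrow> v (f y - f x) < e"
  using assms unfolding continuous_map_FT_iff by meson

lemma continuous_map_FT_add:
  assumes "continuous_map T FT f" "continuous_map T FT g"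
  shows "continuous_map T FT (\<lambda>x. f x + g x)"
  unfolding continuous_map_FT_iff
proof (intro ballI allI impI)
  fix x and e :: real assume x: "x \<in> topspace T" "e > 0"
  obtain U where U: "openin T U" "x \<in> U" "\<And>y. y \<in> U \<Longrightarrow> v (f y - f x) < e"
    using continuous_map_FT_D[OF assms(1) x] by blast
  obtain V where V: "openin T V" "x \<in> V" "\<And>y. y \<in> V \<Longrightarrow> v (g y - g x) < e"
    using continuous_map_FT_D[OF assms(2) x] by blast
  have "v (f y + g y - (f x + g x)) < e" if "y \<in> U \<inter> V" for y
  proof -
    have "f y + g y - (f x + g x) = (f y - f x) + (g y - g x)" by simp
    then show ?thesis using v_add[of "f y - f x" "g y - g x"] U(3)[of y] V(3)[of y] that
      by (metis IntE le_less_trans max_less_iff_conj)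
  qed
  then show "\<exists>U. openin T U \<and> x \<in> U \<and> (\<forall>y\<in>U. v (f y + g y - (f x + g x)) < e)"
    using U V by (intro exI[of _ "U \<inter> V"]) auto
qed

lemma continuous_map_FT_mult:
  assumes "continuous_map T FT f" "continuous_map T FT g"
  shows "continuous_map T FT (\<lambda>x. f x * g x)"
  unfolding continuous_map_FT_iff
proof (intro ballI allI impI)
  fix x and e :: real assume x: "x \<in> topspace T" and e: "e > 0"
  \<comment> \<open>The bound \<open>1\<close> keeps \<open>f y\<close> within \<open>1 + v (f x)\<close>.\<close>
  define d where "d = min 1 (e / (1 + v (f x) + v (g x)))"
  have D: "0 < 1 + v (f x) + v (g x)" using v_nonneg[of "f x"] v_nonneg[of "g x"] by linarith
  have d: "d > 0" "d \<le> 1" using e D by (auto simp: d_def)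
  have "d \<le> e / (1 + v (f x) + v (g x))" by (simp add: d_def)
  then have de: "d * (1 + v (f x) + v (g x)) \<le> e" using D by (simp add: pos_le_divide_eq)
  then have de': "d + d * v (f x) + d * v (g x) \<le> e" by (simp add: algebra_simps)
  have nn: "0 \<le> d * v (f x)" "0 \<le> d * v (g x)" using d(1) by simp_all
  obtain U where U: "openin T U" "x \<in> U" "\<And>y. y \<in> U \<Longrightarrow> v (f y - f x) < d"
    using continuous_map_FT_D[OF assms(1) x d(1)] by blast
  obtain V where V: "openin T V" "x \<in> V" "\<And>y. y \<in> V \<Longrightarrow> v (g y - g x) < d"
    using continuous_map_FT_D[OF assms(2) x d(1)] by blast
  have "v (f y * g y - f x * g x) < e" if "y \<in> U \<inter> V" for y
  proof -
    let ?a = "f y - f x" and ?b = "g y - g x"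
    have ab: "v ?a < d" "v ?b < d" using U(3) V(3) that by auto
    have "v (f y) \<le> max (v ?a) (v (f x))" using v_add[of ?a "f x"] by simp
    then have fy: "v (f y) \<le> 1 + v (f x)" using ab(1) d(2) v_nonneg[of "f x"] by linarith
    have "f y * g y - f x * g x = f y * ?b + ?a * g x" by (simp add: algebra_simps)
    then have "v (f y * g y - f x * g x) \<le> max (v (f y) * v ?b) (v ?a * v (g x))"
      using v_add[of "f y * ?b" "?a * g x"] by (simp add: v_mult)
    moreover have "v (f y) * v ?b \<le> (1 + v (f x)) * v ?b"
      using fy by (simp add: mult_right_mono)
    moreover have "(1 + v (f x)) * v ?b < (1 + v (f x)) * d"
      using ab(2) v_nonneg[of "f x"] by (intro mult_strict_left_mono) linarith+
    moreover have "(1 + v (f x)) * d \<le> e" using nn de' by (simp only: distrib_left mult.commute[of _ d] mult_1_right)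
    moreover have "v ?a * v (g x) \<le> d * v (g x)" using ab(1) by (simp add: mult_right_mono)
    moreover have "d * v (g x) < e" using de' nn d(1) by linarith
    ultimately show ?thesis by linarith
  qed
  then show "\<exists>U. openin T U \<and> x \<in> U \<and> (\<forall>y\<in>U. v (f y * g y - f x * g x) < e)"
    using U V by (intro exI[of _ "U \<inter> V"]) auto
qed

lemma continuous_map_FT_inverse:
  assumes "continuous_map T FT f" "\<And>x. x \<in> topspace T \<Longrightarrow> f x \<noteq> 0"
  shows "continuous_map T FT (\<lambda>x. inverse (f x))"
  unfolding continuous_map_FT_iff
proof (intro ballI allI impI)
  fix x and e :: real assume x: "x \<in> topspace T" and e: "e > 0"
  have fx: "f x \<noteq> 0" "v (f x) > 0" using assms(2)[OF x] v_pos by auto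
  \<comment> \<open>Below \<open>v (f x)\<close> the ultrametric inequality keeps \<open>f y\<close> at least as large as \<open>f x\<close>.\<close>
  define d where "d = min (v (f x)) (e * (v (f x))\<^sup>2)"
  have d: "d > 0" "d \<le> v (f x)" "d \<le> e * (v (f x))\<^sup>2" using fx e by (auto simp: d_def)
  obtain U where U: "openin T U" "x \<in> U" "\<And>y. y \<in> U \<Longrightarrow> v (f y - f x) < d"
    using continuous_map_FT_D[OF assms(1) x d(1)] by blast
  have "v (inverse (f y) - inverse (f x)) < e" if y: "y \<in> U" for y
  proof -
    have "v (f x) \<le> max (v (f x - f y)) (v (f y))" using v_add[of "f x - f y" "f y"] by simp
    then have ge: "v (f x) \<le> v (f y)"
      using U(3)[OF y] d(2) v_diff_commute[of "f x" "f y"] by (simp add: max_def split: if_splits)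
    then have fy: "f y \<noteq> 0" using fx by auto
    have "(inverse (f y) - inverse (f x)) * (f x * f y) = f x - f y"
      using fx fy by (simp add: field_simps)
    then have *: "v (inverse (f y) - inverse (f x)) * (v (f x) * v (f y)) = v (f y - f x)"
      by (metis v_mult v_diff_commute)
    have "v (inverse (f y) - inverse (f x)) * (v (f x) * v (f x))
        \<le> v (inverse (f y) - inverse (f x)) * (v (f x) * v (f y))"
      using ge by (intro mult_left_mono) auto
    also have "\<dots> < e * (v (f x) * v (f x))"
      using * U(3)[OF y] d(3) by (simp add: power2_eq_square)
    finally show ?thesis using fx by (simp add: mult_less_cancel_right)
  qed
  then show "\<exists>U. openin T U \<and> x \<in> U \<and> (\<forall>y\<in>U. v (inverse (f y) - inverse (f x)) < e)"
    using U by blast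
qed

lemma l_space_FT: "l_space FT"
  unfolding l_space_def
proof (intro conjI allI impI)
  show "Hausdorff_space FT" unfolding absval_topology_def by (rule M.Hausdorff_space_mtopology)
  fix U x assume *: "openin FT U \<and> x \<in> U"
  obtain r where r: "r > 0" "M.mball x r \<subseteq> U"
    using * unfolding absval_topology_def M.openin_mtopology by blast
  have "locally_compact_space FT" using nonarch unfolding nonarch_local_field_def by blast
  then have "\<exists>V L. openin FT V \<and> compactin FT L \<and> x \<in> V \<and> V \<subseteq> L"
    unfolding locally_compact_space_def by simp
  then obtain V L where L: "openin FT V" "compactin FT L" "x \<in> V" "V \<subseteq> L" by metis
  obtain s where s: "s > 0" "M.mball x s \<subseteq> V"
    using L(1,3) unfolding absval_topology_def M.openin_mtopology by blast
  let ?K = "M.mball x (min r s)"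
  have op: "openin FT ?K" unfolding absval_topology_def by (rule M.openin_mball)
  \<comment> \<open>By the ultrametric inequality every open ball is closed.\<close>
  have "openin FT (UNIV - ?K)"
    unfolding absval_topology_def M.openin_mtopology
  proof (intro conjI allI impI exI)
    fix y assume y: "y \<in> UNIV - ?K"
    show "0 < min r s" using r s by simp
    show "M.mball y (min r s) \<subseteq> UNIV - ?K"
    proof
      fix z assume z: "z \<in> M.mball y (min r s)"
      have "v (x - y) \<le> max (v (x - z)) (v (z - y))" using v_add[of "x - z" "z - y"] by simp
      then show "z \<in> UNIV - ?K" using y z v_diff_commute[of z y] by (auto simp: M.in_mball max_def split: if_splits)
    qed
  qed simp
  then have "closedin FT ?K" by (simp add: closedin_def)
  then have "compactin FT ?K"
    by (rule closed_compactin[OF L(2), rotated]) (use s L in \<open>auto simp: M.in_mball\<close>)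
  moreover have "x \<in> ?K" "?K \<subseteq> U" using r s by (auto simp: M.in_mball)
  ultimately show "\<exists>K. compactin FT K \<and> openin FT K \<and> x \<in> K \<and> K \<subseteq> U" using op by blast
qed

text \<open>
  Regular functions take values in the algebraic closure \<open>K\<close>, but on rational points they land in
  the image of \<open>F\<close>. This is continuity of such a function for the topology of \<open>F\<close>.
\<close>

definition F_continuous :: "'x topology \<Rightarrow> ('x \<Rightarrow> 'f alg_closure) \<Rightarrow> bool" where
  "F_continuous T f \<longleftrightarrow>
     (\<exists>g. continuous_map T FT g \<and> (\<forall>x\<in>topspace T. f x = to_ac (g x)))"

lemma F_continuousE:
  assumes "F_continuous T f"
  obtains g where "continuous_map T FT g" "\<And>x. x \<in> topspace T \<Longrightarrow> f x = to_ac (g x)"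
  using assms unfolding F_continuous_def by blast

lemma F_continuous_base: "F_continuous T f \<Longrightarrow> x \<in> topspace T \<Longrightarrow> f x \<in> base_field"
  unfolding F_continuous_def by blast

lemma F_continuous_cong:
  assumes "F_continuous T f" "\<And>x. x \<in> topspace T \<Longrightarrow> f' x = f x"
  shows "F_continuous T f'"
  using assms unfolding F_continuous_def by metis

lemma F_continuous_const: "c \<in> base_field \<Longrightarrow> F_continuous T (\<lambda>_. c)"
  unfolding F_continuous_def by (elim imageE, intro exI[of _ "\<lambda>_. _"]) auto

lemma F_continuous_add:
  "F_continuous T f \<Longrightarrow> F_continuous T g \<Longrightarrow> F_continuous T (\<lambda>x. f x + g x)"
  by (elim F_continuousE, unfold F_continuous_def)
    (intro exI conjI, erule (1) continuous_map_FT_add, simp)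

lemma F_continuous_mult:
  "F_continuous T f \<Longrightarrow> F_continuous T g \<Longrightarrow> F_continuous T (\<lambda>x. f x * g x)"
  by (elim F_continuousE, unfold F_continuous_def)
    (intro exI conjI, erule (1) continuous_map_FT_mult, simp)

lemma F_continuous_inverse:
  assumes "F_continuous T f" "\<And>x. x \<in> topspace T \<Longrightarrow> f x \<noteq> 0"
  shows "F_continuous T (\<lambda>x. inverse (f x))"
proof -
  obtain g where g: "continuous_map T FT g" "\<And>x. x \<in> topspace T \<Longrightarrow> f x = to_ac (g x)"
    using assms(1) unfolding F_continuous_def by blast
  then have "continuous_map T FT (\<lambda>x. inverse (g x))"
    using assms(2) by (intro continuous_map_FT_inverse) auto
  then show ?thesis using g(2) unfolding F_continuous_def by auto
qed

lemma F_continuous_divide: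
  assumes "F_continuous T f" "F_continuous T g" "\<And>x. x \<in> topspace T \<Longrightarrow> g x \<noteq> 0"
  shows "F_continuous T (\<lambda>x. f x / g x)"
  using F_continuous_mult[OF assms(1) F_continuous_inverse[OF assms(2,3)]] by (simp add: divide_inverse)

lemma base_field_0: "0 \<in> base_field" by (metis to_ac_0 rangeI)
lemma base_field_1: "1 \<in> base_field" by (metis to_ac_1 rangeI)

lemma F_continuous_sum:
  "(\<And>i. i < (n::nat) \<Longrightarrow> F_continuous T (f i)) \<Longrightarrow> F_continuous T (\<lambda>x. \<Sum>i<n. f i x)"
proof (induction n)
  case 0
  then show ?case using F_continuous_const[OF base_field_0] by simp
next
  case (Suc n)
  then show ?case using F_continuous_add[of T "\<lambda>x. \<Sum>i<n. f i x" "f n"] by simp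
qed

lemma F_continuous_openin:
  assumes "F_continuous T f" "openin FT S"
  shows "openin T {x \<in> topspace T. f x \<in> to_ac ` S}"
proof -
  obtain g where g: "continuous_map T FT g" "\<And>x. x \<in> topspace T \<Longrightarrow> f x = to_ac (g x)"
    using assms(1) unfolding F_continuous_def by blast
  have "{x \<in> topspace T. f x \<in> to_ac ` S} = {x \<in> topspace T. g x \<in> S}" using g(2) by auto
  then show ?thesis using g(1) assms(2) by (simp add: continuous_map_def)
qed

lemma F_continuousI:
  assumes "\<And>x. x \<in> topspace T \<Longrightarrow> f x \<in> base_field"
    and "\<And>S. openin FT S \<Longrightarrow> openin T {x \<in> topspace T. f x \<in> to_ac ` S}"
  shows "F_continuous T f"
  unfolding F_continuous_def
proof (intro exI conjI ballI)
  have *: "f x = to_ac (of_ac (f x))" if "x \<in> topspace T" for x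
    using assms(1)[OF that] by (simp add: to_ac_of_ac)
  then show "\<And>x. x \<in> topspace T \<Longrightarrow> f x = to_ac (of_ac (f x))" .
  have "{x \<in> topspace T. of_ac (f x) \<in> S} = {x \<in> topspace T. f x \<in> to_ac ` S}" for S
    using * by force
  then show "continuous_map T FT (\<lambda>x. of_ac (f x))"
    using assms(2) by (simp add: continuous_map_def)
qed

lemma F_continuous_nonzero:
  assumes "F_continuous T f" shows "openin T {x \<in> topspace T. f x \<noteq> 0}"
proof -
  have op: "openin FT (UNIV - {0})"
    using l_space_FT closedin_Hausdorff_singleton[of FT 0] unfolding l_space_def closedin_def by simp
  have eq: "{x \<in> topspace T. f x \<noteq> 0} = {x \<in> topspace T. f x \<in> to_ac ` (UNIV - {0})}"
  proof -
    have "f x \<in> to_ac ` (UNIV - {0})" if x: "x \<in> topspace T" "f x \<noteq> 0" for x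
    proof -
      obtain a where "f x = to_ac a" using F_continuous_base[OF assms x(1)] by blast
      then show ?thesis using x(2) by auto
    qed
    then show ?thesis by (intro Collect_cong conj_cong refl) auto
  qed
  show ?thesis unfolding eq by (rule F_continuous_openin[OF assms op])
qed

lemma F_continuous_compose:
  assumes "F_continuous T f" "continuous_map S T h"
  shows "F_continuous S (\<lambda>x. f (h x))"
proof -
  obtain g where g: "continuous_map T FT g" "\<And>x. x \<in> topspace T \<Longrightarrow> f x = to_ac (g x)"
    using assms(1) unfolding F_continuous_def by blast
  have "continuous_map S FT (g \<circ> h)" using assms(2) g(1) continuous_map_compose by blast
  then show ?thesis using g(2) assms(2) unfolding F_continuous_def
    by (intro exI[of _ "g \<circ> h"]) (auto simp: continuous_map_def)
qed

lemma F_continuous_subtopology: "F_continuous T f \<Longrightarrow> F_continuous (subtopology T U) f"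
  unfolding F_continuous_def by (auto intro: continuous_map_from_subtopology)

lemma F_continuous_mono:
  "F_continuous (subtopology T U) f \<Longrightarrow> V \<subseteq> U \<Longrightarrow> F_continuous (subtopology T V) f"
  using F_continuous_subtopology[of "subtopology T U" f V] by (simp add: subtopology_subtopology inf.absorb2)

lemma F_continuous_local:
  assumes "\<And>x. x \<in> topspace T \<Longrightarrow> \<exists>N. openin T N \<and> x \<in> N \<and> F_continuous (subtopology T N) f"
  shows "F_continuous T f"
proof (rule F_continuousI)
  fix x assume x: "x \<in> topspace T"
  then obtain N where "x \<in> N" "F_continuous (subtopology T N) f" using assms by blast
  then show "f x \<in> base_field" using F_continuous_base x by (metis IntI topspace_subtopology)
next
  fix S assume S: "openin FT S"
  show "openin T {x \<in> topspace T. f x \<in> to_ac ` S}"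
  proof (subst openin_subopen, intro ballI)
    fix x assume x: "x \<in> {x \<in> topspace T. f x \<in> to_ac ` S}"
    then obtain N where N: "openin T N" "x \<in> N" "F_continuous (subtopology T N) f" using assms by blast
    let ?A = "{y \<in> topspace (subtopology T N). f y \<in> to_ac ` S}"
    have "openin (subtopology T N) ?A" by (rule F_continuous_openin[OF N(3) S])
    then have "openin T ?A" using N(1) by (simp add: openin_open_subtopology)
    then show "\<exists>A. openin T A \<and> x \<in> A \<and> A \<subseteq> {x \<in> topspace T. f x \<in> to_ac ` S}"
      using x N(2) by (intro exI[of _ ?A]) auto
  qed
qed

lemma F_continuous_poly:
  assumes "p \<in> poly_fun base_field" "\<And>i. F_continuous T (\<lambda>x. e x i)"
  shows "F_continuous T (\<lambda>x. p (e x))"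
  using assms(1)
  by induction (auto intro: F_continuous_const assms(2) F_continuous_add F_continuous_mult)

text \<open>
  The coefficients \<open>a i\<close> are arbitrary elements of \<open>K\<close>, so the sum need not lie in \<open>F\<close>.
  The claim is that \<open>F\<close>-linear subspaces of \<open>F\<^sup>n\<close> are closed. By induction, either the last
  coefficient is an \<open>F\<close>-combination of the others and can be eliminated, or it is \<open>F\<close>-independent of
  them and the sum vanishes only if the last coordinate does.
\<close>

lemma openin_linear_form_nonzero:
  assumes "\<And>i. i < (n::nat) \<Longrightarrow> F_continuous T (b i)"
  shows "openin T {x \<in> topspace T. (\<Sum>i<n. a i * b i x) \<noteq> 0}"
  using assms
proof (induction n arbitrary: b)
  case 0
  then show ?case by simp
next
  case (Suc n)
  show ?case
  proof (cases "\<exists>m. (\<forall>i<n. m i \<in> base_field) \<and> a n = (\<Sum>i<n. a i * m i)")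
    case True
    then obtain m where m: "\<And>i. i < n \<Longrightarrow> m i \<in> base_field" "a n = (\<Sum>i<n. a i * m i)" by blast
    have "(\<Sum>i<Suc n. a i * b i x) = (\<Sum>i<n. a i * (b i x + m i * b n x))" for x
      unfolding sum.lessThan_Suc m(2) by (simp add: sum_distrib_right sum_distrib_left algebra_simps sum.distrib)
    moreover have "F_continuous T (\<lambda>x. b i x + m i * b n x)" if "i < n" for i
      using that Suc.prems m(1) by (intro F_continuous_add F_continuous_mult F_continuous_const) auto
    ultimately show ?thesis using Suc.IH[of "\<lambda>i x. b i x + m i * b n x"] by simp
  next
    case False
    have "(\<Sum>i<Suc n. a i * b i x) \<noteq> 0 \<longleftrightarrow> b n x \<noteq> 0 \<or> (\<Sum>i<n. a i * b i x) \<noteq> 0"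
      if x: "x \<in> topspace T" for x
    proof (cases "b n x = 0")
      case nz: False
      have "(\<Sum>i<Suc n. a i * b i x) \<noteq> 0"
      proof
        assume "(\<Sum>i<Suc n. a i * b i x) = 0"
        then have "a n * b n x = - (\<Sum>i<n. a i * b i x)" by (simp add: eq_neg_iff_add_eq_0 add.commute)
        then have "a n = - (\<Sum>i<n. a i * b i x) / b n x" using nz by (simp add: field_simps)
        also have "\<dots> = (\<Sum>i<n. a i * (- (b i x / b n x)))"
          by (simp add: sum_divide_distrib sum_negf)
        finally have "a n = (\<Sum>i<n. a i * (- (b i x / b n x)))" .
        moreover have "- (b i x / b n x) \<in> base_field" if "i < n" for i
        proof -
          have "b i x \<in> base_field" "b n x \<in> base_field"
            using F_continuous_base[OF Suc.prems x] that by auto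
          then show ?thesis by (metis imageE rangeI to_ac_divide to_ac_minus)
        qed
        ultimately show False using False
          by (elim notE, intro exI[of _ "\<lambda>i. - (b i x / b n x)"]) simp
      qed
      then show ?thesis using nz by simp
    qed simp
    then have "{x \<in> topspace T. (\<Sum>i<Suc n. a i * b i x) \<noteq> 0} =
       {x \<in> topspace T. b n x \<noteq> 0} \<union> {x \<in> topspace T. (\<Sum>i<n. a i * b i x) \<noteq> 0}" by blast
    moreover have "openin T {x \<in> topspace T. b n x \<noteq> 0}"
      by (rule F_continuous_nonzero) (simp add: Suc.prems)
    ultimately show ?thesis using Suc.IH[of b] Suc.prems by (simp add: openin_Un)
  qed
qed

end

section \<open>Rational points and the natural topology\<close>

lemma openin_topology_generated_by_mono:
  assumes "openin (topology_generated_by \<A>) S" "\<And>A. A \<in> \<A> \<Longrightarrow> openin T A"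
  shows "openin T S"
proof -
  have "generate_topology_on \<A> S" using assms(1) by (simp add: openin_topology_generated_by_iff)
  then show ?thesis
  proof induction
    case (UN K)
    then show ?case by (auto intro: openin_Union)
  qed (auto intro: assms(2))
qed

lemma ztop_fspace_of:
  "ztop (fspace_of \<C>) = topology_generated_by {{x \<in> U. h x \<noteq> 0} | U A h. (U, A) \<in> \<C> \<and> h \<in> A}"
  by (simp add: fspace_of_def)

lemma regs_fspace_of:
  "regs (fspace_of \<C>) V = {f. \<forall>x\<in>V. \<exists>U A h k. (U, A) \<in> \<C> \<and> h \<in> A \<and> k \<in> A \<and> x \<in> U \<and> k x \<noteq> 0 \<and>
                        (\<forall>y \<in> V \<inter> U. k y \<noteq> 0 \<longrightarrow> f y = h y / k y)}"
  by (simp add: fspace_of_def)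

lemma ex_family_iff:
  "(\<exists>U A h k. (U, A) \<in> {(a W, b W) |W. Q W} \<and> P U A h k) \<longleftrightarrow> (\<exists>W h k. Q W \<and> P (a W) (b W) h k)"
  "(\<exists>U A h. S = f U h \<and> (U, A) \<in> {(a W, b W) |W. Q W} \<and> h \<in> A) \<longleftrightarrow>
     (\<exists>W h. S = f (a W) h \<and> Q W \<and> h \<in> b W)"
  by (rule iffI; clarsimp; blast)+

lemma ztop_subvar: "ztop (subvar Z Y) =
   topology_generated_by {{x \<in> U \<inter> Y. h x \<noteq> 0} | U h. openin (ztop Z) U \<and> h \<in> regs Z U}"
  unfolding subvar_def ztop_fspace_of ex_family_iff ..

lemma regs_subvar: "f \<in> regs (subvar Z Y) V \<longleftrightarrow>
   (\<forall>x\<in>V. \<exists>U h k. openin (ztop Z) U \<and> h \<in> regs Z U \<and> k \<in> regs Z U \<and> x \<in> U \<inter> Y \<and> k x \<noteq> 0 \<and>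
          (\<forall>y \<in> V \<inter> (U \<inter> Y). k y \<noteq> 0 \<longrightarrow> f y = h y / k y))"
  unfolding subvar_def regs_fspace_of ex_family_iff by (rule mem_Collect_eq)

text \<open>
  The part of the definition of a variety that makes regular functions a sheaf closed under
  division. It holds for affine space as well, so the lemmas below apply to both.
\<close>

definition self_generated :: "('x, 'k::field) fspace \<Rightarrow> bool" where
  "self_generated Z \<longleftrightarrow> ztop (subvar Z (pts Z)) = ztop Z \<and>
     (\<forall>U. openin (ztop Z) U \<longrightarrow> regs (subvar Z (pts Z)) U = regs Z U)"

lemma variety_self_generated: "variety_over_F Z \<Longrightarrow> self_generated Z"
  unfolding variety_over_F_def self_generated_def by (elim conjE, intro conjI)

lemma openin_pts: "openin (ztop Z) U \<Longrightarrow> U \<subseteq> pts Z"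
  unfolding pts_def by (rule openin_subset)

lemma openin_ztop_pts [simp]: "openin (ztop Z) (pts Z)"
  unfolding pts_def by simp

lemma openin_nonzero_locus:
  assumes "self_generated Z" "openin (ztop Z) U" "h \<in> regs Z U"
  shows "openin (ztop Z) {x \<in> U. h x \<noteq> 0}"
proof -
  have "{x \<in> U. h x \<noteq> 0} = {x \<in> U \<inter> pts Z. h x \<noteq> 0}" using openin_pts[OF assms(2)] by auto
  then have "openin (ztop (subvar Z (pts Z))) {x \<in> U. h x \<noteq> 0}"
    unfolding ztop_subvar by (intro topology_generated_by_Basis) (use assms in blast)
  then show ?thesis using assms(1) unfolding self_generated_def by simp
qed

lemma regs_iff:
  assumes "self_generated Z" "openin (ztop Z) V"
  shows "f \<in> regs Z V \<longleftrightarrow>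
   (\<forall>x\<in>V. \<exists>U h k. openin (ztop Z) U \<and> h \<in> regs Z U \<and> k \<in> regs Z U \<and> x \<in> U \<and> k x \<noteq> 0 \<and>
          (\<forall>y \<in> V \<inter> U. k y \<noteq> 0 \<longrightarrow> f y = h y / k y))"
proof -
  have "f \<in> regs Z V \<longleftrightarrow> f \<in> regs (subvar Z (pts Z)) V"
    using assms unfolding self_generated_def by simp
  moreover have "U \<inter> pts Z = U" if "openin (ztop Z) U" for U using openin_pts[OF that] by blast
  ultimately show ?thesis unfolding regs_subvar by (metis (no_types, lifting))
qed

lemma one_regs:
  assumes Z: "self_generated Z" and V: "openin (ztop Z) V"
  shows "(\<lambda>_. 1) \<in> regs Z V"
  unfolding regs_iff[OF assms]
proof
  fix x assume "x \<in> V"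
  then have "x \<in> topspace (ztop (subvar Z (pts Z)))"
    using Z openin_pts[OF V] unfolding self_generated_def pts_def by auto
  then obtain U h where "openin (ztop Z) U" "h \<in> regs Z U" "x \<in> U" "h x \<noteq> 0"
    unfolding ztop_subvar topology_generated_by_topspace by blast
  then show "\<exists>U h k. openin (ztop Z) U \<and> h \<in> regs Z U \<and> k \<in> regs Z U \<and> x \<in> U \<and> k x \<noteq> 0 \<and>
      (\<forall>y\<in>V \<inter> U. k y \<noteq> 0 \<longrightarrow> 1 = h y / k y)"
    by (intro exI[of _ U] exI[of _ h]) auto
qed

lemma divide_regs:
  assumes Z: "self_generated Z" and U: "openin (ztop Z) U" "h \<in> regs Z U" "k \<in> regs Z U"
    and V: "openin (ztop Z) V" "V \<subseteq> U" "\<And>x. x \<in> V \<Longrightarrow> k x \<noteq> 0"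
  shows "(\<lambda>x. h x / k x) \<in> regs Z V"
  unfolding regs_iff[OF Z V(1)]
  by (intro ballI exI[of _ U] exI[of _ h] exI[of _ k]) (use U V in auto)

lemma ztop_subvar_eq:
  assumes Z: "self_generated Z"
  shows "ztop (subvar Z Y) = subtopology (ztop Z) Y"
  unfolding topology_eq
proof (intro allI iffI)
  fix S assume "openin (ztop (subvar Z Y)) S"
  then show "openin (subtopology (ztop Z) Y) S"
    unfolding ztop_subvar
  proof (rule openin_topology_generated_by_mono, clarify)
    fix U h assume "openin (ztop Z) U" "h \<in> regs Z U"
    then show "openin (subtopology (ztop Z) Y) {x \<in> U \<inter> Y. h x \<noteq> 0}"
      using openin_nonzero_locus[OF Z, of U h] unfolding openin_subtopology
      by (intro exI[of _ "{x \<in> U. h x \<noteq> 0}"]) auto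
  qed
next
  fix S assume "openin (subtopology (ztop Z) Y) S"
  then obtain U where U: "openin (ztop Z) U" "S = U \<inter> Y" by (auto simp: openin_subtopology)
  show "openin (ztop (subvar Z Y)) S" unfolding ztop_subvar
    by (rule topology_generated_by_Basis)
      (use U one_regs[OF Z U(1)] in \<open>auto intro!: exI[of _ U] exI[of _ "\<lambda>_. 1"]\<close>)
qed

lemma restrict_regs:
  assumes Z: "self_generated Z" and U: "openin (ztop Z) U" "f \<in> regs Z U"
  shows "f \<in> regs (subvar Z Y) (U \<inter> Y)"
  unfolding regs_subvar
  by (intro ballI exI[of _ U] exI[of _ f] exI[of _ "\<lambda>_. 1"]) (use U one_regs[OF Z U(1)] in auto)

lemma rat_pts_subset: "rat_pts Z \<subseteq> pts Z"
  unfolding rat_pts_def by blast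

lemma rat_pts_value:
  "x \<in> rat_pts Z \<Longrightarrow> openin (ztop Z) U \<Longrightarrow> x \<in> U \<Longrightarrow> f \<in> regs Z U \<Longrightarrow> f x \<in> base_field"
  unfolding rat_pts_def by blast

lemma base_field_divide: "a \<in> base_field \<Longrightarrow> b \<in> base_field \<Longrightarrow> a / b \<in> base_field"
  by (elim imageE) (simp flip: to_ac_divide)

text \<open>
  A regular function on \<open>Y\<close> is locally a quotient of regular functions on the ambient space,
  and \<open>F\<close> is closed under quotients.
\<close>

lemma rat_pts_subvar:
  assumes Z: "self_generated Z" and Y: "Y \<subseteq> pts Z"
  shows "rat_pts (subvar Z Y) = Y \<inter> rat_pts Z"
proof -
  have pts: "pts (subvar Z Y) = Y"
    using Y unfolding pts_def ztop_subvar_eq[OF Z] by auto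
  show ?thesis
  proof (intro equalityI subsetI)
    fix x assume x: "x \<in> rat_pts (subvar Z Y)"
    then have xY: "x \<in> Y" using pts rat_pts_subset[of "subvar Z Y"] by auto
    have "f x \<in> base_field" if U: "openin (ztop Z) U" "x \<in> U" "f \<in> regs Z U" for U f
    proof (rule rat_pts_value[OF x])
      show "openin (ztop (subvar Z Y)) (U \<inter> Y)"
        using U(1) unfolding ztop_subvar_eq[OF Z] by (auto simp: openin_subtopology)
      show "f \<in> regs (subvar Z Y) (U \<inter> Y)" by (rule restrict_regs[OF Z U(1,3)])
    qed (use U xY in auto)
    then show "x \<in> Y \<inter> rat_pts Z" using xY Y unfolding rat_pts_def by blast
  next
    fix x assume x: "x \<in> Y \<inter> rat_pts Z"
    have "f x \<in> base_field" if V: "openin (ztop (subvar Z Y)) V" "x \<in> V" "f \<in> regs (subvar Z Y) V" for V f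
    proof -
      from V(2,3)[unfolded regs_subvar] obtain U h k where
        U: "openin (ztop Z) U" "h \<in> regs Z U" "k \<in> regs Z U" "x \<in> U" "k x \<noteq> 0" "f x = h x / k x"
        by (metis (no_types, lifting) IntD1 IntI)
      then show ?thesis using x rat_pts_value[of x Z U] by (auto intro: base_field_divide)
    qed
    then show "x \<in> rat_pts (subvar Z Y)" using x unfolding rat_pts_def[of "subvar Z Y"] pts by blast
  qed
qed

context local_field
begin

abbreviation NT :: "('x, 'f alg_closure) fspace \<Rightarrow> 'x topology" where
  "NT \<equiv> natural_topology v"

lemma openin_NT_basic:
  assumes "openin (ztop Z) U" "f \<in> regs Z U" "openin FT S"
  shows "openin (NT Z) {x \<in> U \<inter> rat_pts Z. f x \<in> to_ac ` S}"
  unfolding natural_topology_def by (rule topology_generated_by_Basis) (use assms in blast)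

lemma openin_NT_open:
  assumes Z: "self_generated Z" and U: "openin (ztop Z) U"
  shows "openin (NT Z) (U \<inter> rat_pts Z)"
proof -
  have eq: "U \<inter> rat_pts Z = {x \<in> U \<inter> rat_pts Z. (1::'f alg_closure) \<in> to_ac ` UNIV}"
    using base_field_1 by auto
  have "openin FT UNIV" using openin_topspace[of FT] by simp
  then show ?thesis by (subst eq) (rule openin_NT_basic[OF U one_regs[OF Z U]])
qed

lemma topspace_NT [simp]:
  assumes "self_generated Z" shows "topspace (NT Z) = rat_pts Z"
proof
  show "topspace (NT Z) \<subseteq> rat_pts Z"
    unfolding natural_topology_def topology_generated_by_topspace by blast
  have "openin (NT Z) (pts Z \<inter> rat_pts Z)" by (rule openin_NT_open[OF assms]) simp
  then show "rat_pts Z \<subseteq> topspace (NT Z)" using rat_pts_subset openin_subset by (metis inf.absorb2)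
qed

lemma F_continuous_regs:
  assumes Z: "self_generated Z" and U: "openin (ztop Z) U" "f \<in> regs Z U"
  shows "F_continuous (subtopology (NT Z) U) f"
proof (rule F_continuousI)
  show "f x \<in> base_field" if "x \<in> topspace (subtopology (NT Z) U)" for x
    by (rule rat_pts_value[OF _ U(1) _ U(2)]) (use that topspace_NT[OF Z] in auto)
  fix S assume "openin FT S"
  then have "openin (NT Z) {x \<in> U \<inter> rat_pts Z. f x \<in> to_ac ` S}" by (rule openin_NT_basic[OF U])
  then show "openin (subtopology (NT Z) U) {x \<in> topspace (subtopology (NT Z) U). f x \<in> to_ac ` S}"
    unfolding openin_subtopology topspace_subtopology topspace_NT[OF Z]
    by (intro exI[of _ "{x \<in> U \<inter> rat_pts Z. f x \<in> to_ac ` S}"]) auto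
qed

text \<open>
  A local quotient \<open>h / k\<close> is itself regular on the open set where \<open>k\<close> does not vanish, so passing to
  local quotients on \<open>Y\<close> creates no new open sets.
\<close>

lemma NT_subvar:
  assumes Z: "self_generated Z" and Y: "Y \<subseteq> pts Z"
  shows "NT (subvar Z Y) = subtopology (NT Z) Y"
  unfolding topology_eq
proof (intro allI iffI)
  fix A assume "openin (NT (subvar Z Y)) A"
  then show "openin (subtopology (NT Z) Y) A"
    unfolding natural_topology_def[of v "subvar Z Y"]
  proof (rule openin_topology_generated_by_mono, clarify)
    fix V f S assume V: "openin (ztop (subvar Z Y)) V" and f: "f \<in> regs (subvar Z Y) V" and S: "openin FT S"
    obtain V' where V': "openin (ztop Z) V'" "V = V' \<inter> Y"
      using V unfolding ztop_subvar_eq[OF Z] by (auto simp: openin_subtopology)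
    show "openin (subtopology (NT Z) Y) {x \<in> V \<inter> rat_pts (subvar Z Y). f x \<in> to_ac ` S}" (is "openin _ ?A")
    proof (subst openin_subopen, intro ballI)
      fix x assume x: "x \<in> ?A"
      then have xV: "x \<in> V" "x \<in> rat_pts Z" "x \<in> Y" by (auto simp: rat_pts_subvar[OF Z Y])
      from f[unfolded regs_subvar, rule_format, OF xV(1)] obtain U h k where
        U: "openin (ztop Z) U" "h \<in> regs Z U" "k \<in> regs Z U" "x \<in> U" "k x \<noteq> 0"
        "\<And>y. y \<in> V \<inter> (U \<inter> Y) \<Longrightarrow> k y \<noteq> 0 \<Longrightarrow> f y = h y / k y"
        by blast
      let ?W = "{y \<in> U. k y \<noteq> 0}"
      have W: "openin (ztop Z) ?W" by (rule openin_nonzero_locus[OF Z U(1,3)])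
      have d: "(\<lambda>y. h y / k y) \<in> regs Z ?W" by (rule divide_regs[OF Z U(1-3) W]) auto
      let ?B = "{y \<in> ?W \<inter> rat_pts Z. h y / k y \<in> to_ac ` S} \<inter> (V' \<inter> rat_pts Z)"
      have "openin (NT Z) ?B"
        using openin_NT_basic[OF W d S] openin_NT_open[OF Z V'(1)] by blast
      then have "openin (subtopology (NT Z) Y) (?B \<inter> Y)" unfolding openin_subtopology by blast
      moreover have "x \<in> ?B \<inter> Y" using x U(4-6) V'(2) xV by auto
      moreover have "?B \<inter> Y \<subseteq> ?A" using U(6) V'(2) by (auto simp: rat_pts_subvar[OF Z Y])
      ultimately show "\<exists>B. openin (subtopology (NT Z) Y) B \<and> x \<in> B \<and> B \<subseteq> ?A" by blast
    qed
  qed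
next
  have "continuous_map (NT (subvar Z Y)) (NT Z) id"
    unfolding natural_topology_def[of v Z]
  proof (rule continuous_on_generated_topo)
    fix A assume "A \<in> {{x \<in> U \<inter> rat_pts Z. f x \<in> to_ac ` S} |U f S.
          openin (ztop Z) U \<and> f \<in> regs Z U \<and> openin FT S}"
    then obtain U f S where U: "openin (ztop Z) U" "f \<in> regs Z U" "openin FT S"
        "A = {x \<in> U \<inter> rat_pts Z. f x \<in> to_ac ` S}" by blast
    have "openin (ztop (subvar Z Y)) (U \<inter> Y)"
      using U(1) unfolding ztop_subvar_eq[OF Z] by (auto simp: openin_subtopology)
    then have "openin (NT (subvar Z Y)) {x \<in> U \<inter> Y \<inter> rat_pts (subvar Z Y). f x \<in> to_ac ` S}"
      using openin_NT_basic[OF _ restrict_regs[OF Z U(1,2)] U(3)] by blast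
    then have op: "openin (NT (subvar Z Y)) (A \<inter> Y)"
      unfolding U(4) rat_pts_subvar[OF Z Y] by (rule back_subst[of "openin _"]) auto
    have "topspace (NT (subvar Z Y)) \<subseteq> Y"
      unfolding natural_topology_def topology_generated_by_topspace rat_pts_subvar[OF Z Y] by blast
    then have "id -` A \<inter> topspace (NT (subvar Z Y)) = A \<inter> Y \<inter> topspace (NT (subvar Z Y))" by auto
    then show "openin (NT (subvar Z Y)) (id -` A \<inter> topspace (NT (subvar Z Y)))"
      using op by (simp add: openin_Int)
  next
    have "topspace (NT (subvar Z Y)) \<subseteq> rat_pts Z"
      unfolding natural_topology_def topology_generated_by_topspace rat_pts_subvar[OF Z Y] by blast
    then show "id ` topspace (NT (subvar Z Y)) \<subseteq> \<Union> {{x \<in> U \<inter> rat_pts Z. f x \<in> to_ac ` S} |U f S.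
          openin (ztop Z) U \<and> f \<in> regs Z U \<and> openin FT S}"
      using topspace_NT[OF Z] unfolding natural_topology_def[of v Z] topology_generated_by_topspace by simp
  qed
  moreover fix A assume "openin (subtopology (NT Z) Y) A"
  then obtain B where B: "openin (NT Z) B" "A = B \<inter> Y" by (auto simp: openin_subtopology)
  ultimately have "openin (NT (subvar Z Y)) {x \<in> topspace (NT (subvar Z Y)). x \<in> B}"
    by (simp add: continuous_map_def)
  moreover have "topspace (NT (subvar Z Y)) = Y \<inter> rat_pts Z"
  proof
    show "topspace (NT (subvar Z Y)) \<subseteq> Y \<inter> rat_pts Z"
      unfolding natural_topology_def topology_generated_by_topspace rat_pts_subvar[OF Z Y] by blast
    have "openin (ztop (subvar Z Y)) (pts Z \<inter> Y)"
      unfolding ztop_subvar_eq[OF Z] openin_subtopology using openin_ztop_pts by blast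
    from openin_NT_basic[OF this restrict_regs[OF Z openin_ztop_pts one_regs[OF Z openin_ztop_pts]],
        of UNIV]
    have "openin (NT (subvar Z Y)) {x \<in> pts Z \<inter> Y \<inter> rat_pts (subvar Z Y). (1::'f alg_closure) \<in> range to_ac}"
      using openin_topspace[of FT] by simp
    then have "openin (NT (subvar Z Y)) (Y \<inter> rat_pts Z)"
      unfolding rat_pts_subvar[OF Z Y]
      by (rule back_subst[of "openin _"]) (use base_field_1 Y in auto)
    then show "Y \<inter> rat_pts Z \<subseteq> topspace (NT (subvar Z Y))" by (rule openin_subset)
  qed
  moreover have "B \<subseteq> rat_pts Z" using B(1) openin_subset topspace_NT[OF Z] by blast
  ultimately show "openin (NT (subvar Z Y)) A" unfolding B(2)
    by (elim back_subst[of "openin _"]) auto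
qed

end

section \<open>Affine varieties as closed subspaces of affine space\<close>

lemma ztop_affine: "ztop (affine_space n) =
    topology_generated_by {{x \<in> affine_pts n. h x \<noteq> 0} | h. h \<in> poly_fun base_field}"
  unfolding affine_space_def ztop_fspace_of by (rule arg_cong[of _ _ topology_generated_by]) auto

lemma regs_affine: "f \<in> regs (affine_space n) V \<longleftrightarrow>
   (\<forall>x\<in>V. \<exists>h k. h \<in> poly_fun base_field \<and> k \<in> poly_fun base_field \<and> x \<in> affine_pts n \<and> k x \<noteq> 0 \<and>
          (\<forall>y \<in> V \<inter> affine_pts n. k y \<noteq> 0 \<longrightarrow> f y = h y / k y))"
  unfolding affine_space_def regs_fspace_of by simp

lemma one_poly: "(\<lambda>_. 1) \<in> poly_fun base_field"
  using poly_fun.const[of 1 base_field] to_ac_1 by (metis rangeI)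

lemma pts_affine: "pts (affine_space n) = affine_pts n"
proof
  show "pts (affine_space n) \<subseteq> affine_pts n"
    unfolding pts_def ztop_affine topology_generated_by_topspace by blast
  have "openin (ztop (affine_space n)) {x \<in> affine_pts n. (1::'a alg_closure) \<noteq> 0}"
    unfolding ztop_affine
    by (rule topology_generated_by_Basis, rule CollectI, rule exI[of _ "\<lambda>_. 1"]) (simp add: one_poly)
  then show "affine_pts n \<subseteq> pts (affine_space n :: (nat \<Rightarrow> 'a alg_closure, 'a alg_closure) fspace)"
    using openin_pts by fastforce
qed

lemma openin_affine_basis:
  assumes "openin (ztop (affine_space n)) U" "x \<in> U"
  shows "\<exists>s\<in>poly_fun base_field. s x \<noteq> 0 \<and> {y \<in> affine_pts n. s y \<noteq> 0} \<subseteq> U"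
proof -
  have "generate_topology_on {{x \<in> affine_pts n. h x \<noteq> 0} | h. h \<in> poly_fun base_field} U"
    using assms(1) unfolding ztop_affine by (simp add: openin_topology_generated_by_iff)
  then show ?thesis using assms(2)
  proof (induction arbitrary: x)
    case (Int a b)
    obtain s where s: "s \<in> poly_fun base_field" "s x \<noteq> 0" "{y \<in> affine_pts n. s y \<noteq> 0} \<subseteq> a"
      using Int.IH(1)[of x] Int.prems by auto
    obtain t where t: "t \<in> poly_fun base_field" "t x \<noteq> 0" "{y \<in> affine_pts n. t y \<noteq> 0} \<subseteq> b"
      using Int.IH(2)[of x] Int.prems by auto
    show ?case
      by (rule bexI[of _ "\<lambda>y. s y * t y"]) (use s t in \<open>auto intro: poly_fun.mult\<close>)
  next
    case (UN K)
    then show ?case by (meson Union_iff Union_upper subset_trans)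
  qed auto
qed

text \<open>
  A quotient of quotients of polynomials is again a quotient of polynomials; the work lies in
  choosing a denominator that vanishes wherever one of the intermediate quotients is not defined.
\<close>

lemma self_generated_affine:
  "self_generated (affine_space n :: (nat \<Rightarrow> 'f::field alg_closure, 'f alg_closure) fspace)"
  unfolding self_generated_def
proof (intro conjI allI impI)
  let ?A = "affine_space n :: (nat \<Rightarrow> 'f alg_closure, 'f alg_closure) fspace"
  have basic: "openin (ztop ?A) {x \<in> affine_pts n. h x \<noteq> 0}" if "h \<in> poly_fun base_field" for h
    unfolding ztop_affine by (rule topology_generated_by_Basis) (use that in blast)
  have poly_regs: "h \<in> regs ?A U" if "h \<in> poly_fun base_field" "U \<subseteq> affine_pts n" for h U
    unfolding regs_affine
    by (intro ballI exI[of _ h] exI[of _ "\<lambda>_. 1"]) (use that one_poly in auto)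
  show "ztop (subvar ?A (pts ?A)) = ztop ?A"
    unfolding topology_eq
  proof (intro allI iffI)
    fix S assume "openin (ztop (subvar ?A (pts ?A))) S"
    then show "openin (ztop ?A) S"
      unfolding ztop_subvar
    proof (rule openin_topology_generated_by_mono, clarify)
      fix U f assume U: "openin (ztop ?A) U" and f: "f \<in> regs ?A U"
      show "openin (ztop ?A) {x \<in> U \<inter> pts ?A. f x \<noteq> 0}"
      proof (subst openin_subopen, intro ballI)
        fix x assume x: "x \<in> {x \<in> U \<inter> pts ?A. f x \<noteq> 0}"
        then obtain h k where hk: "h \<in> poly_fun base_field" "k \<in> poly_fun base_field" "k x \<noteq> 0"
          "\<And>y. y \<in> U \<inter> affine_pts n \<Longrightarrow> k y \<noteq> 0 \<Longrightarrow> f y = h y / k y"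
          using f unfolding regs_affine by blast
        let ?W = "U \<inter> {y \<in> affine_pts n. h y \<noteq> 0} \<inter> {y \<in> affine_pts n. k y \<noteq> 0}"
        have "openin (ztop ?A) ?W" using U basic hk by blast
        moreover have "x \<in> ?W" using x hk(3,4) by (force simp: pts_affine)
        moreover have "?W \<subseteq> {x \<in> U \<inter> pts ?A. f x \<noteq> 0}" using hk(4) by (auto simp: pts_affine)
        ultimately show "\<exists>W. openin (ztop ?A) W \<and> x \<in> W \<and> W \<subseteq> {x \<in> U \<inter> pts ?A. f x \<noteq> 0}" by blast
      qed
    qed
  next
    fix S assume "openin (ztop ?A) S"
    then show "openin (ztop (subvar ?A (pts ?A))) S"
      unfolding ztop_affine[of n]
    proof (rule openin_topology_generated_by_mono, clarify)
      fix h :: "(nat \<Rightarrow> 'f alg_closure) \<Rightarrow> 'f alg_closure" assume h: "h \<in> poly_fun base_field"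
      have "{x \<in> affine_pts n. h x \<noteq> 0} \<in>
          {{x \<in> U \<inter> pts ?A. h x \<noteq> 0} |U h. openin (ztop ?A) U \<and> h \<in> regs ?A U}"
        using poly_regs[OF h, of "affine_pts n"] openin_ztop_pts[of ?A] unfolding pts_affine by blast
      then show "openin (ztop (subvar ?A (pts ?A))) {x \<in> affine_pts n. h x \<noteq> 0}"
        unfolding ztop_subvar by (rule topology_generated_by_Basis)
    qed
  qed
  fix V assume V: "openin (ztop ?A) V"
  then have VA: "V \<subseteq> affine_pts n" using openin_pts pts_affine by metis
  show "regs (subvar ?A (pts ?A)) V = regs ?A V"
  proof (intro equalityI subsetI)
    fix f assume f: "f \<in> regs ?A V"
    show "f \<in> regs (subvar ?A (pts ?A)) V" unfolding regs_subvar pts_affine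
      by (intro ballI exI[of _ V] exI[of _ f] exI[of _ "\<lambda>_. 1"])
        (use V VA f poly_regs[OF one_poly VA] in auto)
  next
    fix f assume f: "f \<in> regs (subvar ?A (pts ?A)) V"
    show "f \<in> regs ?A V"
      unfolding regs_affine
    proof
      fix x assume x: "x \<in> V"
      from f[unfolded regs_subvar pts_affine, rule_format, OF x] obtain U h k where
        U: "openin (ztop ?A) U" "h \<in> regs ?A U" "k \<in> regs ?A U" "x \<in> U" "x \<in> affine_pts n" "k x \<noteq> 0"
        "\<And>y. y \<in> V \<inter> (U \<inter> affine_pts n) \<Longrightarrow> k y \<noteq> 0 \<Longrightarrow> f y = h y / k y"
        by blast
      from U(2)[unfolded regs_affine, rule_format, OF U(4)] obtain p q where
        p: "p \<in> poly_fun base_field" "q \<in> poly_fun base_field" "q x \<noteq> 0"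
        "\<And>y. y \<in> U \<inter> affine_pts n \<Longrightarrow> q y \<noteq> 0 \<Longrightarrow> h y = p y / q y" by blast
      from U(3)[unfolded regs_affine, rule_format, OF U(4)] obtain p' q' where
        p': "p' \<in> poly_fun base_field" "q' \<in> poly_fun base_field" "q' x \<noteq> 0"
        "\<And>y. y \<in> U \<inter> affine_pts n \<Longrightarrow> q' y \<noteq> 0 \<Longrightarrow> k y = p' y / q' y" by blast
      obtain s where s: "s \<in> poly_fun base_field" "s x \<noteq> 0" "{y \<in> affine_pts n. s y \<noteq> 0} \<subseteq> U"
        using openin_affine_basis[OF U(1,4)] by blast
      have p'x: "p' x \<noteq> 0" using U(4-6) p'(3,4) by force
      \<comment> \<open>The factors \<open>s\<close> and \<open>q'\<close> of the denominator confine its non-vanishing locus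
        to the set where \<open>f\<close>, \<open>h\<close> and \<open>k\<close> are all given by the chosen fractions.\<close>
      let ?H = "\<lambda>y. (p y * q' y) * (q' y * s y)" and ?K = "\<lambda>y. (q y * p' y) * (q' y * s y)"
      have "f y = ?H y / ?K y" if "y \<in> V \<inter> affine_pts n" "?K y \<noteq> 0" for y
      proof -
        have nz: "q y \<noteq> 0" "p' y \<noteq> 0" "q' y \<noteq> 0" "s y \<noteq> 0" using that(2) by auto
        then have y: "y \<in> U" using s(3) that(1) by blast
        have h: "h y = p y / q y" and k: "k y = p' y / q' y" using p(4) p'(4) y that(1) nz by auto
        then have "k y \<noteq> 0" using nz by simp
        then have "f y = (p y / q y) / (p' y / q' y)" using U(7)[of y] y that(1) h k by auto
        then show ?thesis using nz by simp
      qed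
      moreover have "?H \<in> poly_fun base_field" "?K \<in> poly_fun base_field"
        using p p' s by (auto intro: poly_fun.mult)
      moreover have "?K x \<noteq> 0" using p(3) p'x p'(3) s(2) by simp
      ultimately show "\<exists>h k. h \<in> poly_fun base_field \<and> k \<in> poly_fun base_field \<and> x \<in> affine_pts n \<and> k x \<noteq> 0 \<and>
          (\<forall>y\<in>V \<inter> affine_pts n. k y \<noteq> 0 \<longrightarrow> f y = h y / k y)"
        using U(5) by (intro exI[of _ ?H] exI[of _ ?K] conjI) blast+
    qed
  qed
qed

context local_field
begin

text \<open>
  \<open>F\<^sup>n\<close>, with points extended by zero to all of \<open>nat\<close> as in \<open>affine_pts\<close>.
\<close>

definition affine_coords :: "nat \<Rightarrow> (nat \<Rightarrow> 'f) topology" where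
  "affine_coords n = product_topology (\<lambda>i. if i < n then FT else subtopology FT {0}) UNIV"

lemma subtopology_NT_rat:
  assumes "self_generated Z"
  shows "subtopology (NT Z) (W \<inter> rat_pts Z) = subtopology (NT Z) W"
  using subtopology_restrict[of "NT Z" W] by (simp add: assms Int_commute)

lemma topspace_affine_coords: "topspace (affine_coords n) = {y. \<forall>i\<ge>n. y i = 0}"
  unfolding affine_coords_def topspace_product_topology
  by (auto simp: PiE_iff split: if_splits)

lemma l_space_affine_coords: "l_space (affine_coords n)"
  unfolding affine_coords_def
proof (rule l_space_product)
  have "closedin FT {0}"
    using l_space_FT closedin_Hausdorff_singleton[of FT 0] unfolding l_space_def by simp
  then show "l_space (if i < n then FT else subtopology FT {0})" for i
    using l_space_FT l_space_subtopology_closed[OF l_space_FT, of "{0}"] by simp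
  have "compact_space (subtopology FT {0})"
    by (simp add: compact_space_subtopology)
  then have "{i \<in> UNIV. \<not> compact_space (if i < n then FT else subtopology FT {0})} \<subseteq> {..<n}" by auto
  then show "finite {i \<in> UNIV. \<not> compact_space (if i < n then FT else subtopology FT {0})}"
    using finite_subset by blast
qed

lemma F_continuous_affine_coords: "F_continuous (affine_coords n) (\<lambda>y. to_ac (y i))"
proof -
  have "continuous_map (affine_coords n) (if i < n then FT else subtopology FT {0}) (\<lambda>y. y i)"
    unfolding affine_coords_def by (rule continuous_map_product_projection) simp
  then have "continuous_map (affine_coords n) FT (\<lambda>y. y i)"
    by (auto simp: continuous_map_in_subtopology split: if_splits)
  then show ?thesis unfolding F_continuous_def by blast
qed

text \<open>
  Polynomials over \<open>F\<close>, and hence their local quotients, are continuous in the coordinates;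
  conversely the coordinates are regular functions.
\<close>

lemma homeomorphic_affine_coords:
  "homeomorphic_maps (affine_coords n) (NT (affine_space n)) (\<lambda>y i. to_ac (y i)) (\<lambda>x i. of_ac (x i))"
proof -
  let ?A = "affine_space n :: (nat \<Rightarrow> 'f alg_closure, 'f alg_closure) fspace"
  let ?P = "affine_coords n" and ?e = "\<lambda>(y :: nat \<Rightarrow> 'f) i. to_ac (y i)"
  note A = self_generated_affine[where ?'f = 'f, of n]
  have e_pts: "?e y \<in> affine_pts n" if "y \<in> topspace ?P" for y
    using that unfolding topspace_affine_coords affine_pts_def by auto
  have poly: "F_continuous ?P (\<lambda>y. p (?e y))" if "p \<in> poly_fun base_field" for p
    by (rule F_continuous_poly[OF that F_continuous_affine_coords])
  have e_open: "openin ?P {y \<in> topspace ?P. ?e y \<in> U}" if U: "openin (ztop ?A) U" for U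
  proof (subst openin_subopen, intro ballI)
    fix y assume y: "y \<in> {y \<in> topspace ?P. ?e y \<in> U}"
    then obtain s where s: "s \<in> poly_fun base_field" "s (?e y) \<noteq> 0" "{z \<in> affine_pts n. s z \<noteq> 0} \<subseteq> U"
      using openin_affine_basis[OF U, of "?e y"] by blast
    show "\<exists>N. openin ?P N \<and> y \<in> N \<and> N \<subseteq> {y \<in> topspace ?P. ?e y \<in> U}"
      using F_continuous_nonzero[OF poly[OF s(1)]] s e_pts y
      by (intro exI[of _ "{y \<in> topspace ?P. s (?e y) \<noteq> 0}"]) blast
  qed
  have e_regs: "F_continuous (subtopology ?P {y. ?e y \<in> U}) (\<lambda>y. f (?e y))"
    if U: "openin (ztop ?A) U" and f: "f \<in> regs ?A U" for U f
  proof (rule F_continuous_local)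
    fix y assume "y \<in> topspace (subtopology ?P {y. ?e y \<in> U})"
    then have y: "y \<in> topspace ?P" "?e y \<in> U" by auto
    obtain h k where hk: "h \<in> poly_fun base_field" "k \<in> poly_fun base_field" "k (?e y) \<noteq> 0"
      "\<And>z. z \<in> U \<inter> affine_pts n \<Longrightarrow> k z \<noteq> 0 \<Longrightarrow> f z = h z / k z"
      using f[unfolded regs_affine, rule_format, OF y(2)] by blast
    let ?T = "subtopology ?P {y. ?e y \<in> U}"
    let ?N = "{z \<in> topspace ?T. k (?e z) \<noteq> 0}"
    have cont: "F_continuous (subtopology ?T ?N) (\<lambda>z. h (?e z) / k (?e z))"
      by (intro F_continuous_divide F_continuous_subtopology poly hk(1,2)) auto
    show "\<exists>N. openin ?T N \<and> y \<in> N \<and> F_continuous (subtopology ?T N) (\<lambda>y. f (?e y))"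
    proof (intro exI conjI)
      show "openin ?T ?N" by (intro F_continuous_nonzero F_continuous_subtopology poly hk(2))
      show "y \<in> ?N" using y hk(3) by auto
      show "F_continuous (subtopology ?T ?N) (\<lambda>y. f (?e y))"
        by (rule F_continuous_cong[OF cont]) (use hk(4) e_pts in auto)
    qed
  qed
  have e_rat: "?e y \<in> rat_pts ?A" if y: "y \<in> topspace ?P" for y
    unfolding rat_pts_def pts_affine
  proof (intro CollectI conjI allI impI ballI)
    show "?e y \<in> affine_pts n" using e_pts[OF y] .
    fix U f assume "openin (ztop ?A) U \<and> ?e y \<in> U" "f \<in> regs ?A U"
    then show "f (?e y) \<in> base_field"
      using F_continuous_base[OF e_regs, of U f y] y by auto
  qed
  have coord: "F_continuous (NT ?A) (\<lambda>x. x i)" for i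
  proof -
    have "(\<lambda>x. x i) \<in> regs ?A (pts ?A)"
      unfolding regs_affine pts_affine
      by (intro ballI exI[of _ "\<lambda>x. x i"] exI[of _ "\<lambda>_. 1"]) (auto intro: poly_fun.coord one_poly)
    then have "F_continuous (subtopology (NT ?A) (pts ?A)) (\<lambda>x. x i)"
      using F_continuous_regs[OF A openin_ztop_pts] by blast
    moreover have "subtopology (NT ?A) (pts ?A) = NT ?A"
      by (rule subtopology_superset) (simp add: A rat_pts_subset)
    ultimately show ?thesis by simp
  qed
  show ?thesis
    unfolding homeomorphic_maps_def
  proof (intro conjI ballI)
    show "continuous_map ?P (NT ?A) ?e"
      unfolding natural_topology_def
    proof (rule continuous_on_generated_topo)
      fix B assume "B \<in> {{x \<in> U \<inter> rat_pts ?A. f x \<in> to_ac ` S} |U f S.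
          openin (ztop ?A) U \<and> f \<in> regs ?A U \<and> openin FT S}"
      then obtain U f S where U: "openin (ztop ?A) U" "f \<in> regs ?A U" "openin FT S"
        "B = {x \<in> U \<inter> rat_pts ?A. f x \<in> to_ac ` S}" by blast
      let ?T = "subtopology ?P {y \<in> topspace ?P. ?e y \<in> U}"
      have T: "?T = subtopology ?P {y. ?e y \<in> U}"
        using subtopology_restrict[of ?P "{y. ?e y \<in> U}"] by (simp add: Collect_conj_eq)
      have "openin ?T {y \<in> topspace ?T. f (?e y) \<in> to_ac ` S}"
        using F_continuous_openin[OF e_regs[OF U(1,2)] U(3)] unfolding T .
      then have "openin ?P {y \<in> topspace ?T. f (?e y) \<in> to_ac ` S}"
        using e_open[OF U(1)] by (simp add: openin_open_subtopology)
      moreover have "?e -` B \<inter> topspace ?P = {y \<in> topspace ?T. f (?e y) \<in> to_ac ` S}"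
        using e_rat unfolding U(4) by auto
      ultimately show "openin ?P (?e -` B \<inter> topspace ?P)" by simp
    next
      show "?e ` topspace ?P \<subseteq> \<Union> {{x \<in> U \<inter> rat_pts ?A. f x \<in> to_ac ` S} |U f S.
          openin (ztop ?A) U \<and> f \<in> regs ?A U \<and> openin FT S}"
        using e_rat topspace_NT[OF A]
        unfolding natural_topology_def topology_generated_by_topspace by blast
    qed
    show "continuous_map (NT ?A) ?P (\<lambda>x i. of_ac (x i))"
      unfolding affine_coords_def
    proof (subst continuous_map_componentwise_UNIV, intro allI)
      fix i
      obtain g where g: "continuous_map (NT ?A) FT g" "\<And>x. x \<in> topspace (NT ?A) \<Longrightarrow> x i = to_ac (g x)"
        using coord[of i] unfolding F_continuous_def by blast
      have *: "continuous_map (NT ?A) FT (\<lambda>x. of_ac (x i))"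
        by (rule continuous_map_eq[OF g(1)]) (simp add: g(2))
      have "of_ac (x i) = 0" if "\<not> i < n" "x \<in> topspace (NT ?A)" for x
      proof -
        have "x \<in> affine_pts n" using that(2) rat_pts_subset[of ?A] by (auto simp: A pts_affine)
        then show ?thesis using that(1) of_ac_to_ac[of 0] unfolding affine_pts_def by auto
      qed
      then show "continuous_map (NT ?A) (if i < n then FT else subtopology FT {0}) (\<lambda>x. of_ac (x i))"
        using * by (auto simp: continuous_map_in_subtopology)
    qed
    show "(\<lambda>i. of_ac (to_ac (y i))) = y" for y :: "nat \<Rightarrow> 'f" by simp
    fix x assume x: "x \<in> topspace (NT ?A)"
    then have "x i \<in> range to_ac" for i using F_continuous_base[OF coord] by blast
    then show "(\<lambda>i. to_ac (of_ac (x i))) = x" by (simp add: to_ac_of_ac)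
  qed
qed

lemma l_space_affine: "l_space (NT (affine_space n))"
  using l_space_homeomorphic[OF homeomorphic_affine_coords l_space_affine_coords] .

lemma morphism_rat_pts:
  assumes "morphism Z Z' h" "x \<in> rat_pts Z"
  shows "h x \<in> rat_pts Z'"
  unfolding rat_pts_def
proof (intro CollectI conjI allI impI ballI)
  have c: "continuous_map (ztop Z) (ztop Z') h" using assms(1) unfolding morphism_def by blast
  have x: "x \<in> pts Z" using assms(2) rat_pts_subset[of Z] by blast
  then show "h x \<in> pts Z'" using c unfolding pts_def continuous_map_def by blast
  fix U f assume U: "openin (ztop Z') U \<and> h x \<in> U" and f: "f \<in> regs Z' U"
  have "f \<circ> h \<in> regs Z {x \<in> pts Z. h x \<in> U}" using assms(1) U f unfolding morphism_def by blast
  moreover have "openin (ztop Z) {x \<in> pts Z. h x \<in> U}"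
    using c U unfolding continuous_map_def pts_def by blast
  ultimately have "(f \<circ> h) x \<in> base_field" using rat_pts_value[OF assms(2)] x U by blast
  then show "f (h x) \<in> base_field" by simp
qed

lemma morphism_continuous_NT:
  assumes h: "morphism Z Z' h" and top: "topspace (NT Z) \<subseteq> rat_pts Z" "rat_pts Z' \<subseteq> topspace (NT Z')"
  shows "continuous_map (NT Z) (NT Z') h"
  unfolding natural_topology_def[of v Z']
proof (rule continuous_on_generated_topo)
  fix B assume "B \<in> {{x \<in> U \<inter> rat_pts Z'. f x \<in> to_ac ` S} |U f S.
          openin (ztop Z') U \<and> f \<in> regs Z' U \<and> openin FT S}"
  then obtain U f S where U: "openin (ztop Z') U" "f \<in> regs Z' U" "openin FT S"
    "B = {x \<in> U \<inter> rat_pts Z'. f x \<in> to_ac ` S}" by blast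
  have "openin (ztop Z) {x \<in> pts Z. h x \<in> U}" "f \<circ> h \<in> regs Z {x \<in> pts Z. h x \<in> U}"
    using h U(1,2) unfolding morphism_def continuous_map_def pts_def by blast+
  from openin_NT_basic[OF this U(3)]
  have "openin (NT Z) {x \<in> {x \<in> pts Z. h x \<in> U} \<inter> rat_pts Z. (f \<circ> h) x \<in> to_ac ` S}" .
  then have "openin (NT Z) ({x \<in> {x \<in> pts Z. h x \<in> U} \<inter> rat_pts Z. (f \<circ> h) x \<in> to_ac ` S} \<inter> topspace (NT Z))"
    by blast
  moreover have "h -` B \<inter> topspace (NT Z) =
      {x \<in> {x \<in> pts Z. h x \<in> U} \<inter> rat_pts Z. (f \<circ> h) x \<in> to_ac ` S} \<inter> topspace (NT Z)"
    using top(1) rat_pts_subset[of Z] morphism_rat_pts[OF h] unfolding U(4) by auto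
  ultimately show "openin (NT Z) (h -` B \<inter> topspace (NT Z))" by simp
next
  show "h ` topspace (NT Z) \<subseteq> \<Union> {{x \<in> U \<inter> rat_pts Z'. f x \<in> to_ac ` S} |U f S.
          openin (ztop Z') U \<and> f \<in> regs Z' U \<and> openin FT S}"
    using top morphism_rat_pts[OF h]
    unfolding natural_topology_def[of v Z'] topology_generated_by_topspace by blast
qed

lemma topspace_NT_subvar:
  assumes "self_generated Z" "Y \<subseteq> pts Z"
  shows "topspace (NT (subvar Z Y)) = rat_pts (subvar Z Y)"
  using assms by (auto simp: NT_subvar rat_pts_subvar)

text \<open>
  A closed subvariety of affine space is closed in the natural topology, and isomorphisms over \<open>F\<close>
  induce homeomorphisms of the spaces of rational points.
\<close>

lemma l_space_affine_open:
  assumes Z: "self_generated Z" and U: "openin (ztop Z) U" "affine_variety (subvar Z U)"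
  shows "l_space (subtopology (NT Z) U)"
proof -
  obtain n C where C: "closed_over_F n C" and iso: "isomorphic (subvar Z U) (subvar (affine_space n) C)"
    using U(2) unfolding affine_variety_def by blast
  let ?A = "affine_space n :: (nat \<Rightarrow> 'f alg_closure, 'f alg_closure) fspace"
  note A = self_generated_affine[where ?'f = 'f, of n]
  have Ccl: "closedin (ztop ?A) C" using C unfolding closed_over_F_def by blast
  then have CA: "C \<subseteq> pts ?A" unfolding pts_def by (rule closedin_subset)
  have UZ: "U \<subseteq> pts Z" by (rule openin_pts[OF U(1)])
  have "openin (NT ?A) ((pts ?A - C) \<inter> rat_pts ?A)"
    by (rule openin_NT_open[OF A]) (use Ccl in \<open>auto simp: closedin_def pts_def\<close>)
  moreover have "(pts ?A - C) \<inter> rat_pts ?A = topspace (NT ?A) - (C \<inter> rat_pts ?A)"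
    using rat_pts_subset[of ?A] by (auto simp: A)
  ultimately have "closedin (NT ?A) (C \<inter> rat_pts ?A)" by (simp add: closedin_def A)
  then have "l_space (subtopology (NT ?A) (C \<inter> rat_pts ?A))"
    by (rule l_space_subtopology_closed[OF l_space_affine])
  moreover have "subtopology (NT ?A) (C \<inter> rat_pts ?A) = subtopology (NT ?A) C"
    by (rule subtopology_NT_rat[OF A])
  ultimately have lC: "l_space (NT (subvar ?A C))" by (simp add: NT_subvar[OF A CA])
  obtain p q where pq: "morphism (subvar Z U) (subvar ?A C) p" "morphism (subvar ?A C) (subvar Z U) q"
    "\<And>x. x \<in> pts (subvar Z U) \<Longrightarrow> q (p x) = x" "\<And>y. y \<in> pts (subvar ?A C) \<Longrightarrow> p (q y) = y"
    using iso unfolding isomorphic_def by blast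
  have "homeomorphic_maps (NT (subvar ?A C)) (NT (subvar Z U)) q p"
    unfolding homeomorphic_maps_def
    using morphism_continuous_NT[OF pq(1)] morphism_continuous_NT[OF pq(2)]
      topspace_NT_subvar[OF A CA] topspace_NT_subvar[OF Z UZ] pq(3,4)
      rat_pts_subset[of "subvar ?A C"] rat_pts_subset[of "subvar Z U"] by auto
  then have "l_space (NT (subvar Z U))" using lC by (rule l_space_homeomorphic)
  then show ?thesis by (simp add: NT_subvar[OF Z UZ])
qed

end

section \<open>Slices of products, and the Hausdorff property\<close>

lemma ztop_fprod: "ztop (fprod Z Z') = topology_generated_by
    {{p \<in> U \<times> W. (\<Sum>i<n. a i (fst p) * b i (snd p)) \<noteq> 0} | U W n a b.
       openin (ztop Z) U \<and> openin (ztop Z') W \<and> (\<forall>i<(n::nat). a i \<in> regs Z U \<and> b i \<in> regs Z' W)}"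
proof -
  have "{{x \<in> U. h x \<noteq> 0} |U A h. (U, A) \<in> {(U \<times> W, tensors Z Z' U W) |U W. openin (ztop Z) U \<and> openin (ztop Z') W} \<and> h \<in> A}
    = {{p \<in> U \<times> W. (\<Sum>i<n. a i (fst p) * b i (snd p)) \<noteq> 0} | U W n a b.
       openin (ztop Z) U \<and> openin (ztop Z') W \<and> (\<forall>i<(n::nat). a i \<in> regs Z U \<and> b i \<in> regs Z' W)}"
    (is "?L = ?R")
  proof (intro equalityI subsetI)
    fix S assume "S \<in> ?L"
    then obtain U W h where 1: "S = {x \<in> U \<times> W. h x \<noteq> 0}" "openin (ztop Z) U" "openin (ztop Z') W"
      "h \<in> tensors Z Z' U W" by blast
    then obtain n a b where "h = (\<lambda>(x, y). \<Sum>i<(n::nat). a i x * b i y)" "\<forall>i<n. a i \<in> regs Z U \<and> b i \<in> regs Z' W"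
      unfolding tensors_def by blast
    then show "S \<in> ?R" using 1(1-3)
      by (intro CollectI exI[of _ U] exI[of _ W] exI[of _ n] exI[of _ a] exI[of _ b]) (auto simp: case_prod_beta)
  next
    fix S assume "S \<in> ?R"
    then obtain U W n a b where 1: "S = {p \<in> U \<times> W. (\<Sum>i<n. a i (fst p) * b i (snd p)) \<noteq> 0}"
       "openin (ztop Z) U" "openin (ztop Z') W" "\<forall>i<(n::nat). a i \<in> regs Z U \<and> b i \<in> regs Z' W" by blast
    let ?h = "\<lambda>(x, y). \<Sum>i<n. a i x * b i y"
    have "?h \<in> tensors Z Z' U W" unfolding tensors_def using 1(4) by blast
    then show "S \<in> ?L" using 1(1-3)
      by (intro CollectI exI[of _ "U \<times> W"] exI[of _ "tensors Z Z' U W"] exI[of _ ?h]) (auto simp: case_prod_beta)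
  qed
  then show ?thesis unfolding fprod_def ztop_fspace_of by simp
qed

lemma regs_fprodD:
  assumes "f \<in> regs (fprod Z Z') V" "(x, y) \<in> V"
  obtains U W n a b m c d where
    "openin (ztop Z) U" "openin (ztop Z') W" "x \<in> U" "y \<in> W"
    "\<And>i. i < n \<Longrightarrow> a i \<in> regs Z U" "\<And>i. i < (n::nat) \<Longrightarrow> b i \<in> regs Z' W"
    "\<And>i. i < m \<Longrightarrow> c i \<in> regs Z U" "\<And>i. i < (m::nat) \<Longrightarrow> d i \<in> regs Z' W"
    "(\<Sum>i<m. c i x * d i y) \<noteq> 0"
    "\<And>x y. (x, y) \<in> V \<Longrightarrow> x \<in> U \<Longrightarrow> y \<in> W \<Longrightarrow> (\<Sum>i<m. c i x * d i y) \<noteq> 0 \<Longrightarrow>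
       f (x, y) = (\<Sum>i<n. a i x * b i y) / (\<Sum>i<m. c i x * d i y)"
proof -
  from assms obtain U W h k where
    UW: "openin (ztop Z) U" "openin (ztop Z') W" "(x, y) \<in> U \<times> W"
      "h \<in> tensors Z Z' U W" "k \<in> tensors Z Z' U W" "k (x, y) \<noteq> 0"
      and f: "\<forall>p \<in> V \<inter> (U \<times> W). k p \<noteq> 0 \<longrightarrow> f p = h p / k p"
    unfolding fprod_def regs_fspace_of by blast
  obtain n a b where h: "h = (\<lambda>(x, y). \<Sum>i<(n::nat). a i x * b i y)" "\<forall>i<n. a i \<in> regs Z U \<and> b i \<in> regs Z' W"
    using UW(4) unfolding tensors_def by blast
  obtain m c d where k: "k = (\<lambda>(x, y). \<Sum>i<(m::nat). c i x * d i y)" "\<forall>i<m. c i \<in> regs Z U \<and> d i \<in> regs Z' W"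
    using UW(5) unfolding tensors_def by blast
  show thesis
    by (rule that[of U W n a b m c d]) (use UW(1-3,6) f h k in auto)
qed

lemma pts_fprod:
  assumes "self_generated Z" "self_generated Z'"
  shows "pts (fprod Z Z') = pts Z \<times> pts Z'"
proof
  show "pts (fprod Z Z') \<subseteq> pts Z \<times> pts Z'"
    unfolding pts_def[of "fprod Z Z'"] ztop_fprod topology_generated_by_topspace
    by (auto dest!: openin_pts)
  \<comment> \<open>The non-vanishing locus of the tensor \<open>1 \<otimes> 1\<close>.\<close>
  let ?S = "{p \<in> pts Z \<times> pts Z'. (\<Sum>i<Suc 0. (\<lambda>_. 1) (fst p) * (\<lambda>_. 1) (snd p)) \<noteq> (0::'b)}"
  have "openin (ztop (fprod Z Z')) ?S"
    unfolding ztop_fprod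
    by (rule topology_generated_by_Basis, rule CollectI,
        rule exI[of _ "pts Z"], rule exI[of _ "pts Z'"], rule exI[of _ "Suc 0"],
        rule exI[of _ "\<lambda>_ _. 1"], rule exI[of _ "\<lambda>_ _. 1"])
      (simp add: one_regs assms)
  then have "?S \<subseteq> pts (fprod Z Z')" by (rule openin_pts)
  then show "pts Z \<times> pts Z' \<subseteq> pts (fprod Z Z')" by simp
qed

context local_field
begin

text \<open>
  For a fixed point \<open>g\<close> over \<open>K\<close> a tensor becomes a \<open>K\<close>-linear combination of regular functions over
  \<open>F\<close>, and \<open>openin_linear_form_nonzero\<close> applies.
\<close>

lemma openin_fprod_slice:
  assumes Z: "self_generated Z" and O: "openin (ztop (fprod H Z)) O'"
  shows "openin (NT Z) {x \<in> rat_pts Z. (g, x) \<in> O'}"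
proof -
  have "generate_topology_on {{p \<in> U \<times> W. (\<Sum>i<n. a i (fst p) * b i (snd p)) \<noteq> 0} | U W n a b.
       openin (ztop H) U \<and> openin (ztop Z) W \<and> (\<forall>i<(n::nat). a i \<in> regs H U \<and> b i \<in> regs Z W)} O'"
    using O unfolding ztop_fprod by (simp add: openin_topology_generated_by_iff)
  then show ?thesis
  proof induction
    case (Int A B)
    have "{x \<in> rat_pts Z. (g, x) \<in> A \<inter> B} = {x \<in> rat_pts Z. (g, x) \<in> A} \<inter> {x \<in> rat_pts Z. (g, x) \<in> B}"
      by blast
    then show ?case using Int.IH by auto
  next
    case (UN K)
    have "{x \<in> rat_pts Z. (g, x) \<in> \<Union>K} = (\<Union>k\<in>K. {x \<in> rat_pts Z. (g, x) \<in> k})" by blast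
    then show ?case using UN.IH by auto
  next
    case (Basis S)
    then obtain U W n a b where S: "S = {p \<in> U \<times> W. (\<Sum>i<n. a i (fst p) * b i (snd p)) \<noteq> 0}"
       "openin (ztop Z) W" "\<And>i. i < (n::nat) \<Longrightarrow> b i \<in> regs Z W" by blast
    let ?T = "subtopology (NT Z) (W \<inter> rat_pts Z)"
    have T: "?T = subtopology (NT Z) W"
      by (rule subtopology_NT_rat[OF Z])
    have "openin ?T {x \<in> topspace ?T. (\<Sum>i<n. a i g * b i x) \<noteq> 0}"
      unfolding T by (rule openin_linear_form_nonzero) (rule F_continuous_regs[OF Z S(2) S(3)])
    then have *: "openin (NT Z) {x \<in> topspace ?T. (\<Sum>i<n. a i g * b i x) \<noteq> 0}"
      using openin_NT_open[OF Z S(2)] by (simp add: openin_open_subtopology)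
    show ?case
    proof (cases "g \<in> U")
      case True
      then have "{x \<in> rat_pts Z. (g, x) \<in> S} = {x \<in> topspace ?T. (\<Sum>i<n. a i g * b i x) \<noteq> 0}"
        unfolding S(1) by (auto simp: Z)
      then show ?thesis using * by simp
    next
      case False
      then have eq: "{x \<in> rat_pts Z. (g, x) \<in> S} = {}" unfolding S(1) by auto
      show ?thesis unfolding eq by simp
    qed
  qed simp
qed

lemma F_continuous_fprod_slice:
  assumes Z: "self_generated Z" and g: "g \<in> rat_pts H"
    and f: "f \<in> regs (fprod H Z) V"
  shows "F_continuous (subtopology (NT Z) {x. (g, x) \<in> V}) (\<lambda>x. f (g, x))"
proof (rule F_continuous_local)
  let ?T = "subtopology (NT Z) {x. (g, x) \<in> V}"
  fix x assume "x \<in> topspace ?T"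
  then have x: "x \<in> rat_pts Z" "(g, x) \<in> V" by (auto simp: Z)
  obtain U W n a b m c d where
    UW: "openin (ztop H) U" "openin (ztop Z) W" "g \<in> U" "x \<in> W"
    "\<And>i. i < n \<Longrightarrow> a i \<in> regs H U" "\<And>i. i < (n::nat) \<Longrightarrow> b i \<in> regs Z W"
    "\<And>i. i < m \<Longrightarrow> c i \<in> regs H U" "\<And>i. i < (m::nat) \<Longrightarrow> d i \<in> regs Z W"
    "(\<Sum>i<m. c i g * d i x) \<noteq> 0"
    and eq: "\<And>x y. (x, y) \<in> V \<Longrightarrow> x \<in> U \<Longrightarrow> y \<in> W \<Longrightarrow> (\<Sum>i<m. c i x * d i y) \<noteq> 0 \<Longrightarrow>
       f (x, y) = (\<Sum>i<n. a i x * b i y) / (\<Sum>i<m. c i x * d i y)"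
    by (rule regs_fprodD[OF f x(2)]) blast
  have lin: "F_continuous (subtopology (NT Z) W) (\<lambda>x. \<Sum>i<n. a i g * b i x)"
    if "\<And>i. i < n \<Longrightarrow> a i \<in> regs H U" "\<And>i. i < (n::nat) \<Longrightarrow> b i \<in> regs Z W" for n a b
    by (intro F_continuous_sum F_continuous_mult F_continuous_const F_continuous_regs[OF Z UW(2)]
        rat_pts_value[OF g UW(1,3)] that)
  have num: "F_continuous (subtopology (NT Z) W) (\<lambda>x. \<Sum>i<n. a i g * b i x)"
    by (rule lin; fact UW)
  have den: "F_continuous (subtopology (NT Z) W) (\<lambda>x. \<Sum>i<m. c i g * d i x)"
    by (rule lin; fact UW)
  let ?N = "{x \<in> topspace (subtopology (NT Z) W). (\<Sum>i<m. c i g * d i x) \<noteq> 0}"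
  have "openin (subtopology (NT Z) (W \<inter> rat_pts Z)) ?N"
    unfolding subtopology_NT_rat[OF Z] by (rule F_continuous_nonzero[OF den])
  then have N: "openin (NT Z) ?N"
    unfolding openin_open_subtopology[OF openin_NT_open[OF Z UW(2)]] by (rule conjunct1)
  have cont: "F_continuous (subtopology (NT Z) ?N) (\<lambda>x. (\<Sum>i<n. a i g * b i x) / (\<Sum>i<m. c i g * d i x))"
    by (intro F_continuous_divide F_continuous_mono[OF num] F_continuous_mono[OF den]) auto
  show "\<exists>N. openin ?T N \<and> x \<in> N \<and> F_continuous (subtopology ?T N) (\<lambda>x. f (g, x))"
  proof (intro exI conjI)
    show "openin ?T (?N \<inter> {x. (g, x) \<in> V})" using N unfolding openin_subtopology by blast
    show "x \<in> ?N \<inter> {x. (g, x) \<in> V}" using x UW(4,9) by (auto simp: Z)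
    have sub: "subtopology ?T (?N \<inter> {x. (g, x) \<in> V}) = subtopology (subtopology (NT Z) ?N) {x. (g, x) \<in> V}"
      by (simp add: subtopology_subtopology Int_ac)
    show "F_continuous (subtopology ?T (?N \<inter> {x. (g, x) \<in> V})) (\<lambda>x. f (g, x))"
      unfolding sub by (rule F_continuous_cong[OF F_continuous_subtopology[OF cont]]) (use eq UW(3) in auto)
  qed
qed

lemma openin_fprod_NT:
  assumes Z: "self_generated Z" and Z': "self_generated Z'" and O: "openin (ztop (fprod Z Z')) O'"
  shows "openin (prod_topology (NT Z) (NT Z')) (O' \<inter> (rat_pts Z \<times> rat_pts Z'))"
proof -
  let ?R = "rat_pts Z \<times> rat_pts Z'" and ?P = "prod_topology (NT Z) (NT Z')"
  have "generate_topology_on {{p \<in> U \<times> W. (\<Sum>i<n. a i (fst p) * b i (snd p)) \<noteq> 0} | U W n a b.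
       openin (ztop Z) U \<and> openin (ztop Z') W \<and> (\<forall>i<(n::nat). a i \<in> regs Z U \<and> b i \<in> regs Z' W)} O'"
    using O unfolding ztop_fprod by (simp add: openin_topology_generated_by_iff)
  then show ?thesis
  proof induction
    case (Int A B)
    have "A \<inter> B \<inter> ?R = (A \<inter> ?R) \<inter> (B \<inter> ?R)" by blast
    then show ?case using Int.IH by auto
  next
    case (UN K)
    have eq: "\<Union>K \<inter> ?R = (\<Union>k\<in>K. k \<inter> ?R)" by blast
    show ?case unfolding eq using UN.IH by (intro openin_Union) auto
  next
    case (Basis S)
    then obtain U W n a b where S: "S = {p \<in> U \<times> W. (\<Sum>i<n. a i (fst p) * b i (snd p)) \<noteq> 0}"
       "openin (ztop Z) U" "openin (ztop Z') W"
       "\<And>i. i < (n::nat) \<Longrightarrow> a i \<in> regs Z U" "\<And>i. i < (n::nat) \<Longrightarrow> b i \<in> regs Z' W" by blast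
    let ?B = "(U \<inter> rat_pts Z) \<times> (W \<inter> rat_pts Z')"
    let ?T = "subtopology ?P ?B"
    have B: "openin ?P ?B"
      using openin_NT_open[OF Z S(2)] openin_NT_open[OF Z' S(3)] by (simp add: openin_prod_Times_iff)
    have c1: "continuous_map ?T (subtopology (NT Z) U) fst" and c2: "continuous_map ?T (subtopology (NT Z') W) snd"
      by (auto simp: continuous_map_in_subtopology intro!: continuous_map_from_subtopology continuous_map_fst continuous_map_snd)
    have "F_continuous ?T (\<lambda>p. \<Sum>i<n. a i (fst p) * b i (snd p))"
      by (intro F_continuous_sum F_continuous_mult F_continuous_compose[OF _ c1] F_continuous_compose[OF _ c2]
          F_continuous_regs[OF Z S(2,4)] F_continuous_regs[OF Z' S(3,5)])
    then have "openin ?T {p \<in> topspace ?T. (\<Sum>i<n. a i (fst p) * b i (snd p)) \<noteq> 0}"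
      by (rule F_continuous_nonzero)
    then have "openin ?P {p \<in> topspace ?T. (\<Sum>i<n. a i (fst p) * b i (snd p)) \<noteq> 0}"
      using B by (simp add: openin_open_subtopology)
    moreover have "{p \<in> topspace ?T. (\<Sum>i<n. a i (fst p) * b i (snd p)) \<noteq> 0} = S \<inter> ?R"
      unfolding S(1) by (auto simp: Z Z')
    ultimately show ?case by simp
  qed simp
qed

text \<open>
  Separatedness, i.e. closedness of the diagonal in the Zariski topology of the product, gives the
  Hausdorff property; everything else is local and holds on affine open sets.
\<close>

lemma l_space_variety:
  assumes "variety_over_F Z"
  shows "l_space (NT Z)"
proof (rule l_space_locally)
  have Z: "self_generated Z" by (rule variety_self_generated[OF assms])
  let ?\<Delta> = "{(x, x) | x. x \<in> pts Z}"
  have "closedin (ztop (fprod Z Z)) ?\<Delta>" using assms unfolding variety_over_F_def by blast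
  then have "openin (ztop (fprod Z Z)) (pts Z \<times> pts Z - ?\<Delta>)"
    unfolding closedin_def pts_fprod[OF Z Z, symmetric] pts_def[of "fprod Z Z"] by blast
  from openin_fprod_NT[OF Z Z this]
  have "openin (prod_topology (NT Z) (NT Z)) ((pts Z \<times> pts Z - ?\<Delta>) \<inter> (rat_pts Z \<times> rat_pts Z))" .
  moreover have "(pts Z \<times> pts Z - ?\<Delta>) \<inter> (rat_pts Z \<times> rat_pts Z) =
      topspace (prod_topology (NT Z) (NT Z)) - (\<lambda>x. (x, x)) ` topspace (NT Z)"
    using rat_pts_subset[of Z] by (auto simp: Z)
  ultimately have "closedin (prod_topology (NT Z) (NT Z)) ((\<lambda>x. (x, x)) ` topspace (NT Z))"
    by (auto simp: closedin_def)
  then show "Hausdorff_space (NT Z)" by (simp add: Hausdorff_space_closedin_diagonal)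
  fix x assume "x \<in> topspace (NT Z)"
  then have x: "x \<in> rat_pts Z" "x \<in> pts Z" using rat_pts_subset[of Z] by (auto simp: Z)
  then obtain U where U: "openin (ztop Z) U" "affine_variety (subvar Z U)" "x \<in> U"
    using assms unfolding variety_over_F_def by blast
  have "subtopology (NT Z) (U \<inter> rat_pts Z) = subtopology (NT Z) U"
    by (rule subtopology_NT_rat[OF Z])
  then show "\<exists>W. openin (NT Z) W \<and> x \<in> W \<and> l_space (subtopology (NT Z) W)"
    using openin_NT_open[OF Z U(1)] U(3) x l_space_affine_open[OF Z U(1,2)]
    by (intro exI[of _ "U \<inter> rat_pts Z"]) auto
qed

end

section \<open>The action of the rational points\<close>

locale rational_action = local_field v
  for v :: "'f::field \<Rightarrow> real" +
  fixes G :: "('g, 'f alg_closure) alg_group"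
    and act :: "'g \<Rightarrow> 'x \<Rightarrow> 'x"
    and Z :: "('x, 'f alg_closure) fspace"
  assumes linear_algebraic_group: "linear_algebraic_group G"
    and group_variety: "group_variety G act Z"
begin

lemma variety_Z: "variety_over_F Z"
  and group_action: "group_action G (pts Z) act"
  and action_morphism: "morphism (fprod (variety G) Z) Z (\<lambda>(g, x). act g x)"
  using group_variety unfolding group_variety_def by blast+

lemma self_generated_Z: "self_generated Z"
  by (rule variety_self_generated[OF variety_Z])

lemma carrier_G: "carrier G = pts (variety G)"
  using linear_algebraic_group unfolding linear_algebraic_group_def by blast

lemma self_generated_G: "self_generated (variety G)"
  using linear_algebraic_group variety_self_generated unfolding linear_algebraic_group_def by blast

lemma group_G: "group G"
  using linear_algebraic_group unfolding linear_algebraic_group_def by blast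

lemma rat_carrier: "g \<in> rat_pts (variety G) \<Longrightarrow> g \<in> carrier G"
  using rat_pts_subset[of "variety G"] carrier_G by blast

lemma inv_rat: "g \<in> rat_pts (variety G) \<Longrightarrow> inv\<^bsub>G\<^esub> g \<in> rat_pts (variety G)"
  using linear_algebraic_group morphism_rat_pts[of "variety G" "variety G" "\<lambda>g. inv\<^bsub>G\<^esub> g"]
  unfolding linear_algebraic_group_def by blast

lemma act_pts: "g \<in> carrier G \<Longrightarrow> x \<in> pts Z \<Longrightarrow> act g x \<in> pts Z"
  using group_action.element_image[OF group_action] by blast

lemma act_inv:
  assumes "g \<in> carrier G" "x \<in> pts Z"
  shows "act (inv\<^bsub>G\<^esub> g) (act g x) = x" "act g (act (inv\<^bsub>G\<^esub> g) x) = x"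
proof -
  have ig: "inv\<^bsub>G\<^esub> g \<in> carrier G" and "inv\<^bsub>G\<^esub> (inv\<^bsub>G\<^esub> g) = g"
    using group.inv_closed[OF group_G assms(1)] group.inv_inv[OF group_G assms(1)] .
  then show "act (inv\<^bsub>G\<^esub> g) (act g x) = x" "act g (act (inv\<^bsub>G\<^esub> g) x) = x"
    using group_action.orbit_sym_aux[OF group_action assms refl]
      group_action.orbit_sym_aux[OF group_action ig assms(2) refl] by simp_all
qed

lemma openin_act_locus:
  assumes "openin (ztop Z) V"
  shows "openin (ztop (fprod (variety G) Z)) {p \<in> pts (fprod (variety G) Z). (\<lambda>(g, x). act g x) p \<in> V}"
  using action_morphism assms unfolding morphism_def continuous_map_def pts_def by blast

text \<open>
  Translation by a point \<open>g\<close> over \<open>K\<close> does not preserve the rational points, but translated Zariski open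
  sets still cut out open sets on them. This replaces \<open>G(K)\<close>-invariance of Zariski closures.
\<close>

lemma openin_translate:
  assumes "g \<in> carrier G" "openin (ztop Z) V"
  shows "openin (NT Z) {x \<in> rat_pts Z. act g x \<in> V}"
proof -
  have "{x \<in> rat_pts Z. act g x \<in> V} =
      {x \<in> rat_pts Z. (g, x) \<in> {p \<in> pts (fprod (variety G) Z). (\<lambda>(g, x). act g x) p \<in> V}}"
    using assms(1) rat_pts_subset[of Z] by (auto simp: pts_fprod[OF self_generated_G self_generated_Z] carrier_G)
  then show ?thesis using openin_fprod_slice[OF self_generated_Z openin_act_locus[OF assms(2)], of g] by simp
qed

text \<open>
  The pair \<open>(g, x)\<close> is a rational point of the product, and morphisms over \<open>F\<close> preserve rational
  points.
\<close>

lemma act_rat: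
  assumes "g \<in> rat_pts (variety G)" "x \<in> rat_pts Z"
  shows "act g x \<in> rat_pts Z"
proof -
  have "(g, x) \<in> rat_pts (fprod (variety G) Z)"
    unfolding rat_pts_def[of "fprod (variety G) Z"]
  proof (intro CollectI conjI allI impI ballI)
    show "(g, x) \<in> pts (fprod (variety G) Z)"
      using assms rat_pts_subset[of Z] rat_pts_subset[of "variety G"] by (auto simp: pts_fprod[OF self_generated_G self_generated_Z])
    fix U f assume U: "openin (ztop (fprod (variety G) Z)) U \<and> (g, x) \<in> U"
      and f: "f \<in> regs (fprod (variety G) Z) U"
    show "f (g, x) \<in> base_field"
      using F_continuous_base[OF F_continuous_fprod_slice[OF self_generated_Z assms(1) f], of x] U assms(2) by (simp add: self_generated_Z)
  qed
  from morphism_rat_pts[OF action_morphism this] show ?thesis by simp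
qed

lemma act_continuous:
  assumes g: "g \<in> rat_pts (variety G)"
  shows "continuous_map (NT Z) (NT Z) (act g)"
  unfolding natural_topology_def[of v Z]
proof (rule continuous_on_generated_topo, fold natural_topology_def[of v Z])
  fix B assume "B \<in> {{x \<in> U \<inter> rat_pts Z. f x \<in> to_ac ` S} |U f S.
          openin (ztop Z) U \<and> f \<in> regs Z U \<and> openin FT S}"
  then obtain U f S where U: "openin (ztop Z) U" "f \<in> regs Z U" "openin FT S"
    "B = {x \<in> U \<inter> rat_pts Z. f x \<in> to_ac ` S}" by blast
  define V where "V = {p \<in> pts (fprod (variety G) Z). (\<lambda>(g, x). act g x) p \<in> U}"
  have f': "f \<circ> (\<lambda>(g, x). act g x) \<in> regs (fprod (variety G) Z) V"
    using action_morphism U(1,2) unfolding morphism_def V_def by blast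
  have V: "(g, x) \<in> V \<longleftrightarrow> act g x \<in> U" if "x \<in> rat_pts Z" for x
    using that g rat_pts_subset[of Z] rat_pts_subset[of "variety G"] unfolding V_def
    by (auto simp: pts_fprod[OF self_generated_G self_generated_Z])
  let ?T = "subtopology (NT Z) ({x. (g, x) \<in> V} \<inter> rat_pts Z)"
  have op: "openin (NT Z) ({x. (g, x) \<in> V} \<inter> rat_pts Z)"
    using openin_fprod_slice[OF self_generated_Z openin_act_locus[OF U(1)], of g] unfolding V_def
    by (rule back_subst[of "openin _"]) auto
  have "openin ?T {x \<in> topspace ?T. (f \<circ> (\<lambda>(g, x). act g x)) (g, x) \<in> to_ac ` S}"
    unfolding subtopology_NT_rat[OF self_generated_Z] by (rule F_continuous_openin[OF F_continuous_fprod_slice[OF self_generated_Z g f'] U(3)])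
  then have "openin (NT Z) {x \<in> topspace ?T. (f \<circ> (\<lambda>(g, x). act g x)) (g, x) \<in> to_ac ` S}"
    unfolding openin_open_subtopology[OF op] by (rule conjunct1)
  moreover have "{x \<in> topspace ?T. (f \<circ> (\<lambda>(g, x). act g x)) (g, x) \<in> to_ac ` S} = act g -` B \<inter> topspace (NT Z)"
    unfolding U(4) using V act_rat[OF g] by (auto simp: self_generated_Z)
  ultimately show "openin (NT Z) (act g -` B \<inter> topspace (NT Z))" by simp
next
  have "act g ` topspace (NT Z) \<subseteq> topspace (NT Z)" using act_rat[OF g] by (auto simp: self_generated_Z)
  then show "act g ` topspace (NT Z) \<subseteq> \<Union> {{x \<in> U \<inter> rat_pts Z. f x \<in> to_ac ` S} |U f S.
          openin (ztop Z) U \<and> f \<in> regs Z U \<and> openin FT S}"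
    unfolding natural_topology_def[of v Z] topology_generated_by_topspace .
qed

lemma act_homeomorphic:
  assumes g: "g \<in> rat_pts (variety G)"
  shows "homeomorphic_maps (NT Z) (NT Z) (act g) (act (inv\<^bsub>G\<^esub> g))"
  unfolding homeomorphic_maps_def
  using act_continuous[OF g] act_continuous[OF inv_rat[OF g]] act_inv[OF rat_carrier[OF g]] rat_pts_subset[of Z]
  by (auto simp: self_generated_Z)

lemma translate_schwartz:
  assumes "g \<in> rat_pts (variety G)" "\<phi> \<in> Schw v Z"
  shows "translate G act Z g \<phi> \<in> Schw v Z"
  using schwartz_push[OF act_homeomorphic[OF assms(1)] assms(2)] unfolding translate_def by (simp add: self_generated_Z)

section \<open>The stratification by orbits\<close>

abbreviation strata :: "'x set set" where "strata \<equiv> var_orbits G act Z"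

lemma strata_subset: "Y \<in> strata \<Longrightarrow> Y \<subseteq> pts Z"
  unfolding orbits_def orbit_def using act_pts by blast

lemma strata_cover: "x \<in> pts Z \<Longrightarrow> \<exists>Y\<in>strata. x \<in> Y"
  unfolding orbits_def using group_action.orbit_refl[OF group_action] by blast

lemma strata_disjoint: "Y \<in> strata \<Longrightarrow> Y' \<in> strata \<Longrightarrow> x \<in> Y \<Longrightarrow> x \<in> Y' \<Longrightarrow> Y = Y'"
  using group_action.disjoint_union[OF group_action] by blast

lemma strata_act: "Y \<in> strata \<Longrightarrow> x \<in> Y \<Longrightarrow> g \<in> carrier G \<Longrightarrow> act g x \<in> Y"
proof -
  assume Y: "Y \<in> strata" "x \<in> Y" and g: "g \<in> carrier G"
  then have x: "x \<in> pts Z" using strata_subset by blast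
  have "orbit G act x \<in> strata" using x unfolding orbits_def by blast
  then have "orbit G act x = Y"
    using strata_disjoint[OF _ Y(1) _ Y(2)] group_action.orbit_refl[OF group_action x] by blast
  then show "act g x \<in> Y" using g unfolding orbit_def by blast
qed

lemma strata_transitive:
  assumes "Y \<in> strata" "x \<in> Y" "y \<in> Y"
  obtains g where "g \<in> carrier G" "act g x = y"
proof -
  have x: "x \<in> pts Z" using assms strata_subset by blast
  have "orbit G act x \<in> strata" using x unfolding orbits_def by blast
  then have "orbit G act x = Y"
    using strata_disjoint[OF _ assms(1) _ assms(2)] group_action.orbit_refl[OF group_action x] by blast
  then show thesis using assms(3) that unfolding orbit_def by blast
qed

abbreviation rat_part :: "'x set \<Rightarrow> 'x set" where "rat_part Y \<equiv> Y \<inter> rat_pts Z"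
abbreviation cl :: "'x set \<Rightarrow> 'x set" where "cl A \<equiv> Abstract_Topology.closure_of (NT Z) A"

lemma rat_pts_stratum: "Y \<in> strata \<Longrightarrow> rat_pts (subvar Z Y) = rat_part Y"
  by (rule rat_pts_subvar[OF self_generated_Z strata_subset])

lemma NT_stratum: "Y \<in> strata \<Longrightarrow> NT (subvar Z Y) = subtopology (NT Z) (rat_part Y)"
  by (simp add: NT_subvar[OF self_generated_Z strata_subset] subtopology_NT_rat[OF self_generated_Z])

end

locale ordered_action = rational_action v G act Z
  for v :: "'f::field \<Rightarrow> real"
    and G :: "('g, 'f alg_closure) alg_group"
    and act :: "'g \<Rightarrow> 'x \<Rightarrow> 'x"
    and Z :: "('x, 'f alg_closure) fspace" +
  assumes locally_closed: "\<forall>Y \<in> var_orbits G act Z. subvariety_over_F Z Y"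
    and ordered: "ordered_variety v G act Z"
begin

abbreviation le :: "'x set \<Rightarrow> 'x set \<Rightarrow> bool" where
  "le Y' Y \<equiv> (Y', Y) \<in> closure_order v G act Z"

lemma le_iff: "le Y' Y \<longleftrightarrow> Y' \<in> strata \<and> Y \<in> strata \<and> rat_part Y' \<subseteq> cl (rat_part Y)"
  unfolding closure_order_def using rat_pts_stratum by auto

lemma le_refl: "Y \<in> strata \<Longrightarrow> le Y Y"
  and le_trans: "le Y1 Y2 \<Longrightarrow> le Y2 Y3 \<Longrightarrow> le Y1 Y3"
  and le_antisym: "le Y1 Y2 \<Longrightarrow> le Y2 Y1 \<Longrightarrow> Y1 = Y2"
  and le_total: "Y1 \<in> strata \<Longrightarrow> Y2 \<in> strata \<Longrightarrow> le Y1 Y2 \<or> le Y2 Y1"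
proof -
  have lin: "linear_order_on strata (closure_order v G act Z)"
    using ordered unfolding ordered_variety_def .
  show refl: "Y \<in> strata \<Longrightarrow> le Y Y" for Y
    using lin unfolding order_on_defs refl_on_def by blast
  show "le Y1 Y2 \<Longrightarrow> le Y2 Y3 \<Longrightarrow> le Y1 Y3"
    using lin unfolding order_on_defs trans_def by blast
  show "le Y1 Y2 \<Longrightarrow> le Y2 Y1 \<Longrightarrow> Y1 = Y2"
    using lin unfolding order_on_defs antisym_def by blast
  show "Y1 \<in> strata \<Longrightarrow> Y2 \<in> strata \<Longrightarrow> le Y1 Y2 \<or> le Y2 Y1"
    using lin refl[of Y1] unfolding order_on_defs total_on_def by (cases "Y1 = Y2") auto
qed

text \<open>
  If the claim fails, then \<open>Y < Y''\<close> because the order is total, so \<open>Y(F)\<close> and \<open>Y''(F)\<close> meet each other's closures. Writing \<open>Y = C \<inter> U\<close> with \<open>C\<close> closed and \<open>U\<close>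
  open, \<open>U\<close> contains a rational point \<open>y''\<close> of \<open>Y''\<close>, which lies outside \<open>C\<close>. It is a translate \<open>g x\<close> over
  \<open>K\<close>, so near \<open>x\<close> translation by \<open>g\<close> avoids \<open>C\<close>. But \<open>x\<close> is a limit of points of \<open>Y(F)\<close>, and those stay in
  \<open>Y \<subseteq> C\<close> under \<open>g\<close>.
\<close>

lemma closure_stratum:
  assumes Y: "Y \<in> strata" "Y'' \<in> strata" and x: "x \<in> rat_part Y''" "x \<in> cl (rat_part Y)"
  shows "le Y'' Y"
proof (rule ccontr)
  assume nle: "\<not> le Y'' Y"
  then have le: "le Y Y''" using le_total Y by blast
  have ne: "Y \<noteq> Y''" using nle le_refl Y by blast
  obtain C U where CU: "closedin (ztop Z) C" "openin (ztop Z) U" "Y = C \<inter> U"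
    using locally_closed Y(1) unfolding subvariety_over_F_def by blast
  have "rat_part Y \<noteq> {}" using x(2) by auto
  then obtain y where y: "y \<in> rat_part Y" by blast
  then have "y \<in> cl (rat_part Y'')" using le unfolding le_iff by blast
  moreover have "openin (NT Z) (U \<inter> rat_pts Z)" by (rule openin_NT_open[OF self_generated_Z CU(2)])
  moreover have "y \<in> U \<inter> rat_pts Z" using y CU(3) by blast
  ultimately obtain y'' where y'': "y'' \<in> rat_part Y''" "y'' \<in> U" unfolding in_closure_of by blast
  then have "y'' \<notin> Y" using strata_disjoint[OF Y] ne by blast
  then have nC: "y'' \<notin> C" using y''(2) CU(3) by blast
  obtain g where g: "g \<in> carrier G" "act g x = y''"
    using strata_transitive[OF Y(2)] x(1) y''(1) by blast
  have "openin (ztop Z) (pts Z - C)" using CU(1) unfolding closedin_def pts_def by blast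
  then have "openin (NT Z) {z \<in> rat_pts Z. act g z \<in> pts Z - C}" by (rule openin_translate[OF g(1)])
  moreover have "x \<in> {z \<in> rat_pts Z. act g z \<in> pts Z - C}"
    using x(1) g(2) y''(1) nC strata_subset[OF Y(2)] by blast
  ultimately obtain z where z: "z \<in> rat_part Y" "z \<in> {z \<in> rat_pts Z. act g z \<in> pts Z - C}"
    using x(2) unfolding in_closure_of by meson
  then have "act g z \<in> Y" "act g z \<notin> C" using strata_act[OF Y(1) _ g(1), of z] by auto
  then show False using CU(3) by blast
qed

text \<open>
  The open unions of strata that filter the Schwartz space.
\<close>

definition up :: "'x set \<Rightarrow> 'x set" where "up Y = (\<Union>Y' \<in> {Y'. le Y Y'}. rat_part Y')"
definition above :: "'x set \<Rightarrow> 'x set" where "above Y = (\<Union>Y' \<in> {Y'. le Y Y' \<and> Y' \<noteq> Y}. rat_part Y')"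

lemma rat_cover: "x \<in> rat_pts Z \<Longrightarrow> \<exists>Y\<in>strata. x \<in> rat_part Y"
  using strata_cover rat_pts_subset[of Z] by blast

lemma above_eq:
  assumes "Y \<in> strata"
  shows "above Y = rat_pts Z - cl (rat_part Y)"
proof (intro equalityI subsetI)
  fix x assume "x \<in> above Y"
  then obtain Y' where Y': "le Y Y'" "Y' \<noteq> Y" "x \<in> rat_part Y'" unfolding above_def by blast
  then have "Y' \<in> strata" unfolding le_iff by blast
  then have "x \<notin> cl (rat_part Y)" using closure_stratum[OF assms _ Y'(3)] le_antisym Y' by blast
  then show "x \<in> rat_pts Z - cl (rat_part Y)" using Y' by blast
next
  fix x assume x: "x \<in> rat_pts Z - cl (rat_part Y)"
  then obtain Y' where Y': "Y' \<in> strata" "x \<in> rat_part Y'" using rat_cover by blast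
  then have "\<not> le Y' Y" using x unfolding le_iff by blast
  then show "x \<in> above Y" using Y' le_total[OF Y'(1) assms] le_refl[OF assms] unfolding above_def by blast
qed

lemma openin_above: "Y \<in> strata \<Longrightarrow> openin (NT Z) (above Y)"
  using above_eq topspace_NT[OF self_generated_Z] closedin_closure_of[of "NT Z" "rat_part Y"] by (simp add: closedin_def)

lemma up_eq: "Y \<in> strata \<Longrightarrow> up Y = above Y \<union> rat_part Y"
  unfolding up_def above_def using le_refl by blast

lemma rat_part_subset_cl: "rat_part Y \<subseteq> cl (rat_part Y)"
  by (rule closure_of_subset) (simp add: self_generated_Z)

lemma stratum_eq:
  assumes "Y \<in> strata" shows "rat_part Y = up Y \<inter> cl (rat_part Y)"
  using rat_part_subset_cl[of Y] up_eq[OF assms] above_eq[OF assms] by blast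

text \<open>
  With \<open>Y = C \<inter> U\<close> for \<open>C\<close> closed and \<open>U\<close> open, \<open>up Y\<close> is \<open>above Y\<close> together with the rational points of \<open>U\<close>: those points of
  \<open>U\<close> that lie in the closure of \<open>Y(F)\<close> also lie in \<open>C\<close>, hence in \<open>Y\<close>.
\<close>

lemma openin_up:
  assumes "Y \<in> strata" shows "openin (NT Z) (up Y)"
proof -
  obtain C U where CU: "closedin (ztop Z) C" "openin (ztop Z) U" "Y = C \<inter> U"
    using locally_closed assms unfolding subvariety_over_F_def by blast
  have "openin (NT Z) ((pts Z - C) \<inter> rat_pts Z)"
    by (rule openin_NT_open[OF self_generated_Z]) (use CU(1) in \<open>auto simp: closedin_def pts_def\<close>)
  then have "closedin (NT Z) (C \<inter> rat_pts Z)"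
    unfolding closedin_def topspace_NT[OF self_generated_Z]
    by (intro conjI) (auto elim!: back_subst[of "openin _"] dest: subsetD[OF rat_pts_subset])
  then have "cl (rat_part Y) \<subseteq> C" using closure_of_minimal[of "rat_part Y" "C \<inter> rat_pts Z" "NT Z"] CU(3) by blast
  then have "U \<inter> rat_pts Z \<subseteq> above Y \<union> rat_part Y" using CU(3) above_eq[OF assms] by blast
  then have "up Y = above Y \<union> (U \<inter> rat_pts Z)" using up_eq[OF assms] CU(3) by blast
  then show ?thesis using openin_Un[OF openin_above[OF assms] openin_NT_open[OF self_generated_Z CU(2)]] by simp
qed

text \<open>
  The union of the closures of the \<open>y i\<close> is closed, because its complement is a union of sets \<open>up Y\<close>. It is
  therefore a Baire space, and some closure has interior in it. An open set inside the closure of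
  \<open>y i\<close> meets \<open>y (Suc i)\<close>, whose closure contains \<open>y i\<close>, and this contradicts antisymmetry.
\<close>

lemma no_ascending_chain:
  assumes y: "\<And>i::nat. le (y i) (y (Suc i))" "\<And>i. y i \<noteq> y (Suc i)"
  shows False
proof -
  have ys: "y i \<in> strata" for i using y(1) unfolding le_iff by blast
  define C where "C = (\<Union>i. cl (rat_part (y i)))"
  have "cl A \<subseteq> rat_pts Z" for A using closure_of_subset_topspace[of "NT Z" A] by (simp add: self_generated_Z)
  then have CZ: "C \<subseteq> rat_pts Z" unfolding C_def by blast
  have "openin (NT Z) (rat_pts Z - C)"
  proof (subst openin_subopen, intro ballI)
    fix x assume x: "x \<in> rat_pts Z - C"
    then obtain Y where Y: "Y \<in> strata" "x \<in> rat_part Y" using rat_cover by blast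
    have nle: "\<not> le Y (y i)" for i using x Y(2) unfolding C_def le_iff by blast
    have "z \<notin> C" if z: "z \<in> up Y" for z
    proof
      assume "z \<in> C"
      then obtain i where i: "z \<in> cl (rat_part (y i))" unfolding C_def by blast
      obtain Y' where Y': "le Y Y'" "z \<in> rat_part Y'" using z unfolding up_def by blast
      then have "Y' \<in> strata" unfolding le_iff by blast
      then have "le Y' (y i)" using closure_stratum[OF ys _ Y'(2) i] by blast
      then show False using le_trans[OF Y'(1)] nle by blast
    qed
    moreover have "x \<in> up Y" using Y up_eq by blast
    moreover have "up Y \<subseteq> rat_pts Z" unfolding up_def by blast
    ultimately show "\<exists>W. openin (NT Z) W \<and> x \<in> W \<and> W \<subseteq> rat_pts Z - C"
      using openin_up[OF Y(1)] by blast
  qed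
  then have Ccl: "closedin (NT Z) C" using CZ by (simp add: closedin_def self_generated_Z)
  let ?T = "subtopology (NT Z) C"
  have top: "topspace ?T = C" using CZ by (auto simp: self_generated_Z)
  have l: "l_space ?T" by (rule l_space_subtopology_closed[OF l_space_variety[OF variety_Z] Ccl])
  then have reg: "locally_compact_space ?T \<and> regular_space ?T"
    using l_space_locally_compact locally_compact_Hausdorff_imp_regular_space unfolding l_space_def by blast
  have "Abstract_Topology.interior_of ?T (\<Union>(range (\<lambda>i. cl (rat_part (y i))))) = {}"
  proof (rule Baire_category_alt)
    show "completely_metrizable_space ?T \<or> locally_compact_space ?T \<and> regular_space ?T" using reg by blast
    fix A assume "A \<in> range (\<lambda>i. cl (rat_part (y i)))"
    then obtain i where A: "A = cl (rat_part (y i))" by blast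
    then have AC: "A \<subseteq> C" unfolding C_def by blast
    show "closedin ?T A \<and> Abstract_Topology.interior_of ?T A = {}"
    proof
      show "closedin ?T A" using AC unfolding A by (simp add: closedin_subset_topspace)
      show "Abstract_Topology.interior_of ?T A = {}"
      proof (rule ccontr)
        assume "Abstract_Topology.interior_of ?T A \<noteq> {}"
        then obtain W w where W: "openin ?T W" "W \<subseteq> A" "w \<in> W" unfolding interior_of_def by blast
        then obtain V where V: "openin (NT Z) V" "W = V \<inter> C" by (auto simp: openin_subtopology)
        have "cl (rat_part (y i)) \<subseteq> cl (rat_part (y (Suc i)))"
          by (rule closure_of_minimal) (use y(1)[of i] in \<open>auto simp: le_iff\<close>)
        then have "w \<in> cl (rat_part (y (Suc i)))" using W A by blast
        then obtain z where z: "z \<in> rat_part (y (Suc i))" "z \<in> V" using V W(3) unfolding in_closure_of by blast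
        then have "z \<in> C" using rat_part_subset_cl unfolding C_def by blast
        then have "z \<in> cl (rat_part (y i))" using z V W(2) A by blast
        then have "le (y (Suc i)) (y i)" using closure_stratum[OF ys ys z(1)] by blast
        then show False using le_antisym[OF y(1)[of i]] y(2)[of i] by simp
      qed
    qed
  qed simp
  moreover have "Abstract_Topology.interior_of ?T C = C"
    using openin_topspace[of ?T] unfolding top by (simp add: interior_of_openin)
  ultimately have "C = {}" unfolding C_def by simp
  then have "rat_part (y i) = {}" for i using rat_part_subset_cl[of "y i"] unfolding C_def by blast
  then have "le (y (Suc 0)) (y 0)" using ys unfolding le_iff by blast
  then show False using le_antisym[OF y(1)[of 0]] y(2)[of 0] by simp
qed

lemma maximal_stratum:
  assumes "D \<subseteq> strata" "D \<noteq> {}"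
  obtains Y where "Y \<in> D" "\<And>Y'. Y' \<in> D \<Longrightarrow> le Y Y' \<Longrightarrow> Y' = Y"
proof -
  have wf: "wf {(Y', Y). le Y Y' \<and> Y \<noteq> Y'}"
    unfolding wf_iff_no_infinite_down_chain
  proof
    assume "\<exists>y. \<forall>i. (y (Suc i), y i) \<in> {(Y', Y). le Y Y' \<and> Y \<noteq> Y'}"
    then obtain y where "\<forall>i. (y (Suc i), y i) \<in> {(Y', Y). le Y Y' \<and> Y \<noteq> Y'}" by (elim exE)
    then show False using no_ascending_chain[of y] by simp
  qed
  obtain Y0 where "Y0 \<in> D" using assms(2) by blast
  then show thesis
  proof (rule wfE_min[OF wf])
    fix Y assume Y: "Y \<in> D" "\<And>Y'. (Y', Y) \<in> {(Y', Y). le Y Y' \<and> Y \<noteq> Y'} \<Longrightarrow> Y' \<notin> D"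
    then show thesis by (intro that[of Y]) auto
  qed
qed

text \<open>
  The sets \<open>up Y\<close> form a chain, so a finite subcover of a compact set reduces to one of them.
\<close>

lemma compact_in_up:
  assumes K: "compactin (NT Z) K" "K \<noteq> {}" and I: "I \<subseteq> strata" "K \<subseteq> \<Union>(up ` I)"
  obtains Y where "Y \<in> I" "K \<subseteq> up Y"
proof -
  have "\<And>U. U \<in> up ` I \<Longrightarrow> openin (NT Z) U" using openin_up I(1) by blast
  from compactinD[OF K(1) this I(2)] obtain \<F> where "finite \<F>" "\<F> \<subseteq> up ` I" "K \<subseteq> \<Union>\<F>" by blast
  then obtain F where F: "finite F" "F \<subseteq> I" "K \<subseteq> \<Union>(up ` F)" by (metis finite_subset_image)
  then have "F \<noteq> {}" using K(2) by auto
  with F(1) have "F \<subseteq> I \<Longrightarrow> \<exists>Y\<in>F. \<forall>Y'\<in>F. le Y Y'"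
  proof (induction rule: finite_ne_induct)
    case (singleton x)
    then show ?case using le_refl I(1) by blast
  next
    case (insert x F)
    then obtain Y where Y: "Y \<in> F" "\<forall>Y'\<in>F. le Y Y'" by auto
    have "x \<in> strata" "Y \<in> strata" using insert.prems Y(1) I(1) by auto
    then show ?case using Y le_total[of x Y] le_refl le_trans by (metis insert_iff)
  qed
  then obtain Y where Y: "Y \<in> F" "\<And>Y'. Y' \<in> F \<Longrightarrow> le Y Y'" using F(2) by blast
  have "up Y' \<subseteq> up Y" if "Y' \<in> F" for Y'
    using le_trans[OF Y(2)[OF that]] unfolding up_def by blast
  then have "K \<subseteq> up Y" using F(3) by blast
  then show thesis using that Y(1) F(2) by blast
qed

lemma up_act:
  assumes "g \<in> rat_pts (variety G)" "y \<in> rat_pts Z" "act (inv\<^bsub>G\<^esub> g) y \<in> up Y"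
  shows "y \<in> up Y"
proof -
  obtain Y' where Y': "le Y Y'" "act (inv\<^bsub>G\<^esub> g) y \<in> Y'" using assms(3) unfolding up_def by blast
  then have "act g (act (inv\<^bsub>G\<^esub> g) y) \<in> Y'"
    using strata_act rat_carrier[OF assms(1)] unfolding le_iff by blast
  moreover have "act g (act (inv\<^bsub>G\<^esub> g) y) = y"
    using act_inv(2)[OF rat_carrier[OF assms(1)]] assms(2) rat_pts_subset[of Z] by blast
  ultimately show ?thesis using assms(2) Y'(1) unfolding up_def by auto
qed

end

section \<open>Descent of morphisms to strata\<close>

lemma complex_ring_simps [simp]:
  "carrier complex_ring = UNIV" "x \<oplus>\<^bsub>complex_ring\<^esub> y = x + y" "x \<otimes>\<^bsub>complex_ring\<^esub> y = x * y"
  "\<zero>\<^bsub>complex_ring\<^esub> = 0" "\<one>\<^bsub>complex_ring\<^esub> = 1"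
  by (simp_all add: ring_of_type_algebra_def)

lemma complex_module_neg:
  assumes "module complex_ring M" "x \<in> carrier M"
  shows "(- c) \<odot>\<^bsub>M\<^esub> x \<oplus>\<^bsub>M\<^esub> c \<odot>\<^bsub>M\<^esub> x = \<zero>\<^bsub>M\<^esub>"
proof -
  interpret module complex_ring M by fact
  have "(- c) \<odot>\<^bsub>M\<^esub> x \<oplus>\<^bsub>M\<^esub> c \<odot>\<^bsub>M\<^esub> x = (- c + c) \<odot>\<^bsub>M\<^esub> x"
    using smult_l_distr[of "- c" c x] assms(2) by simp
  then show ?thesis using smult_l_null[OF assms(2)] by simp
qed

lemma complex_module_eqI:
  assumes "module complex_ring M" "x \<in> carrier M" "y \<in> carrier M"
    and "(- c) \<odot>\<^bsub>M\<^esub> x \<oplus>\<^bsub>M\<^esub> y = \<zero>\<^bsub>M\<^esub>"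
  shows "y = c \<odot>\<^bsub>M\<^esub> x"
proof -
  interpret module complex_ring M by fact
  have closed: "(- c) \<odot>\<^bsub>M\<^esub> x \<in> carrier M" "c \<odot>\<^bsub>M\<^esub> x \<in> carrier M" using assms(2) by auto
  have "(- c) \<odot>\<^bsub>M\<^esub> x \<oplus>\<^bsub>M\<^esub> y = (- c) \<odot>\<^bsub>M\<^esub> x \<oplus>\<^bsub>M\<^esub> c \<odot>\<^bsub>M\<^esub> x"
    using assms(4) complex_module_neg[OF assms(1,2), of c] by simp
  then show ?thesis using M.add.l_cancel closed assms(3) by blast
qed

context ordered_action
begin

abbreviation restr :: "'x set \<Rightarrow> ('x \<Rightarrow> complex) \<Rightarrow> 'x \<Rightarrow> complex" where
  "restr Y \<phi> \<equiv> (\<lambda>x. if x \<in> rat_part Y then \<phi> x else 0)"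

abbreviation Schw_on :: "'x set \<Rightarrow> ('x \<Rightarrow> complex) set" where
  "Schw_on W \<equiv> {\<phi> \<in> Schw v Z. supp (NT Z) \<phi> \<subseteq> W}"

lemma l_space_Z: "l_space (NT Z)"
  by (rule l_space_variety[OF variety_Z])

lemma closedin_cl: "closedin (NT Z) (cl A)"
  by simp

text \<open>
  Restriction and extension between \<open>S(up Y)\<close> and \<open>S(Y)\<close>: both rest on \<open>Y(F)\<close> being closed in the open
  set \<open>up Y\<close>.
\<close>

lemma restr_schwartz:
  assumes "Y \<in> strata" "\<phi> \<in> Schw_on (up Y)"
  shows "restr Y \<phi> \<in> Schw v (subvar Z Y)"
  unfolding NT_stratum[OF assms(1)]
  by (rule schwartz_restrict[OF _ closedin_cl _ stratum_eq[OF assms(1)]]) (use assms(2) in auto)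

lemma extend_schwartz:
  assumes "Y \<in> strata" "\<psi> \<in> Schw v (subvar Z Y)"
  shows "\<exists>\<phi>. \<phi> \<in> Schw_on (up Y) \<and> (\<forall>x\<in>rat_part Y. \<phi> x = \<psi> x)"
  by (rule schwartz_extend[OF l_space_Z openin_up[OF assms(1)] stratum_eq[OF assms(1)]
        assms(2)[unfolded NT_stratum[OF assms(1)]]]) blast

lemma Schw_on_lincomb:
  assumes "\<phi> \<in> Schw_on W" "\<psi> \<in> Schw_on W"
  shows "(\<lambda>y. c * \<phi> y + \<psi> y) \<in> Schw_on W"
proof -
  have *: "(\<lambda>y. c * \<phi> y + \<psi> y) \<in> Schw v Z" using assms schwartz_lincomb by blast
  have "x \<in> W" if "c * \<phi> x + \<psi> x \<noteq> 0" for x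
  proof -
    have "\<phi> x \<noteq> 0 \<or> \<psi> x \<noteq> 0" using that by auto
    then show ?thesis using assms by (auto simp: supp_schwartz)
  qed
  then show ?thesis using * by (auto simp: supp_schwartz)
qed

lemma translate_Schw_on:
  assumes g: "g \<in> rat_pts (variety G)" and \<phi>: "\<phi> \<in> Schw_on (up Y)"
  shows "translate G act Z g \<phi> \<in> Schw_on (up Y)"
proof -
  have *: "translate G act Z g \<phi> \<in> Schw v Z" using translate_schwartz[OF g] \<phi> by blast
  have "y \<in> up Y" if "translate G act Z g \<phi> y \<noteq> 0" for y
  proof -
    from that have y: "y \<in> rat_pts Z" "\<phi> (act (inv\<^bsub>G\<^esub> g) y) \<noteq> 0"
      unfolding translate_def by (auto split: if_splits)
    then have "act (inv\<^bsub>G\<^esub> g) y \<in> up Y" using \<phi> by (auto simp: supp_schwartz)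
    then show ?thesis by (rule up_act[OF g y(1)])
  qed
  then show ?thesis using * by (auto simp: supp_schwartz)
qed

lemma translate_restr:
  assumes Y: "Y \<in> strata" and g: "g \<in> rat_pts (variety G)" and eq: "\<forall>x\<in>rat_part Y. \<phi> x = \<psi> x"
  shows "translate G act (subvar Z Y) g \<psi> = restr Y (translate G act Z g \<phi>)"
proof
  fix y
  show "translate G act (subvar Z Y) g \<psi> y = restr Y (translate G act Z g \<phi>) y"
  proof (cases "y \<in> rat_part Y")
    case True
    then have "act (inv\<^bsub>G\<^esub> g) y \<in> rat_part Y"
      using strata_act[OF Y _ rat_carrier[OF inv_rat[OF g]]] act_rat[OF inv_rat[OF g]] by blast
    then show ?thesis using True eq by (simp add: translate_def rat_pts_stratum[OF Y])
  next
    case False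
    then show ?thesis unfolding translate_def rat_pts_stratum[OF Y] by (simp only: if_False)
  qed
qed

end

locale equivariant_map = ordered_action v G act Z
  for v :: "'f::field \<Rightarrow> real"
    and G :: "('g, 'f alg_closure) alg_group"
    and act :: "'g \<Rightarrow> 'x \<Rightarrow> 'x"
    and Z :: "('x, 'f alg_closure) fspace" +
  fixes M :: "(complex, 'v) module" and \<rho> :: "'g \<Rightarrow> 'v \<Rightarrow> 'v" and f :: "('x \<Rightarrow> complex) \<Rightarrow> 'v"
  assumes smooth: "smooth_rep v G M \<rho>"
    and morphism: "rep_morphism v G act Z M \<rho> f"
begin

lemma module_M: "module complex_ring M"
  using smooth unfolding smooth_rep_def by blast

lemma f_closed: "\<phi> \<in> Schw v Z \<Longrightarrow> f \<phi> \<in> carrier M"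
  and f_lincomb: "\<phi> \<in> Schw v Z \<Longrightarrow> \<psi> \<in> Schw v Z \<Longrightarrow> f (\<lambda>y. c * \<phi> y + \<psi> y) = c \<odot>\<^bsub>M\<^esub> f \<phi> \<oplus>\<^bsub>M\<^esub> f \<psi>"
  and f_translate: "g \<in> rat_pts (variety G) \<Longrightarrow> \<phi> \<in> Schw v Z \<Longrightarrow> f (translate G act Z g \<phi>) = \<rho> g (f \<phi>)"
  using morphism unfolding rep_morphism_def by simp_all

lemma f_zero: "f (\<lambda>_. 0) = \<zero>\<^bsub>M\<^esub>"
  using f_lincomb[OF schwartz_zero schwartz_zero, of "-1"]
    complex_module_neg[OF module_M f_closed[OF schwartz_zero], of 1]
    module.smult_one[OF module_M f_closed[OF schwartz_zero]] by simp

definition vanishes_on :: "'x set \<Rightarrow> bool" where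
  "vanishes_on W \<longleftrightarrow> (\<forall>\<phi> \<in> Schw_on W. f \<phi> = \<zero>\<^bsub>M\<^esub>)"

text \<open>
  The difference of the two functions vanishes on \<open>Y(F)\<close>, so its support moves into \<open>above Y\<close>.
\<close>

lemma f_eq_on_stratum:
  assumes Y: "Y \<in> strata" and van: "vanishes_on (above Y)"
    and \<phi>: "\<phi> \<in> Schw_on (up Y)" "\<psi> \<in> Schw_on (up Y)" "\<forall>x\<in>rat_part Y. \<phi> x = \<psi> x"
  shows "f \<phi> = f \<psi>"
proof -
  let ?\<delta> = "\<lambda>y. (- 1) * \<psi> y + \<phi> y"
  have d: "?\<delta> \<in> Schw_on (up Y)" by (rule Schw_on_lincomb[OF \<phi>(2,1)])
  have "supp (NT Z) ?\<delta> \<subseteq> above Y"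
  proof
    fix x assume x: "x \<in> supp (NT Z) ?\<delta>"
    then have "x \<in> up Y" using d by blast
    moreover have "?\<delta> x \<noteq> 0" using x d supp_schwartz[of ?\<delta> "NT Z"] by blast
    ultimately show "x \<in> above Y" using \<phi>(3) up_eq[OF Y] by auto
  qed
  then have "f ?\<delta> = \<zero>\<^bsub>M\<^esub>" using van d unfolding vanishes_on_def by blast
  then have "(- 1) \<odot>\<^bsub>M\<^esub> f \<psi> \<oplus>\<^bsub>M\<^esub> f \<phi> = \<zero>\<^bsub>M\<^esub>" using f_lincomb[of \<psi> \<phi> "-1"] \<phi>(1,2) by simp
  then have "f \<phi> = 1 \<odot>\<^bsub>M\<^esub> f \<psi>"
    using complex_module_eqI[OF module_M f_closed f_closed, of \<psi> \<phi> 1] \<phi>(1,2) by simp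
  then show ?thesis using module.smult_one[OF module_M f_closed, of \<psi>] \<phi>(2) by simp
qed

text \<open>
  The induced morphism is computed on any extension of a function from \<open>Y(F)\<close> to \<open>up Y\<close>. By
  \<open>f_eq_on_stratum\<close> the choice does not matter, which gives linearity and equivariance.
\<close>

lemma descend:
  assumes Y: "Y \<in> strata" and van: "vanishes_on (above Y)"
  obtains f' where "rep_morphism v G act (subvar Z Y) M \<rho> f'"
    "\<And>\<phi>. \<phi> \<in> Schw_on (up Y) \<Longrightarrow> f' (restr Y \<phi>) = f \<phi>"
proof
  define ext where "ext = (\<lambda>\<psi>. SOME \<phi>. \<phi> \<in> Schw_on (up Y) \<and> (\<forall>x\<in>rat_part Y. \<phi> x = \<psi> x))"
  have ext: "ext \<psi> \<in> Schw_on (up Y)" "\<forall>x\<in>rat_part Y. ext \<psi> x = \<psi> x" if "\<psi> \<in> Schw v (subvar Z Y)" for \<psi>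
    using someI_ex[OF extend_schwartz[OF Y that]] unfolding ext_def by blast+
  have key: "f (ext \<psi>) = f \<phi>"
    if "\<psi> \<in> Schw v (subvar Z Y)" "\<phi> \<in> Schw_on (up Y)" "\<forall>x\<in>rat_part Y. \<phi> x = \<psi> x" for \<phi> \<psi>
    using f_eq_on_stratum[OF Y van ext(1)[OF that(1)] that(2)] ext(2)[OF that(1)] that(3) by simp
  show "rep_morphism v G act (subvar Z Y) M \<rho> (\<lambda>\<psi>. f (ext \<psi>))"
    unfolding rep_morphism_def
  proof (intro conjI ballI allI)
    fix \<phi> \<psi> c assume \<phi>: "\<phi> \<in> Schw v (subvar Z Y)" and \<psi>: "\<psi> \<in> Schw v (subvar Z Y)"
    show "f (ext \<phi>) \<in> carrier M" using ext(1)[OF \<phi>] f_closed by blast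
    have "f (ext (\<lambda>y. c * \<phi> y + \<psi> y)) = f (\<lambda>y. c * ext \<phi> y + ext \<psi> y)"
      by (rule key[OF schwartz_lincomb[OF \<phi> \<psi>] Schw_on_lincomb[OF ext(1)[OF \<phi>] ext(1)[OF \<psi>]]])
        (use ext(2)[OF \<phi>] ext(2)[OF \<psi>] in simp)
    then show "f (ext (\<lambda>y. c * \<phi> y + \<psi> y)) = c \<odot>\<^bsub>M\<^esub> f (ext \<phi>) \<oplus>\<^bsub>M\<^esub> f (ext \<psi>)"
      using f_lincomb[of "ext \<phi>" "ext \<psi>" c] ext(1)[OF \<phi>] ext(1)[OF \<psi>] by simp
  next
    fix g \<phi> assume "g \<in> carrier (rat_group G)" and \<phi>: "\<phi> \<in> Schw v (subvar Z Y)"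
    then have g: "g \<in> rat_pts (variety G)" by simp
    note t = translate_Schw_on[OF g ext(1)[OF \<phi>]] and tr = translate_restr[OF Y g ext(2)[OF \<phi>]]
    have "f (ext (translate G act (subvar Z Y) g \<phi>)) = f (translate G act Z g (ext \<phi>))"
      by (rule key) (use t restr_schwartz[OF Y t] in \<open>auto simp: tr\<close>)
    then show "f (ext (translate G act (subvar Z Y) g \<phi>)) = \<rho> g (f (ext \<phi>))"
      using f_translate[OF g] ext(1)[OF \<phi>] by simp
  qed
  show "f (ext (restr Y \<phi>)) = f \<phi>" if "\<phi> \<in> Schw_on (up Y)" for \<phi>
    by (rule key[OF restr_schwartz[OF Y that] that]) simp
qed

text \<open>
  A compact support inside a union of the nested sets \<open>up Y\<close> is contained in one of them.
\<close>

lemma vanishes_on_directed: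
  assumes I: "I \<subseteq> strata" and van: "\<And>Y. Y \<in> I \<Longrightarrow> vanishes_on (up Y)"
    and W: "W \<subseteq> \<Union>(up ` I)"
  shows "vanishes_on W"
  unfolding vanishes_on_def
proof
  fix \<phi> assume \<phi>: "\<phi> \<in> Schw_on W"
  show "f \<phi> = \<zero>\<^bsub>M\<^esub>"
  proof (cases "supp (NT Z) \<phi> = {}")
    case True
    then have "\<phi> = (\<lambda>_. 0)" using \<phi> supp_schwartz[of \<phi> "NT Z"] by auto
    then show ?thesis using f_zero by simp
  next
    case False
    have "compactin (NT Z) (supp (NT Z) \<phi>)" using \<phi> schwartz_compact_supp by blast
    then obtain Y where "Y \<in> I" "supp (NT Z) \<phi> \<subseteq> up Y"
      using compact_in_up[OF _ False I] \<phi> W by (metis (mono_tags, lifting) mem_Collect_eq order_trans)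
    then show ?thesis using van \<phi> unfolding vanishes_on_def by blast
  qed
qed

text \<open>
  The orbit is a maximal one with \<open>f\<close> non-zero on \<open>S(up Y)\<close>. By compactness of supports there are such
  orbits, and by maximality \<open>f\<close> vanishes on all functions supported strictly above it.
\<close>

lemma leading_stratum:
  assumes "\<exists>\<phi> \<in> Schw v Z. f \<phi> \<noteq> \<zero>\<^bsub>M\<^esub>"
  obtains Y where "Y \<in> strata" "vanishes_on (above Y)" "\<not> vanishes_on (up Y)"
proof -
  let ?D = "{Y \<in> strata. \<not> vanishes_on (up Y)}"
  have "rat_pts Z \<subseteq> \<Union>(up ` strata)" using rat_cover up_eq by blast
  moreover have "\<not> vanishes_on (rat_pts Z)"
  proof -
    obtain \<phi> where \<phi>: "\<phi> \<in> Schw v Z" "f \<phi> \<noteq> \<zero>\<^bsub>M\<^esub>" using assms by blast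
    have "supp (NT Z) \<phi> \<subseteq> topspace (NT Z)" unfolding supp_def by (rule closure_of_subset_topspace)
    then show ?thesis using \<phi> unfolding vanishes_on_def by (auto simp: self_generated_Z)
  qed
  ultimately have "?D \<noteq> {}" using vanishes_on_directed[of strata "rat_pts Z"] by blast
  then obtain Y where Y: "Y \<in> ?D" "\<And>Y'. Y' \<in> ?D \<Longrightarrow> le Y Y' \<Longrightarrow> Y' = Y"
    using maximal_stratum[of ?D] by blast
  have "vanishes_on (above Y)"
  proof (rule vanishes_on_directed[of "{Y'. le Y Y' \<and> Y' \<noteq> Y}"])
    show "{Y'. le Y Y' \<and> Y' \<noteq> Y} \<subseteq> strata" unfolding le_iff by blast
    show "vanishes_on (up Y')" if "Y' \<in> {Y'. le Y Y' \<and> Y' \<noteq> Y}" for Y'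
      using that Y(2)[of Y'] unfolding le_iff by blast
    show "above Y \<subseteq> \<Union>(up ` {Y'. le Y Y' \<and> Y' \<noteq> Y})"
      using up_eq unfolding above_def le_iff by blast
  qed
  then show thesis using that Y(1) by blast
qed

end

section \<open>Multiplicity one\<close>

theorem lemma1:
  fixes v :: "'f::field \<Rightarrow> real"
    and G :: "('g, 'f alg_closure) alg_group"
    and B :: "'g set"
    and \<X> :: "('x, 'f alg_closure) fspace"
    and act :: "'g \<Rightarrow> 'x \<Rightarrow> 'x"
  assumes "nonarch_local_field v"
    and "connected_reductive_group G"
    and "borel_subgroup_over_F G B"
    and "spherical_variety G B act \<X>"
    and "\<forall>Y \<in> var_orbits G act \<X>. subvariety_over_F \<X> Y"
    and "ordered_variety v G act \<X>"
    and "\<forall>(M :: (complex, 'v) module) \<rho>.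
           irreducible_smooth_rep v G M \<rho> \<longrightarrow> lifting_property v G act \<X> M \<rho>"
    and "\<forall>Y \<in> var_orbits G act \<X>. multiplicity_free TYPE('v) v G act (subvar \<X> Y)"
  shows "multiplicity_free TYPE('v) v G act \<X>"
  unfolding multiplicity_free_def
proof (intro allI impI)
  interpret ordered_action v G act \<X>
    using assms(1,2,4-6) unfolding connected_reductive_group_def spherical_variety_def
    by unfold_locales blast+
  fix M :: "(complex, 'v) module" and \<rho> f1 f2
  assume *: "irreducible_smooth_rep v G M \<rho> \<and> nonzero_rep_morphism v G act \<X> M \<rho> f1 \<and>
    nonzero_rep_morphism v G act \<X> M \<rho> f2"
  then have irr: "irreducible_smooth_rep v G M \<rho>" and smooth: "smooth_rep v G M \<rho>"
    unfolding irreducible_smooth_rep_def by blast+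
  note eqv = equivariant_map.intro[OF ordered_action_axioms equivariant_map_axioms.intro[OF smooth]]
  \<comment> \<open>The notion \<open>vanishes_on\<close>, with the morphism as an explicit argument, so that different
    morphisms can be compared.\<close>
  define van where "van = (\<lambda>f W. \<forall>\<phi> \<in> Schw_on W. f \<phi> = \<zero>\<^bsub>M\<^esub>)"
  have van_eq: "equivariant_map.vanishes_on v \<X> M f W = van f W"
    if "rep_morphism v G act \<X> M \<rho> f" for f W
    unfolding van_def using equivariant_map.vanishes_on_def[OF eqv[OF that]] .
  define leading where "leading = (\<lambda>f Y. Y \<in> strata \<and> van f (above Y) \<and> \<not> van f (up Y))"
  have leading_ex: "\<exists>Y. leading f Y" if "nonzero_rep_morphism v G act \<X> M \<rho> f" for f
  proof -
    have f: "rep_morphism v G act \<X> M \<rho> f" using that unfolding nonzero_rep_morphism_def by blast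
    show ?thesis
      using equivariant_map.leading_stratum[OF eqv[OF f]] that
      unfolding nonzero_rep_morphism_def leading_def van_eq[OF f] by metis
  qed
  have descent: "\<exists>f'. nonzero_rep_morphism v G act (subvar \<X> Y) M \<rho> f' \<and>
      (\<forall>\<phi> \<in> Schw_on (up Y). f' (restr Y \<phi>) = f \<phi>)"
    if f: "rep_morphism v G act \<X> M \<rho> f" and Y: "leading f Y" for f Y
  proof -
    have Y': "Y \<in> strata" "van f (above Y)" "\<not> van f (up Y)" using Y unfolding leading_def by auto
    obtain f' where f': "rep_morphism v G act (subvar \<X> Y) M \<rho> f'"
      "\<And>\<phi>. \<phi> \<in> Schw_on (up Y) \<Longrightarrow> f' (restr Y \<phi>) = f \<phi>"
      using equivariant_map.descend[OF eqv[OF f] Y'(1)] Y'(2) unfolding van_eq[OF f] by blast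
    obtain \<phi> where \<phi>: "\<phi> \<in> Schw_on (up Y)" "f \<phi> \<noteq> \<zero>\<^bsub>M\<^esub>" using Y'(3) unfolding van_def by blast
    then have "f' (restr Y \<phi>) \<noteq> \<zero>\<^bsub>M\<^esub>" "restr Y \<phi> \<in> Schw v (subvar \<X> Y)"
      using f'(2) restr_schwartz[OF Y'(1)] by simp_all
    then show ?thesis using f' unfolding nonzero_rep_morphism_def by blast
  qed
  \<comment> \<open>The lifting property applies at any leading orbit, since \<open>\<pi>\<close> is in its spectrum.\<close>
  have lift: "van f (above Y)"
    if f: "nonzero_rep_morphism v G act \<X> M \<rho> f" and h: "rep_morphism v G act \<X> M \<rho> h" "leading h Y" for f h Y
  proof -
    have Y: "Y \<in> strata" using h(2) unfolding leading_def by blast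
    have "(M, \<rho>) \<in> spectrum v G act (subvar \<X> Y)"
      using descent[OF h] irr unfolding spectrum_def by blast
    moreover have "lifting_property v G act \<X> M \<rho>" using assms(7) irr by blast
    ultimately have "\<forall>\<phi> \<in> Schw v \<X>. supp (NT \<X>) \<phi>
             \<subseteq> (\<Union>Y' \<in> {Y'. le Y Y' \<and> Y' \<noteq> Y}. rat_pts (subvar \<X> Y')) \<longrightarrow> f \<phi> = \<zero>\<^bsub>M\<^esub>"
      using f Y unfolding lifting_property_def by blast
    moreover have "(\<Union>Y' \<in> {Y'. le Y Y' \<and> Y' \<noteq> Y}. rat_pts (subvar \<X> Y')) = above Y"
      unfolding above_def using rat_pts_stratum by (auto simp: le_iff)
    ultimately show ?thesis unfolding van_def by simp
  qed
  have leading_le: "le Y' Y"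
    if f: "nonzero_rep_morphism v G act \<X> M \<rho> f" "leading f Y'"
      and h: "rep_morphism v G act \<X> M \<rho> h" "leading h Y" for f h Y Y'
  proof (rule ccontr)
    assume nle: "\<not> le Y' Y"
    have Y: "Y \<in> strata" "Y' \<in> strata" using f(2) h(2) unfolding leading_def by auto
    then have "le Y Y'" using nle le_total by blast
    then have "le Y Y1 \<and> Y1 \<noteq> Y" if "le Y' Y1" for Y1
      using le_trans[OF _ that] that nle by metis
    then have "up Y' \<subseteq> above Y" unfolding up_def above_def by (intro UN_mono) auto
    then have "van f (up Y')" using lift[OF f(1) h] unfolding van_def by blast
    then show False using f(2) unfolding leading_def by blast
  qed
  have f1: "nonzero_rep_morphism v G act \<X> M \<rho> f1" "rep_morphism v G act \<X> M \<rho> f1"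
    and f2: "nonzero_rep_morphism v G act \<X> M \<rho> f2" "rep_morphism v G act \<X> M \<rho> f2"
    using * unfolding nonzero_rep_morphism_def by blast+
  obtain Y where Y: "leading f1 Y" using leading_ex[OF f1(1)] by blast
  have same: "Y' = Y" if "nonzero_rep_morphism v G act \<X> M \<rho> f" "leading f Y'" for f Y'
    using leading_le[OF that f1(2) Y] leading_le[OF f1(1) Y _ that(2)] that(1) le_antisym
    unfolding nonzero_rep_morphism_def by blast
  have Y2: "leading f2 Y" using leading_ex[OF f2(1)] same[OF f2(1)] by blast
  have YO: "Y \<in> strata" using Y unfolding leading_def by blast
  obtain f1' where f1': "nonzero_rep_morphism v G act (subvar \<X> Y) M \<rho> f1'"
      "\<forall>\<phi> \<in> Schw_on (up Y). f1' (restr Y \<phi>) = f1 \<phi>"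
    using descent[OF f1(2) Y] by blast
  obtain f2' where f2': "nonzero_rep_morphism v G act (subvar \<X> Y) M \<rho> f2'"
      "\<forall>\<phi> \<in> Schw_on (up Y). f2' (restr Y \<phi>) = f2 \<phi>"
    using descent[OF f2(2) Y2] by blast
  obtain c where c: "\<forall>\<psi> \<in> Schw v (subvar \<X> Y). f2' \<psi> = c \<odot>\<^bsub>M\<^esub> f1' \<psi>"
    using assms(8) YO irr f1'(1) f2'(1) unfolding multiplicity_free_def by blast
  have proportional: "f2 \<phi> = c \<odot>\<^bsub>M\<^esub> f1 \<phi>" if "\<phi> \<in> Schw_on (up Y)" for \<phi>
    using c restr_schwartz[OF YO that] f1'(2) f2'(2) that by auto
  interpret E1: equivariant_map v G act \<X> M \<rho> f1 by (rule eqv[OF f1(2)])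
  interpret E2: equivariant_map v G act \<X> M \<rho> f2 by (rule eqv[OF f2(2)])
  interpret M: module complex_ring M by (rule E1.module_M)
  \<comment> \<open>The morphism \<open>f2 - c f1\<close> would have leading orbit \<open>Y\<close> if it were non-zero.\<close>
  define h where "h = (\<lambda>\<phi>. (- c) \<odot>\<^bsub>M\<^esub> f1 \<phi> \<oplus>\<^bsub>M\<^esub> f2 \<phi>)"
  have h: "rep_morphism v G act \<X> M \<rho> h"
    unfolding rep_morphism_def
  proof (intro conjI ballI allI)
    fix \<phi> \<psi> d assume \<phi>: "\<phi> \<in> Schw v \<X>" and \<psi>: "\<psi> \<in> Schw v \<X>"
    show "h \<phi> \<in> carrier M" unfolding h_def using E1.f_closed[OF \<phi>] E2.f_closed[OF \<phi>] by simp
    note cl = E1.f_closed[OF \<phi>] E2.f_closed[OF \<phi>] E1.f_closed[OF \<psi>] E2.f_closed[OF \<psi>]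
    have "(- c) \<odot>\<^bsub>M\<^esub> (d \<odot>\<^bsub>M\<^esub> f1 \<phi>) = d \<odot>\<^bsub>M\<^esub> ((- c) \<odot>\<^bsub>M\<^esub> f1 \<phi>)"
      using cl M.smult_assoc1[of "- c" d "f1 \<phi>"] M.smult_assoc1[of d "- c" "f1 \<phi>"] by (simp add: mult.commute)
    then show "h (\<lambda>y. d * \<phi> y + \<psi> y) = d \<odot>\<^bsub>M\<^esub> h \<phi> \<oplus>\<^bsub>M\<^esub> h \<psi>"
      unfolding h_def E1.f_lincomb[OF \<phi> \<psi>] E2.f_lincomb[OF \<phi> \<psi>]
      using cl by (simp add: M.smult_r_distr M.a_ac)
  next
    fix g \<phi> assume g: "g \<in> carrier (rat_group G)" and \<phi>: "\<phi> \<in> Schw v \<X>"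
    have "\<rho> g ((- c) \<odot>\<^bsub>M\<^esub> f1 \<phi> \<oplus>\<^bsub>M\<^esub> f2 \<phi>) = (- c) \<odot>\<^bsub>M\<^esub> \<rho> g (f1 \<phi>) \<oplus>\<^bsub>M\<^esub> \<rho> g (f2 \<phi>)"
      using smooth g E1.f_closed[OF \<phi>] E2.f_closed[OF \<phi>] unfolding smooth_rep_def by blast
    then show "h (translate G act \<X> g \<phi>) = \<rho> g (h \<phi>)"
      unfolding h_def using E1.f_translate E2.f_translate g \<phi> by simp
  qed
  have "h \<phi> = \<zero>\<^bsub>M\<^esub>" if \<phi>: "\<phi> \<in> Schw v \<X>" for \<phi>
  proof (rule ccontr)
    assume "h \<phi> \<noteq> \<zero>\<^bsub>M\<^esub>"
    then have nz: "nonzero_rep_morphism v G act \<X> M \<rho> h"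
      using h \<phi> unfolding nonzero_rep_morphism_def by blast
    then obtain Y' where Y': "leading h Y'" using leading_ex by blast
    then have "leading h Y" using same[OF nz Y'] by simp
    then obtain \<psi> where \<psi>: "\<psi> \<in> Schw_on (up Y)" "h \<psi> \<noteq> \<zero>\<^bsub>M\<^esub>" unfolding leading_def van_def by blast
    have "h \<psi> = \<zero>\<^bsub>M\<^esub>"
      unfolding h_def proportional[OF \<psi>(1)]
      using complex_module_neg[OF E1.module_M E1.f_closed, of \<psi> c] \<psi>(1) by simp
    then show False using \<psi>(2) by simp
  qed
  then have "\<forall>\<phi> \<in> Schw v \<X>. f2 \<phi> = c \<odot>\<^bsub>M\<^esub> f1 \<phi>"
    using complex_module_eqI[OF E1.module_M E1.f_closed E2.f_closed] unfolding h_def by blast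
  then show "\<exists>c. \<forall>\<phi> \<in> Schw v \<X>. f2 \<phi> = c \<odot>\<^bsub>M\<^esub> f1 \<phi>" by blast
qed

end
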